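(* Let $n\ge2$, let $\Omega\subset\mathbb{R}^n$ be a smooth and bounded domain, and let $m>0$. Let $u_0\in C^1(\Omega)\cap L^\infty(\Omega)\cap H^1(\Omega)$ extend continuously to a strictly positive function on $\overline\Omega$ with $u_0|_{\partial\Omega}\in C^1(\partial\Omega)$, and let $h_0=\dfrac{m|u_0|}{\int_{\partial\Omega}|u_0|\,d\sigma}$ on $\partial\Omega$. For $k\ge0$, inductively let $u_{k+1}\in C^2(\Omega)\cap C^1(\overline\Omega)$ be the unique solution of $$\begin{cases}-\Delta u_{k+1}=R_m(u_k)\,u_k & \text{in }\Omega,\\ u_{k+1}+h_k\,\partial_\nu u_{k+1}=0 & \text{on }\partial\Omega,\end{cases}\qquad\text{and}\qquad h_{k+1}=\frac{m|u_{k+1}|}{\int_{\partial\Omega}|u_{k+1}|\,d\sigma}\ \text{ on }\partial\Omega.$$ Then the sequence $\{u_k\}_{k=1}^\infty$ is uniformly bounded in $H^1(\Omega)$.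
   Context: Here $\nu$ is the outward-pointing unit normal to $\partial\Omega$, $\partial_\nu u=\nabla u\cdot\nu$, and $\sigma$ is surface measure on $\partial\Omega$. For $v\in H^1(\Omega)$, $v\not\equiv0$, $$R_m(v)=\frac{\int_\Omega|\nabla v|^2\,dx+\frac1m\left(\int_{\partial\Omega}|v|\,d\sigma\right)^2}{\int_\Omega v^2\,dx},$$ with boundary values in the trace sense. The iteration is well-defined, and all $u_k$ are strictly positive on $\overline\Omega$ and all $h_k$ are strictly positive on $\partial\Omega$. *)

theory Defs
  imports "HOL-Analysis.Analysis"
begin

section \<open>Classical derivatives and spaces of differentiable functions\<close>

definition partial_deriv :: "'a::euclidean_space \<Rightarrow> ('a \<Rightarrow> real) \<Rightarrow> 'a \<Rightarrow> real" where
  "partial_deriv b f x = frechet_derivative f (at x) b"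

definition grad :: "('a::euclidean_space \<Rightarrow> real) \<Rightarrow> 'a \<Rightarrow> 'a" where
  "grad f x = (\<Sum>b\<in>Basis. partial_deriv b f x *\<^sub>R b)"

definition laplacian :: "('a::euclidean_space \<Rightarrow> real) \<Rightarrow> 'a \<Rightarrow> real" where
  "laplacian f x = (\<Sum>b\<in>Basis. partial_deriv b (partial_deriv b f) x)"

text \<open>\<open>Ck_on k S f\<close> is \<open>f \<in> C\<^sup>k(S)\<close>; it is meant for open \<open>S\<close> only.\<close>

primrec Ck_on :: "nat \<Rightarrow> 'a::euclidean_space set \<Rightarrow> ('a \<Rightarrow> real) \<Rightarrow> bool" where
  "Ck_on 0 S f \<longleftrightarrow> continuous_on S f"
| "Ck_on (Suc k) S f \<longleftrightarrow>
     (\<forall>x\<in>S. f differentiable (at x)) \<and> (\<forall>b\<in>Basis. Ck_on k S (partial_deriv b f))"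

definition smooth_on :: "'a::euclidean_space set \<Rightarrow> ('a \<Rightarrow> real) \<Rightarrow> bool" where
  "smooth_on S f \<longleftrightarrow> (\<forall>k. Ck_on k S f)"

text \<open>\<open>C\<^sup>1\<close> of the closure of an open set \<open>\<Omega>\<close>: the function and its gradient on \<open>\<Omega>\<close> extend
  continuously to \<open>closure \<Omega>\<close>. Only the values on \<open>closure \<Omega>\<close> matter.\<close>

definition C1_closure :: "'a::euclidean_space set \<Rightarrow> ('a \<Rightarrow> real) \<Rightarrow> bool" where
  "C1_closure \<Omega> f \<longleftrightarrow> Ck_on 1 \<Omega> f \<and> continuous_on (closure \<Omega>) f \<and>
     (\<exists>G. continuous_on (closure \<Omega>) G \<and> (\<forall>x\<in>\<Omega>. G x = grad f x))"

text \<open>\<open>C\<^sup>1\<close> on a hypersurface \<open>S\<close>: locally the restriction of a \<open>C\<^sup>1\<close> function of the ambient space.\<close>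

definition C1_hypersurface :: "'a::euclidean_space set \<Rightarrow> ('a \<Rightarrow> real) \<Rightarrow> bool" where
  "C1_hypersurface S f \<longleftrightarrow>
     (\<forall>p\<in>S. \<exists>U F. open U \<and> p \<in> U \<and> Ck_on 1 U F \<and> (\<forall>x\<in>S \<inter> U. F x = f x))"


section \<open>Smooth domains, outward normal and surface measure\<close>

text \<open>\<open>boundary_graph \<Omega> p r e \<gamma>\<close>: inside \<open>ball p r\<close> the set \<open>\<Omega>\<close> is the region above the graph of a
  smooth function \<open>\<gamma>\<close> of \<open>n - 1\<close> variables, the vertical direction \<open>e\<close> being a signed coordinate
  direction. A function on the hyperplane orthogonal to \<open>e\<close> is encoded as a function on the whole
  space that is constant along \<open>e\<close>; in particular its gradient is orthogonal to \<open>e\<close>.\<close>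

definition boundary_graph ::
  "'a::euclidean_space set \<Rightarrow> 'a \<Rightarrow> real \<Rightarrow> 'a \<Rightarrow> ('a \<Rightarrow> real) \<Rightarrow> bool" where
  "boundary_graph \<Omega> p r e \<gamma> \<longleftrightarrow>
     r > 0 \<and> (e \<in> Basis \<or> - e \<in> Basis) \<and>
     smooth_on UNIV \<gamma> \<and> (\<forall>x t. \<gamma> (x + t *\<^sub>R e) = \<gamma> x) \<and>
     \<Omega> \<inter> ball p r = {x \<in> ball p r. \<gamma> x < x \<bullet> e}"

definition smooth_bounded_domain :: "'a::euclidean_space set \<Rightarrow> bool" where
  "smooth_bounded_domain \<Omega> \<longleftrightarrow>
     open \<Omega> \<and> connected \<Omega> \<and> \<Omega> \<noteq> {} \<and> bounded \<Omega> \<and>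
     (\<forall>p\<in>frontier \<Omega>. \<exists>r e \<gamma>. boundary_graph \<Omega> p r e \<gamma>)"

definition tangent_vector :: "'a::euclidean_space set \<Rightarrow> 'a \<Rightarrow> 'a \<Rightarrow> bool" where
  "tangent_vector S p w \<longleftrightarrow>
     (\<exists>c d. c 0 = p \<and> d > 0 \<and> (\<forall>t. \<bar>t\<bar> < d \<longrightarrow> c t \<in> S) \<and> (c has_vector_derivative w) (at (0::real)))"

definition outward_normal :: "'a::euclidean_space set \<Rightarrow> 'a \<Rightarrow> 'a" where
  "outward_normal \<Omega> p = (THE v. norm v = 1 \<and>
     (\<forall>w. tangent_vector (frontier \<Omega>) p w \<longrightarrow> v \<bullet> w = 0) \<and>
     (\<forall>\<^sub>F t in at_right (0::real). p + t *\<^sub>R v \<notin> \<Omega>))"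

text \<open>The boundary value of the gradient is its continuous extension from \<open>\<Omega>\<close>.\<close>

definition normal_derivative :: "'a::euclidean_space set \<Rightarrow> ('a \<Rightarrow> real) \<Rightarrow> 'a \<Rightarrow> real" where
  "normal_derivative \<Omega> f p = Lim (at p within \<Omega>) (grad f) \<bullet> outward_normal \<Omega> p"

text \<open>Area of the part in \<open>A\<close> of the graph of \<open>\<gamma>\<close> over the hyperplane orthogonal to \<open>e\<close>, that is
  \<open>\<integral> \<sqrt>(1 + |\<nabla>\<gamma>|\<^sup>2) dy\<close> over those \<open>y\<close> in the hyperplane with \<open>y + \<gamma>(y) e \<in> A\<close>. The hyperplane
  carries the product of the one-dimensional Lebesgue measures of the remaining coordinates.\<close>

definition hyperplane_point :: "'a::euclidean_space \<Rightarrow> ('a \<Rightarrow> real) \<Rightarrow> 'a" where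
  "hyperplane_point e y = (\<Sum>i\<in>Basis - {e, - e}. y i *\<^sub>R i)"

definition graph_area :: "'a::euclidean_space \<Rightarrow> ('a \<Rightarrow> real) \<Rightarrow> 'a set \<Rightarrow> ennreal" where
  "graph_area e \<gamma> A =
     (\<integral>\<^sup>+ y. ennreal (sqrt (1 + (norm (grad \<gamma> (hyperplane_point e y)))\<^sup>2)) *
            indicator A (hyperplane_point e y + \<gamma> (hyperplane_point e y) *\<^sub>R e)
       \<partial>(\<Pi>\<^sub>M i\<in>Basis - {e, - e}. lborel))"

text \<open>The surface measure on \<open>frontier \<Omega>\<close> is the Borel measure given by the area formula in each
  local graph representation.\<close>

definition is_surface_measure :: "'a::euclidean_space set \<Rightarrow> 'a measure \<Rightarrow> bool" where
  "is_surface_measure \<Omega> \<sigma> \<longleftrightarrow>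
     sets \<sigma> = sets (restrict_space borel (frontier \<Omega>)) \<and>
     (\<forall>p r e \<gamma> A. boundary_graph \<Omega> p r e \<gamma> \<longrightarrow> A \<in> sets borel \<longrightarrow> A \<subseteq> frontier \<Omega> \<inter> ball p r \<longrightarrow>
        emeasure \<sigma> A = graph_area e \<gamma> A)"

definition surface_measure :: "'a::euclidean_space set \<Rightarrow> 'a measure" where
  "surface_measure \<Omega> = (THE \<sigma>. is_surface_measure \<Omega> \<sigma>)"


section \<open>The Sobolev space \<open>H\<^sup>1\<close> and boundary traces\<close>

definition L2_on :: "'a::euclidean_space set \<Rightarrow> ('a \<Rightarrow> 'b::euclidean_space) \<Rightarrow> bool" where
  "L2_on \<Omega> f \<longleftrightarrow> f \<in> borel_measurable (lebesgue_on \<Omega>) \<and>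
     integrable (lebesgue_on \<Omega>) (\<lambda>x. (norm (f x))\<^sup>2)"

definition Linf_on :: "'a::euclidean_space set \<Rightarrow> ('a \<Rightarrow> real) \<Rightarrow> bool" where
  "Linf_on \<Omega> f \<longleftrightarrow> f \<in> borel_measurable (lebesgue_on \<Omega>) \<and>
     (\<exists>C. AE x in lebesgue_on \<Omega>. \<bar>f x\<bar> \<le> C)"

definition test_function :: "'a::euclidean_space set \<Rightarrow> ('a \<Rightarrow> real) \<Rightarrow> bool" where
  "test_function \<Omega> \<phi> \<longleftrightarrow> smooth_on UNIV \<phi> \<and>
     compact (closure {x. \<phi> x \<noteq> 0}) \<and> closure {x. \<phi> x \<noteq> 0} \<subseteq> \<Omega>"

definition is_weak_grad :: "'a::euclidean_space set \<Rightarrow> ('a \<Rightarrow> real) \<Rightarrow> ('a \<Rightarrow> 'a) \<Rightarrow> bool" where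
  "is_weak_grad \<Omega> v g \<longleftrightarrow>
     (\<forall>\<phi>. test_function \<Omega> \<phi> \<longrightarrow> (\<forall>b\<in>Basis.
        (LINT x|lebesgue_on \<Omega>. v x * partial_deriv b \<phi> x) =
        - (LINT x|lebesgue_on \<Omega>. (g x \<bullet> b) * \<phi> x)))"

definition H1 :: "'a::euclidean_space set \<Rightarrow> ('a \<Rightarrow> real) set" where
  "H1 \<Omega> = {v. L2_on \<Omega> v \<and> (\<exists>g. L2_on \<Omega> g \<and> is_weak_grad \<Omega> v g)}"

text \<open>Weak gradients and traces are determined up to null sets only; a representative is chosen.\<close>

definition weak_grad :: "'a::euclidean_space set \<Rightarrow> ('a \<Rightarrow> real) \<Rightarrow> 'a \<Rightarrow> 'a" where
  "weak_grad \<Omega> v = (SOME g. L2_on \<Omega> g \<and> is_weak_grad \<Omega> v g)"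

definition H1_norm :: "'a::euclidean_space set \<Rightarrow> ('a \<Rightarrow> real) \<Rightarrow> real" where
  "H1_norm \<Omega> v =
     sqrt ((LINT x|lebesgue_on \<Omega>. (v x)\<^sup>2) + (LINT x|lebesgue_on \<Omega>. (norm (weak_grad \<Omega> v x))\<^sup>2))"

text \<open>The trace operator is the continuous extension to \<open>H\<^sup>1(\<Omega>)\<close>, with values in \<open>L\<^sup>2(frontier \<Omega>)\<close>,
  of the restriction map on functions that are \<open>C\<^sup>1\<close> up to the boundary.\<close>

definition is_trace :: "'a::euclidean_space set \<Rightarrow> ('a \<Rightarrow> real) \<Rightarrow> ('a \<Rightarrow> real) \<Rightarrow> bool" where
  "is_trace \<Omega> v g \<longleftrightarrow>
     g \<in> borel_measurable (surface_measure \<Omega>) \<and>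
     integrable (surface_measure \<Omega>) (\<lambda>x. (g x)\<^sup>2) \<and>
     (\<exists>\<phi> :: nat \<Rightarrow> 'a \<Rightarrow> real. (\<forall>j. C1_closure \<Omega> (\<phi> j)) \<and>
        (\<lambda>j. H1_norm \<Omega> (\<lambda>x. \<phi> j x - v x)) \<longlonglongrightarrow> 0 \<and>
        (\<lambda>j. LINT x|surface_measure \<Omega>. (\<phi> j x - g x)\<^sup>2) \<longlonglongrightarrow> 0)"

definition trace_on :: "'a::euclidean_space set \<Rightarrow> ('a \<Rightarrow> real) \<Rightarrow> 'a \<Rightarrow> real" where
  "trace_on \<Omega> v = (SOME g. is_trace \<Omega> v g)"


section \<open>The Rayleigh quotient and the Robin problem\<close>

definition rayleigh :: "'a::euclidean_space set \<Rightarrow> real \<Rightarrow> ('a \<Rightarrow> real) \<Rightarrow> real" where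
  "rayleigh \<Omega> m v =
     ((LINT x|lebesgue_on \<Omega>. (norm (weak_grad \<Omega> v x))\<^sup>2)
        + 1 / m * (LINT x|surface_measure \<Omega>. \<bar>trace_on \<Omega> v x\<bar>)\<^sup>2)
     / (LINT x|lebesgue_on \<Omega>. (v x)\<^sup>2)"

definition robin_solution ::
  "'a::euclidean_space set \<Rightarrow> ('a \<Rightarrow> real) \<Rightarrow> ('a \<Rightarrow> real) \<Rightarrow> ('a \<Rightarrow> real) \<Rightarrow> bool" where
  "robin_solution \<Omega> h f w \<longleftrightarrow>
     Ck_on 2 \<Omega> w \<and> C1_closure \<Omega> w \<and>
     (\<forall>x\<in>\<Omega>. - laplacian w x = f x) \<and>
     (\<forall>x\<in>frontier \<Omega>. w x + h x * normal_derivative \<Omega> w x = 0)"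

end

theory Submission
  imports Defs "HOL-Computational_Algebra.Polynomial"
begin

text \<open>The proof tests the equation for \<open>u\<^bsub>k+1\<^esub>\<close> with \<open>u\<^bsub>k+1\<^esub>\<close>. Write \<open>N = \<partial>\<^sub>\<nu>u\<^bsub>k+1\<^esub>\<close>. The boundary
  condition gives \<open>u\<^bsub>k+1\<^esub> = - h\<^sub>k N\<close> on the boundary, so the boundary term is \<open>\<integral> h\<^sub>k N\<^sup>2\<close>. As
  \<open>\<integral> h\<^sub>k \<le> m\<close>, by Cauchy-Schwarz it is at least \<open>(\<integral> |u\<^bsub>k+1\<^esub>|)\<^sup>2 / m\<close>. Hence the numerator \<open>E\<^bsub>k+1\<^esub>\<close> of
  the Rayleigh quotient satisfies \<open>E\<^bsub>k+1\<^esub> \<le> R\<^sub>m(u\<^sub>k) \<parallel>u\<^sub>k\<parallel> \<parallel>u\<^bsub>k+1\<^esub>\<parallel>\<close>, which means that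
  \<open>R\<^sub>m(u\<^sub>k) \<parallel>u\<^sub>k\<parallel>\<close> is decreasing in \<open>k\<close>, bounded by some \<open>c\<close>, and \<open>E\<^bsub>k+1\<^esub> \<le> c \<parallel>u\<^bsub>k+1\<^esub>\<parallel>\<close>. A Poincare
  inequality \<open>\<parallel>v\<parallel>\<^sup>2 \<le> K E(v)\<close> then bounds \<open>\<parallel>u\<^sub>k\<parallel>\<close> and \<open>E\<^sub>k\<close>.

  The divergence theorem is obtained on epigraphs from translation invariance of the Lebesgue
  measure and a measure-preserving shear. Applied to \<open>\<phi> \<nu>\<close>, it also shows that the area formulas of
  overlapping boundary charts agree, so that the surface measure exists. The Poincare inequality
  combines the interior cone property, which bounds the \<open>L\<^sup>2\<close> norm by the \<open>L\<^sup>1\<close> norm and the gradient,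
  with the divergence theorem for \<open>|v| x\<close>, which bounds the \<open>L\<^sup>1\<close> norm by boundary and gradient terms.\<close>

section \<open>Functions of class \<open>C\<^sup>k\<close>\<close>

text \<open>Two obstacles shape the development. First, the objects of the statement are given by
  descriptions: \<open>surface_measure\<close> and \<open>outward_normal\<close> by
  \<open>THE\<close>, \<open>weak_grad\<close> and \<open>trace_on\<close> by \<open>SOME\<close>.
  Each has to be identified before anything can be computed: the normal through the defining
  function \<open>\<gamma> x - x \<bullet> e\<close>, the measure by gluing over a finite atlas, the
  weak gradient by the fundamental lemma. For the trace one inequality suffices, because the
  Rayleigh quotient of a later iterate is only bounded from above by its boundary values. Second, a
  solution \<open>w\<close> is C2 inside \<Omega> but only C1 up to the boundary, so
  \<open>w grad w\<close> may have no C1 extension to the closure. Its divergence is still bounded,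
  since second derivatives occur in it only as the Laplacian, which the equation prescribes. The
  divergence theorem is therefore stated for fields that are continuous on the closure, C1 inside
  and of bounded divergence; on an epigraph it is proved above the shifted graph
  \<open>\<gamma> + t\<close>, and then t tends to 0.\<close>

lemma partial_deriv_eq:
  assumes "(f has_derivative D) (at x)"
  shows "partial_deriv b f x = D b"
  using frechet_derivative_at[OF assms] by (simp add: partial_deriv_def)

lemma grad_inner:
  assumes "b \<in> Basis"
  shows "grad f x \<bullet> b = partial_deriv b f x"
  using assms by (simp add: grad_def inner_sum_left inner_Basis if_distrib cong: if_cong)

lemma has_derivative_grad:
  assumes "f differentiable (at x)"
  shows "(f has_derivative (\<lambda>h. grad f x \<bullet> h)) (at x)"
proof -
  have D: "(f has_derivative frechet_derivative f (at x)) (at x)"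
    using assms frechet_derivative_works by blast
  have "frechet_derivative f (at x) h = grad f x \<bullet> h" for h
  proof -
    have "frechet_derivative f (at x) h = frechet_derivative f (at x) (\<Sum>b\<in>Basis. (h \<bullet> b) *\<^sub>R b)"
      by (simp add: euclidean_representation)
    also have "\<dots> = (\<Sum>b\<in>Basis. (h \<bullet> b) * frechet_derivative f (at x) b)"
      using has_derivative_linear[OF D] by (simp add: linear_sum linear_scale)
    also have "\<dots> = grad f x \<bullet> h"
      by (simp add: grad_def inner_sum_left inner_sum_right partial_deriv_def inner_commute[of _ h] mult.commute)
    finally show ?thesis .
  qed
  then have "frechet_derivative f (at x) = (\<lambda>h. grad f x \<bullet> h)" by auto
  with D show ?thesis by simp
qed

lemma has_derivative_imp_grad:
  assumes "(f has_derivative (\<lambda>h. g \<bullet> h)) (at x)"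
  shows "grad f x = g"
  by (rule euclidean_eqI) (simp add: grad_inner partial_deriv_eq[OF assms])

lemma Ck_on_subset: "Ck_on k S f \<Longrightarrow> T \<subseteq> S \<Longrightarrow> Ck_on k T f"
  by (induction k arbitrary: f) (auto intro: continuous_on_subset)

text \<open>\<open>partial_deriv\<close> takes full derivatives at a point. On an open set these
  depend only on the values in the set, which lets the induction pass to the partial
  derivatives.\<close>

lemma Ck_on_cong:
  assumes "open S" "\<And>x. x \<in> S \<Longrightarrow> f x = g x"
  shows "Ck_on k S f \<longleftrightarrow> Ck_on k S g"
  using assms(2)
proof (induction k arbitrary: f g)
  case 0
  then show ?case by (auto cong: continuous_on_cong)
next
  case (Suc k)
  have D: "(f has_derivative D) (at x) \<longleftrightarrow> (g has_derivative D) (at x)" if "x \<in> S" for x D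
    using Suc.prems that assms(1) by (metis has_derivative_transform_within_open)
  have "partial_deriv b f x = partial_deriv b g x" if "x \<in> S" for x b
    using D[OF that] by (simp add: partial_deriv_def frechet_derivative_def)
  then have "Ck_on k S (partial_deriv b f) \<longleftrightarrow> Ck_on k S (partial_deriv b g)" for b
    by (rule Suc.IH)
  moreover have "f differentiable at x \<longleftrightarrow> g differentiable at x" if "x \<in> S" for x
    using D[OF that] by (simp add: differentiable_def)
  ultimately show ?case by auto
qed

lemma partial_deriv_cong:
  assumes "open S" "\<And>y. y \<in> S \<Longrightarrow> f y = g y" "x \<in> S"
  shows "partial_deriv b f x = partial_deriv b g x"
proof -
  have "(f has_derivative D) (at x) \<longleftrightarrow> (g has_derivative D) (at x)" for D
    using assms by (metis has_derivative_transform_within_open)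
  then show ?thesis by (simp add: partial_deriv_def frechet_derivative_def)
qed

lemma grad_cong:
  assumes "open S" "\<And>y. y \<in> S \<Longrightarrow> f y = g y" "x \<in> S"
  shows "grad f x = grad g x"
  using partial_deriv_cong[OF assms] by (simp add: grad_def)

lemma Ck_on_imp_continuous_on: "Ck_on k S f \<Longrightarrow> continuous_on S f"
  by (cases k)
    (auto intro!: differentiable_imp_continuous_on differentiable_at_imp_differentiable_on)

lemma Ck_on_SucD: "Ck_on (Suc k) S f \<Longrightarrow> Ck_on k S f"
proof (induction k arbitrary: f)
  case 0
  then show ?case using Ck_on_imp_continuous_on by fastforce
qed auto

text \<open>Trades the family of partial derivatives for one vector-valued function, to which
  continuity rules and gluing over open covers apply directly.\<close>

lemma Ck_on_1_iff:
  "Ck_on 1 S f \<longleftrightarrow> (\<forall>x\<in>S. f differentiable (at x)) \<and> continuous_on S (grad f)"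
proof -
  have "continuous_on S (grad f) \<longleftrightarrow> (\<forall>b\<in>Basis. continuous_on S (partial_deriv b f))"
    by (subst continuous_on_componentwise) (auto simp: grad_inner cong: continuous_on_cong)
  then show ?thesis by simp
qed

lemma Ck_on_1_differentiable: "Ck_on 1 S f \<Longrightarrow> x \<in> S \<Longrightarrow> f differentiable (at x)"
  by simp

lemma Ck_on_1_grad: "Ck_on 1 S f \<Longrightarrow> x \<in> S \<Longrightarrow> (f has_derivative (\<lambda>h. grad f x \<bullet> h)) (at x)"
  by (simp add: has_derivative_grad)

lemma partial_deriv_const [simp]: "partial_deriv b (\<lambda>x. c) = (\<lambda>x. 0)"
  by (rule ext) (rule partial_deriv_eq[OF has_derivative_const])

lemma Ck_on_const [simp]: "Ck_on k S (\<lambda>x. c)"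
  by (induction k arbitrary: c) auto

lemma partial_deriv_add:
  assumes "f differentiable (at x)" "g differentiable (at x)"
  shows "partial_deriv b (\<lambda>x. f x + g x) x = partial_deriv b f x + partial_deriv b g x"
  using partial_deriv_eq[OF has_derivative_add[OF assms[THEN has_derivative_grad]]]
  by (simp add: assms[THEN has_derivative_grad, THEN partial_deriv_eq])

lemma partial_deriv_mult:
  assumes "f differentiable (at x)" "g differentiable (at x)"
  shows "partial_deriv b (\<lambda>x. f x * g x) x = f x * partial_deriv b g x + partial_deriv b f x * g x"
  using partial_deriv_eq[OF has_derivative_mult[OF assms[THEN has_derivative_grad]]]
  by (simp add: assms[THEN has_derivative_grad, THEN partial_deriv_eq])

lemma Ck_on_add:
  assumes "open S"
  shows "Ck_on k S f \<Longrightarrow> Ck_on k S g \<Longrightarrow> Ck_on k S (\<lambda>x. f x + g x)"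
proof (induction k arbitrary: f g)
  case (Suc k)
  have "Ck_on k S (partial_deriv b (\<lambda>x. f x + g x))" if "b \<in> Basis" for b
    using Suc.IH[of "partial_deriv b f" "partial_deriv b g"] Suc.prems that
      Ck_on_cong[OF assms, of "partial_deriv b (\<lambda>x. f x + g x)" "\<lambda>x. partial_deriv b f x + partial_deriv b g x"]
    by (simp add: partial_deriv_add)
  then show ?case using Suc.prems by (auto intro: differentiable_add)
qed (auto intro: continuous_intros)

lemma Ck_on_mult:
  assumes "open S"
  shows "Ck_on k S f \<Longrightarrow> Ck_on k S g \<Longrightarrow> Ck_on k S (\<lambda>x. f x * g x)"
proof (induction k arbitrary: f g)
  case (Suc k)
  have "Ck_on k S (partial_deriv b (\<lambda>x. f x * g x))" if "b \<in> Basis" for b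
  proof -
    have "Ck_on k S (\<lambda>x. f x * partial_deriv b g x + partial_deriv b f x * g x)"
      using Suc.IH Suc.prems that Ck_on_SucD[OF Suc.prems(1)] Ck_on_SucD[OF Suc.prems(2)]
      by (intro Ck_on_add[OF assms] Suc.IH) auto
    moreover have "Ck_on k S (partial_deriv b (\<lambda>x. f x * g x)) \<longleftrightarrow>
        Ck_on k S (\<lambda>x. f x * partial_deriv b g x + partial_deriv b f x * g x)"
      using Suc.prems by (intro Ck_on_cong[OF assms]) (simp add: partial_deriv_mult)
    ultimately show ?thesis by simp
  qed
  then show ?case using Suc.prems by (auto intro: differentiable_mult)
qed (auto intro: continuous_intros)

lemma Ck_on_sum:
  assumes "open S" "\<And>i. i \<in> I \<Longrightarrow> Ck_on k S (f i)"
  shows "Ck_on k S (\<lambda>x. \<Sum>i\<in>I. f i x)"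
  using assms(2) by (induction I rule: infinite_finite_induct) (auto intro: Ck_on_add[OF assms(1)])

lemma Ck_on_prod:
  assumes "open S" "\<And>i. i \<in> I \<Longrightarrow> Ck_on k S (f i)"
  shows "Ck_on k S (\<lambda>x. \<Prod>i\<in>I. f i x)"
  using assms(2) by (induction I rule: infinite_finite_induct) (auto intro: Ck_on_mult[OF assms(1)])

lemma Ck_on_inner_const: "Ck_on k S (\<lambda>x. x \<bullet> c)"
proof (cases k)
  case (Suc l)
  have D: "((\<lambda>x. x \<bullet> c) has_derivative (\<lambda>h. h \<bullet> c)) (at x)" for x :: 'a
    by (intro derivative_eq_intros) auto
  then have "partial_deriv b (\<lambda>x. x \<bullet> c) = (\<lambda>x. b \<bullet> c)" for b :: 'a
    by (intro ext partial_deriv_eq)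
  with D show ?thesis unfolding Suc by (auto intro: differentiableI)
qed (auto intro: continuous_intros)

lemma Ck_on_diff:
  assumes "open S" "Ck_on k S f" "Ck_on k S g"
  shows "Ck_on k S (\<lambda>x. f x - g x)"
  using Ck_on_add[OF assms(1,2) Ck_on_mult[OF assms(1) Ck_on_const[of k S "-1"] assms(3)]] by simp

text \<open>A function of one variable that is smooth on \<open>T\<close> is given by the sequence \<open>G\<close> of its
  derivatives.\<close>

lemma Ck_on_compose:
  fixes G :: "nat \<Rightarrow> real \<Rightarrow> real"
  assumes S: "open S" and f: "Ck_on k S f" and T: "\<And>x. x \<in> S \<Longrightarrow> f x \<in> T"
    and G: "\<And>n t. t \<in> T \<Longrightarrow> (G n has_real_derivative G (Suc n) t) (at t)"
  shows "Ck_on k S (\<lambda>x. G n (f x))"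
  using f
proof (induction k arbitrary: n)
  case 0
  then have "continuous_on S f" by simp
  moreover have "continuous_on T (G n)"
    using G by (meson DERIV_isCont continuous_at_imp_continuous_on)
  ultimately show ?case
    using T by (auto intro!: continuous_on_compose2[of T "G n" S f])
next
  case (Suc k)
  have D: "((\<lambda>x. G n (f x)) has_derivative (\<lambda>h. G (Suc n) (f x) * (grad f x \<bullet> h))) (at x)"
    if "x \<in> S" for x
  proof -
    have "f differentiable (at x)" using Suc.prems that by simp
    from has_derivative_compose[OF has_derivative_grad[OF this]
        G[OF T[OF that], THEN has_field_derivative_imp_has_derivative]]
    show ?thesis .
  qed
  have "Ck_on k S (partial_deriv b (\<lambda>x. G n (f x)))" if b: "b \<in> Basis" for b
  proof -
    have "Ck_on k S (\<lambda>x. G (Suc n) (f x) * partial_deriv b f x)"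
      using Suc.prems Ck_on_SucD[OF Suc.prems] b by (intro Ck_on_mult[OF S] Suc.IH) auto
    moreover have "Ck_on k S (partial_deriv b (\<lambda>x. G n (f x))) \<longleftrightarrow>
        Ck_on k S (\<lambda>x. G (Suc n) (f x) * partial_deriv b f x)"
      using partial_deriv_eq[OF D] b by (intro Ck_on_cong[OF S]) (simp add: grad_inner)
    ultimately show ?thesis by simp
  qed
  with D show ?case by (auto intro: differentiableI)
qed

text \<open>The C1 version asks for one derivative of \<open>g\<close> only and also computes the
  gradient. It serves \<open>1 / sqrt\<close>, \<open>inverse\<close> and the regularized absolute
  value.\<close>

lemma Ck_on_1_compose:
  fixes g g' :: "real \<Rightarrow> real"
  assumes S: "open S" and f: "Ck_on 1 S f" and T: "\<And>x. x \<in> S \<Longrightarrow> f x \<in> T"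
    and g: "\<And>t. t \<in> T \<Longrightarrow> (g has_real_derivative g' t) (at t)" and g': "continuous_on T g'"
  shows "Ck_on 1 S (\<lambda>x. g (f x))"
    and "x \<in> S \<Longrightarrow> grad (\<lambda>x. g (f x)) x = g' (f x) *\<^sub>R grad f x"
proof -
  have D: "((\<lambda>x. g (f x)) has_derivative (\<lambda>h. (g' (f x) *\<^sub>R grad f x) \<bullet> h)) (at x)" if "x \<in> S" for x
  proof -
    have "f differentiable (at x)" using f that by simp
    from has_derivative_compose[OF has_derivative_grad[OF this]
        g[OF T[OF that], THEN has_field_derivative_imp_has_derivative]]
    show ?thesis by simp
  qed
  then show g: "grad (\<lambda>x. g (f x)) x = g' (f x) *\<^sub>R grad f x" if "x \<in> S" for x
    using that has_derivative_imp_grad by blast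
  have "continuous_on S (\<lambda>x. g' (f x) *\<^sub>R grad f x)"
    using f T Ck_on_imp_continuous_on[OF f] unfolding Ck_on_1_iff
    by (intro continuous_intros continuous_on_compose2[OF g']) auto
  then have "continuous_on S (grad (\<lambda>x. g (f x)))"
    using g by (simp cong: continuous_on_cong)
  then show "Ck_on 1 S (\<lambda>x. g (f x))"
    using D unfolding Ck_on_1_iff by (auto intro: differentiableI)
qed

lemma grad_mult:
  assumes "f differentiable (at x)" "g differentiable (at x)"
  shows "grad (\<lambda>x. f x * g x) x = f x *\<^sub>R grad g x + g x *\<^sub>R grad f x"
  by (rule euclidean_eqI) (simp add: grad_inner inner_add_left partial_deriv_mult[OF assms])

lemma grad_diff:
  assumes "f differentiable (at x)" "g differentiable (at x)"
  shows "grad (\<lambda>x. f x - g x) x = grad f x - grad g x"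
  by (rule has_derivative_imp_grad)
    (auto intro!: derivative_eq_intros assms[THEN has_derivative_grad] simp: inner_diff_left)

section \<open>Smooth bump functions\<close>

text \<open>The family of functions p(1/t) exp(-1/t), extended by zero, is closed under
  differentiation, so smoothness of exp(-1/t) needs a single derivative computation.\<close>

definition expinv_poly :: "real poly \<Rightarrow> real \<Rightarrow> real" where
  "expinv_poly p t = (if t \<le> 0 then 0 else poly p (1 / t) * exp (- 1 / t))"

lemma poly_times_exp_minus_tendsto_0: "((\<lambda>s::real. poly p s * exp (- s)) \<longlongrightarrow> 0) at_top"
proof -
  have "((\<lambda>s. \<Sum>i\<le>degree p. coeff p i * (s ^ i / exp s)) \<longlongrightarrow> (\<Sum>i\<le>degree p. coeff p i * 0)) at_top"
    by (intro tendsto_intros tendsto_power_div_exp_0)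
  moreover have "(\<Sum>i\<le>degree p. coeff p i * (s ^ i / exp s)) = poly p s * exp (- s)" for s
    by (simp add: poly_altdef sum_distrib_right exp_minus divide_inverse mult.assoc)
  ultimately show ?thesis by simp
qed

text \<open>In the variable s = 1/t the derivative d/dt is -s^2 d/ds, which turns p(s) exp(-s) into
  s^2 (p - p')(s) exp(-s). The polynomial \<open>[:0, 0, 1:]\<close> is the factor s^2.\<close>

lemma expinv_poly_deriv:
  "(expinv_poly p has_real_derivative expinv_poly ([:0, 0, 1:] * (p - pderiv p)) t) (at t)"
proof -
  consider "t < 0" | "t > 0" | "t = 0" by linarith
  then show ?thesis
  proof cases
    case 1
    have "((\<lambda>_. 0) has_real_derivative 0) (at t)" by simp
    then have "(expinv_poly p has_real_derivative 0) (at t)"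
      by (rule has_field_derivative_transform_within_open[of _ _ _ "{..<0}"])
        (use 1 in \<open>auto simp: expinv_poly_def\<close>)
    with 1 show ?thesis by (simp add: expinv_poly_def)
  next
    case 2
    have inv: "((\<lambda>t. 1 / t) has_real_derivative - (1 / t\<^sup>2)) (at t)"
      using 2 by (auto intro!: derivative_eq_intros simp: power2_eq_square)
    have e: "((\<lambda>t. exp (- 1 / t)) has_real_derivative exp (- 1 / t) * (1 / t\<^sup>2)) (at t)"
      using DERIV_chain2[OF DERIV_exp DERIV_minus[OF inv]] by simp
    have "((\<lambda>t. poly p (1 / t)) has_real_derivative poly (pderiv p) (1 / t) * - (1 / t\<^sup>2)) (at t)"
      by (rule DERIV_chain2[OF poly_DERIV inv])
    note DERIV_mult[OF this e]
    then have "((\<lambda>t. poly p (1 / t) * exp (- 1 / t)) has_real_derivative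
        expinv_poly ([:0, 0, 1:] * (p - pderiv p)) t) (at t)"
    proof (rule DERIV_cong)
      have ring: "b * - X * E + E * X * a = X * (a - b) * E" for a b X E :: real
        by (simp add: algebra_simps)
      have "poly ([:0, 0, 1:] * (p - pderiv p)) (1 / t)
          = (1 / t\<^sup>2) * (poly p (1 / t) - poly (pderiv p) (1 / t))"
        by (simp add: power2_eq_square)
      then have "expinv_poly ([:0, 0, 1:] * (p - pderiv p)) t =
          (1 / t\<^sup>2) * (poly p (1 / t) - poly (pderiv p) (1 / t)) * exp (- 1 / t)"
        using 2 by (simp only: expinv_poly_def if_False not_le[symmetric])
      then show "poly (pderiv p) (1 / t) * - (1 / t\<^sup>2) * exp (- 1 / t) + exp (- 1 / t) * (1 / t\<^sup>2) * poly p (1 / t)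
          = expinv_poly ([:0, 0, 1:] * (p - pderiv p)) t"
        using ring[of "poly (pderiv p) (1 / t)" "1 / t\<^sup>2" "exp (- 1 / t)" "poly p (1 / t)"] by (simp only:)
    qed
    then show ?thesis
      by (rule has_field_derivative_transform_within_open[of _ _ _ "{0<..}"])
        (use 2 in \<open>auto simp: expinv_poly_def\<close>)
  next
    case 3
    \<comment> \<open>At the origin the right difference quotient is of the same form: dividing by h
      multiplies by s = 1/h, which turns \<open>p\<close> into \<open>pCons 0 p\<close>.\<close>
    have "((\<lambda>s. poly (pCons 0 p) s * exp (- s)) \<longlongrightarrow> 0) at_top"
      by (rule poly_times_exp_minus_tendsto_0)
    moreover have "\<forall>\<^sub>F s in at_top. poly (pCons 0 p) s * exp (- s) = expinv_poly p (inverse s) / inverse s"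
      using eventually_gt_at_top[of 0] by eventually_elim (simp add: expinv_poly_def not_le inverse_eq_divide)
    ultimately have "((\<lambda>s. expinv_poly p (inverse s) / inverse s) \<longlongrightarrow> 0) at_top"
      by (rule Lim_transform_eventually)
    then have "((\<lambda>h. expinv_poly p h / h) \<longlongrightarrow> 0) (at_right 0)"
      by (simp add: filterlim_at_right_to_top)
    moreover have "((\<lambda>h. expinv_poly p h / h) \<longlongrightarrow> 0) (at_left 0)"
      by (rule tendsto_eventually)
        (auto simp: eventually_at_filter expinv_poly_def intro!: always_eventually)
    ultimately have "((\<lambda>h. expinv_poly p h / h) \<longlongrightarrow> 0) (at 0)"
      by (simp add: filterlim_split_at)
    with 3 show ?thesis by (simp add: has_field_derivative_iff expinv_poly_def)
  qed
qed

definition expinv :: "real \<Rightarrow> real" where "expinv = expinv_poly 1"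

lemma expinv_nonneg: "0 \<le> expinv t" and expinv_le_1: "expinv t \<le> 1"
  and expinv_pos_iff: "0 < expinv t \<longleftrightarrow> 0 < t" and expinv_eq_0_iff: "expinv t = 0 \<longleftrightarrow> t \<le> 0"
  by (auto simp: expinv_def expinv_poly_def)

lemma Ck_on_expinv:
  assumes "open S" "Ck_on k S f"
  shows "Ck_on k S (\<lambda>x. expinv (f x))"
proof -
  \<comment> \<open>The successive derivatives of \<open>expinv\<close>, obtained by iterating the
    polynomial map of \<open>expinv_poly_deriv\<close> from 1.\<close>
  define G where "G n = expinv_poly (((\<lambda>p. [:0, 0, 1:] * (p - pderiv p)) ^^ n) 1)" for n
  have "(G n has_real_derivative G (Suc n) t) (at t)" for n t
    unfolding G_def using expinv_poly_deriv by simp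
  then have "Ck_on k S (\<lambda>x. G 0 (f x))"
    by (intro Ck_on_compose[OF assms, of UNIV]) auto
  then show ?thesis by (simp add: G_def expinv_def)
qed

definition ball_bump :: "'a::euclidean_space \<Rightarrow> real \<Rightarrow> 'a \<Rightarrow> real" where
  "ball_bump p r x = expinv (r\<^sup>2 - (norm (x - p))\<^sup>2)"

lemma smooth_on_ball_bump: "smooth_on UNIV (ball_bump p r)"
proof -
  have "r\<^sup>2 - (norm (x - p))\<^sup>2 = r\<^sup>2 - (\<Sum>i\<in>Basis. (x \<bullet> i - p \<bullet> i) * (x \<bullet> i - p \<bullet> i))" for x
    unfolding power2_norm_eq_inner by (subst euclidean_inner) (simp add: inner_diff_left)
  then show ?thesis
    unfolding smooth_on_def ball_bump_def
    by (auto intro!: Ck_on_expinv Ck_on_diff Ck_on_sum Ck_on_mult Ck_on_inner_const)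
qed

lemma ball_bump_nonneg: "0 \<le> ball_bump p r x"
  by (simp add: ball_bump_def expinv_nonneg)

lemma ball_bump_pos_iff: "r > 0 \<Longrightarrow> 0 < ball_bump p r x \<longleftrightarrow> x \<in> ball p r"
  using power2_less_imp_less[of "norm (x - p)" r] power_strict_mono[of "norm (x - p)" r 2]
  by (auto simp: ball_bump_def expinv_pos_iff dist_norm norm_minus_commute)

lemma ball_bump_eq_0: "r > 0 \<Longrightarrow> x \<notin> ball p r \<Longrightarrow> ball_bump p r x = 0"
  using ball_bump_pos_iff[of r p x] ball_bump_nonneg[of p r x] by linarith

text \<open>The parameter \<open>c\<close> steepens the bump: at a point of the box each factor is
  exp(-1/(c q)) with q > 0 and tends to 1 as \<open>c\<close> grows. The bumps thus approximate the
  indicator of the box from below.\<close>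

definition box_bump :: "'a::euclidean_space \<Rightarrow> 'a \<Rightarrow> real \<Rightarrow> 'a \<Rightarrow> real" where
  "box_bump a b c x = (\<Prod>i\<in>Basis. expinv (c * ((x \<bullet> i - a \<bullet> i) * (b \<bullet> i - x \<bullet> i))))"

lemma smooth_on_box_bump: "smooth_on UNIV (box_bump a b c)"
  unfolding smooth_on_def box_bump_def
  by (auto intro!: Ck_on_expinv Ck_on_diff Ck_on_prod Ck_on_mult Ck_on_inner_const)

lemma box_bump_nonneg: "0 \<le> box_bump a b c x" and box_bump_le_1: "box_bump a b c x \<le> 1"
  by (auto simp: box_bump_def intro!: prod_nonneg prod_le_1 expinv_nonneg expinv_le_1)

text \<open>The empty box is an exception: if b_i < a_i, the product (x_i - a_i)(b_i - x_i) is
  positive strictly between b_i and a_i.\<close>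

lemma box_bump_eq_0:
  assumes "c > 0" "x \<notin> box a b"
  shows "box_bump a b c x = 0 \<or> box a b = {}"
proof (cases "box a b = {}")
  case False
  then have ab: "a \<bullet> i < b \<bullet> i" if "i \<in> Basis" for i using that by (simp add: box_ne_empty)
  from assms(2) obtain i where i: "i \<in> Basis" "x \<bullet> i \<le> a \<bullet> i \<or> b \<bullet> i \<le> x \<bullet> i"
    by (auto simp: mem_box not_less)
  then have "(x \<bullet> i - a \<bullet> i) * (b \<bullet> i - x \<bullet> i) \<le> 0"
    using ab[OF i(1)] i(2) by (auto simp: mult_le_0_iff)
  then have "expinv (c * ((x \<bullet> i - a \<bullet> i) * (b \<bullet> i - x \<bullet> i))) = 0"
    using assms(1) by (simp add: expinv_eq_0_iff mult_le_0_iff)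
  then show ?thesis using i(1) by (auto simp: box_bump_def)
qed auto

lemma box_bump_tendsto:
  assumes "box a b \<noteq> {}"
  shows "(\<lambda>j. box_bump a b (real (Suc j)) x) \<longlonglongrightarrow> indicator (box a b) x"
proof (cases "x \<in> box a b")
  case True
  have "(\<lambda>j. expinv (real (Suc j) * ((x \<bullet> i - a \<bullet> i) * (b \<bullet> i - x \<bullet> i)))) \<longlonglongrightarrow> 1" if i: "i \<in> Basis" for i
  proof -
    define q where "q = (x \<bullet> i - a \<bullet> i) * (b \<bullet> i - x \<bullet> i)"
    have q: "q > 0" using True i by (simp add: q_def mem_box)
    have "(\<lambda>j. exp (- inverse (real (Suc j)) * (1 / q))) \<longlonglongrightarrow> exp (- 0 * (1 / q))"
      by (intro tendsto_intros LIMSEQ_inverse_real_of_nat)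
    moreover have "expinv (real (Suc j) * q) = exp (- inverse (real (Suc j)) * (1 / q))" for j
    proof -
      have "\<not> real (Suc j) * q \<le> 0" using q by (simp only: mult_le_0_iff) auto
      then show ?thesis by (simp add: expinv_def expinv_poly_def inverse_eq_divide)
    qed
    ultimately show ?thesis by (simp add: q_def)
  qed
  then have "(\<lambda>j. box_bump a b (real (Suc j)) x) \<longlonglongrightarrow> (\<Prod>i\<in>(Basis::'a set). 1)"
    unfolding box_bump_def by (intro tendsto_prod)
  with True show ?thesis by simp
next
  case False
  then have "box_bump a b (real (Suc j)) x = 0" for j
    using box_bump_eq_0[of "real (Suc j)" x a b] assms by simp
  with False show ?thesis by simp
qed

lemma box_bump_support:
  assumes "c > 0" "box a b \<noteq> {}"
  shows "{x. box_bump a b c x \<noteq> 0} \<subseteq> cbox a b"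
  using box_bump_eq_0[OF assms(1)] assms(2) box_subset_cbox by blast

lemma test_function_box_bump:
  assumes "c > 0" "box a b \<noteq> {}" "cbox a b \<subseteq> \<Omega>"
  shows "test_function \<Omega> (box_bump a b c)"
proof -
  have "closure {x. box_bump a b c x \<noteq> 0} \<subseteq> cbox a b"
    using box_bump_support[OF assms(1,2)] by (intro closure_minimal) auto
  then show ?thesis
    unfolding test_function_def using smooth_on_box_bump[of a b c] assms(3)
    by (meson bounded_subset bounded_cbox closed_closure compact_eq_bounded_closed order_trans)
qed

lemma smooth_onD: "smooth_on S f \<Longrightarrow> Ck_on k S f"
  by (simp add: smooth_on_def)

lemma smooth_on_partial_deriv: "smooth_on S f \<Longrightarrow> b \<in> Basis \<Longrightarrow> smooth_on S (partial_deriv b f)"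
  unfolding smooth_on_def by (metis Ck_on.simps(2))

section \<open>Measures and functions determined by small boxes\<close>

lemma finite_measures_eq_on_boxes:
  fixes M N :: "'a::euclidean_space measure"
  assumes "sets M = sets borel" "sets N = sets borel" "emeasure M UNIV \<noteq> \<infinity>"
    and "\<And>a b. emeasure M (box a b) = emeasure N (box a b)"
  shows "M = N"
proof (rule measure_eqI_generator_eq)
  let ?E = "range (\<lambda>(a, b). box a b::'a set)"
  let ?A = "\<lambda>n::nat. box (- (real n *\<^sub>R One)) (real n *\<^sub>R One) :: 'a set"
  show "Int_stable ?E" by (auto simp: Int_stable_def box_Int_box)
  show "?E \<subseteq> Pow UNIV" "sets M = sigma_sets UNIV ?E" "sets N = sigma_sets UNIV ?E"
    using assms by (simp_all add: borel_eq_box)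
  show "range ?A \<subseteq> ?E" "(\<Union>i. ?A i) = UNIV" unfolding UN_box_eq_UNIV by auto
  show "emeasure M (?A i) \<noteq> \<infinity>" for i
    using assms(1,3) emeasure_space[of M "?A i"] sets_eq_imp_space_eq[OF assms(1)]
    by (auto simp: top_unique)
  show "emeasure M X = emeasure N X" if "X \<in> ?E" for X using that assms(4) by auto
qed

lemma open_countable_Union_small_boxes:
  fixes W :: "'a::euclidean_space set"
  assumes "open W"
  shows "\<exists>B :: nat \<Rightarrow> 'a set. W = (\<Union>i. B i) \<and> (\<forall>i. \<exists>a b. B i = box a b \<and> cbox a b \<subseteq> W)"
proof -
  let ?F = "{box a b |a b. cbox a b \<subseteq> W}"
  have "\<exists>S\<in>?F. x \<in> S" if "x \<in> W" for x
  proof -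
    obtain a b where "x \<in> box a b" "cbox a b \<subseteq> W"
      using open_contains_cbox[of W x] assms \<open>x \<in> W\<close> by (metis)
    then show ?thesis by blast
  qed
  then have W: "W = \<Union>?F" using box_subset_cbox by fast
  obtain F' where F': "F' \<subseteq> ?F" "countable F'" "\<Union>F' = \<Union>?F"
    by (rule Lindelof[of ?F]) (auto intro: open_box)
  \<comment> \<open>The empty set is itself a box of the family, so it may be inserted into the
    countable subfamily; this makes the subfamily nonempty, as the enumeration by
    \<open>from_nat_into\<close> requires.\<close>
  have "box One (0::'a) = {}" "cbox One (0::'a) = {}"
    using SOME_Basis by (auto simp: box_eq_empty)
  then have *: "{} \<in> ?F" by (metis (mono_tags, lifting) CollectI empty_subsetI)
  let ?B = "from_nat_into (insert {} F')"
  have r: "range ?B = insert {} F'" using F'(2) by (simp add: range_from_nat_into)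
  then have "W = (\<Union>i. ?B i)" using F'(3) W by simp
  moreover have "?B i \<in> ?F" for i using r F'(1) * by blast
  ultimately show ?thesis by blast
qed

text \<open>A local uniqueness theorem. On a small box the two restrictions are finite measures that
  agree on all boxes, because two boxes intersect in a box. A countable cover by small boxes, made
  disjoint, extends this to Borel subsets of \<open>W\<close>.\<close>

lemma measures_eq_on_open:
  fixes M N :: "'a::euclidean_space measure"
  assumes sets: "sets M = sets borel" "sets N = sets borel" and W: "open W"
    and eq: "\<And>a b. cbox a b \<subseteq> W \<Longrightarrow> emeasure M (box a b) = emeasure N (box a b)"
    and fin: "\<And>a b. cbox a b \<subseteq> W \<Longrightarrow> emeasure M (box a b) \<noteq> \<infinity>"
    and A: "A \<in> sets borel" "A \<subseteq> W"
  shows "emeasure M A = emeasure N A"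
proof -
  note [measurable_cong] = sets
  obtain B where B: "W = (\<Union>i. B i)" "\<And>i::nat. \<exists>a b. B i = box a b \<and> cbox a b \<subseteq> W"
    using open_countable_Union_small_boxes[OF W] by fast
  have meas: "B i \<in> sets borel" for i using B(2)[of i] by auto
  have le: "emeasure M (B i \<inter> A) = emeasure N (B i \<inter> A)" if "A \<in> sets borel" for A i
  proof -
    obtain a b where ab: "B i = box a b" "cbox a b \<subseteq> W" using B(2) by blast
    \<comment> \<open>The restriction is written as a density, so that it remains a measure on the
      whole space and \<open>finite_measures_eq_on_boxes\<close> applies.\<close>
    let ?D = "\<lambda>M. density M (indicator (box a b)) :: 'a measure"
    have D: "emeasure (?D M') X = emeasure M' (box a b \<inter> X)" if "X \<in> sets borel" "sets M' = sets borel" for X M'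
      using that by (subst emeasure_density) (auto simp: nn_integral_indicator[symmetric] simp del: nn_integral_indicator
          intro!: nn_integral_cong split: split_indicator)
    have "?D M = ?D N"
    proof (rule finite_measures_eq_on_boxes)
      show "emeasure (?D M) UNIV \<noteq> \<infinity>" using D[of UNIV M] sets fin[OF ab(2)] by simp
      show "emeasure (?D M) (box c d) = emeasure (?D N) (box c d)" for c d
      proof -
        define c' where "c' = (\<Sum>i\<in>Basis. max (a \<bullet> i) (c \<bullet> i) *\<^sub>R i)"
        define d' where "d' = (\<Sum>i\<in>Basis. min (b \<bullet> i) (d \<bullet> i) *\<^sub>R i)"
        have "box a b \<inter> box c d = box c' d'"
          unfolding c'_def d'_def by (rule box_Int_box)
        moreover have "cbox c' d' \<subseteq> cbox a b"
          by (intro subset_box_imp) (simp_all add: c'_def d'_def)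
        ultimately show ?thesis using eq[of c' d'] ab(2) sets by (simp add: D)
      qed
    qed (use sets in auto)
    then show ?thesis using D[of A M] D[of A N] sets that ab by simp
  qed
  have disj: "disjoint_family (\<lambda>i. disjointed B i \<inter> A)"
    using disjoint_family_disjointed[of B] by (auto simp: disjoint_family_on_def)
  have AU: "A = (\<Union>i. disjointed B i \<inter> A)"
    using UN_disjointed_eq[of B] B(1) A(2) by blast
  have dm: "disjointed B i \<in> sets borel" for i
    using meas by (auto simp: disjointed_def)
  have s: "emeasure M' A = (\<Sum>i. emeasure M' (disjointed B i \<inter> A))" if "sets M' = sets borel" for M'
  proof -
    have "(\<Sum>i. emeasure M' (disjointed B i \<inter> A)) = emeasure M' (\<Union>i. disjointed B i \<inter> A)"
      using that dm A(1) disj by (intro suminf_emeasure) auto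
    then show ?thesis using AU by simp
  qed
  have "disjointed B i \<inter> A = B i \<inter> (disjointed B i \<inter> A)" for i
    using disjointed_subset[of B i] by blast
  then have "emeasure M (disjointed B i \<inter> A) = emeasure N (disjointed B i \<inter> A)" for i
    using le[of "disjointed B i \<inter> A" i] dm A by (metis sets.Int)
  with s sets show ?thesis by simp
qed

section \<open>Integrals of directional derivatives\<close>

lemma integral_lborel_shift:
  fixes f :: "'a::euclidean_space \<Rightarrow> real"
  assumes "f \<in> borel_measurable borel"
  shows "(LINT x|lborel. f (x + a)) = (LINT x|lborel. f x)"
proof -
  have "(LINT x|lborel. f x) = (LINT x|distr lborel borel ((+) a). f x)"
    by (simp add: lborel_distr_plus)
  also have "\<dots> = (LINT x|lborel. f (a + x))"
    using assms by (subst integral_distr) auto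
  finally show ?thesis by (simp add: add.commute)
qed

lemma integrable_bounded_support:
  fixes f :: "'a::euclidean_space \<Rightarrow> real"
  assumes [measurable]: "f \<in> borel_measurable borel" and "\<And>x. \<bar>f x\<bar> \<le> L" "\<And>x. norm x > R \<Longrightarrow> f x = 0"
  shows "integrable lborel f"
proof (rule Bochner_Integration.integrable_bound)
  show "integrable lborel (\<lambda>x::'a. L * indicator (cball 0 R) x :: real)"
    using emeasure_lborel_cball_finite[of "0::'a" R]
    by (intro integrable_mult_right integrable_real_indicator) auto
  have "0 \<le> L" using assms(2)[of 0] by linarith
  then show "AE x in lborel. norm (f x) \<le> norm (L * indicator (cball 0 R) x :: real)"
    using assms(2,3) by (auto simp: indicator_def not_le)
qed auto

lemma DERIV_mean_bound:
  fixes g :: "real \<Rightarrow> real"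
  assumes "\<And>t. (g has_real_derivative g' t) (at t)" "\<And>t. \<bar>g' t\<bar> \<le> M" "0 < h"
  shows "\<bar>(g h - g 0) / h\<bar> \<le> M"
proof -
  obtain z where "g h - g 0 = (h - 0) * g' z"
    using MVT2[of 0 h g g'] assms by auto
  then show ?thesis using assms by simp
qed

text \<open>Difference quotients have integral zero by translation invariance.\<close>

lemma integral_directional_derivative_eq_0:
  fixes f f' :: "'a::euclidean_space \<Rightarrow> real"
  assumes D: "\<And>x. ((\<lambda>t. f (x + t *\<^sub>R b)) has_real_derivative f' x) (at 0)"
    and meas[measurable]: "f \<in> borel_measurable borel"
    and M: "\<And>x. \<bar>f' x\<bar> \<le> M" and L: "\<And>x. \<bar>f x\<bar> \<le> L"
    and supp: "\<And>x. norm x > R \<Longrightarrow> f x = 0"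
  shows "(LINT x|lborel. f' x) = 0"
proof -
  define h :: "nat \<Rightarrow> real" where "h n = inverse (real (Suc n))" for n
  have h: "0 < h n" "h n \<le> 1" for n by (auto simp: h_def inverse_le_1_iff)
  have D': "((\<lambda>t. f (x + t *\<^sub>R b)) has_real_derivative f' (x + t *\<^sub>R b)) (at t)" for x t
    using D[of "x + t *\<^sub>R b"] DERIV_shift[of "\<lambda>t. f (x + t *\<^sub>R b)" _ 0 t]
    by (simp add: algebra_simps)
  define s where "s n x = (f (x + h n *\<^sub>R b) - f x) / h n" for n x
  have s_meas[measurable]: "s n \<in> borel_measurable borel" for n unfolding s_def by measurable
  have lim: "(\<lambda>n. s n x) \<longlonglongrightarrow> f' x" for x
  proof -
    have "((\<lambda>t. (f (x + t *\<^sub>R b) - f x) / t) \<longlongrightarrow> f' x) (at 0)"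
      using D[of x] by (simp add: has_field_derivative_iff)
    moreover have "filterlim h (at 0) sequentially"
      unfolding h_def using LIMSEQ_inverse_real_of_nat by (intro filterlim_atI) auto
    ultimately show ?thesis unfolding s_def by (rule filterlim_compose)
  qed
  have "f' \<in> borel_measurable borel"
    by (rule borel_measurable_LIMSEQ_real[OF lim s_meas])
  \<comment> \<open>The increments are at most 1, so all difference quotients vanish outside one
    ball of radius \<open>R + norm b\<close>; with the mean value bound \<open>M\<close> this gives
    an integrable majorant independent of \<open>n\<close>.\<close>
  moreover have bound: "\<bar>s n x\<bar> \<le> M * indicator (cball 0 (R + norm b)) x" for n x
  proof (cases "norm x \<le> R + norm b")
    case True
    then show ?thesis using DERIV_mean_bound[OF D' M h(1), of x n] by (simp add: s_def)
  next
    case False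
    have "norm (h n *\<^sub>R b) \<le> norm b" using h[of n] by (simp add: mult_left_le_one_le)
    moreover have "norm x \<le> norm (x + h n *\<^sub>R b) + norm (h n *\<^sub>R b)"
      using norm_triangle_ineq4[of "x + h n *\<^sub>R b" "h n *\<^sub>R b"] by simp
    ultimately have "norm (x + h n *\<^sub>R b) > R" "norm x > R"
      using False norm_ge_zero[of b] by linarith+
    then show ?thesis using supp False by (simp add: s_def)
  qed
  ultimately have "(\<lambda>n. LINT x|lborel. s n x) \<longlonglongrightarrow> (LINT x|lborel. f' x)"
    using emeasure_lborel_cball_finite[of "0::'a" "R + norm b"]
    by (intro integral_dominated_convergence[where w="\<lambda>x. M * indicator (cball 0 (R + norm b)) x"]
        AE_I2 lim integrable_mult_right integrable_real_indicator) auto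
  moreover have "(LINT x|lborel. s n x) = 0" for n
  proof -
    have f: "integrable lborel f" by (rule integrable_bounded_support[OF meas L supp])
    have "integrable lborel (\<lambda>x. f (x + h n *\<^sub>R b))"
    proof (rule integrable_bounded_support[of _ L "R + norm (h n *\<^sub>R b)"])
      show "f (x + h n *\<^sub>R b) = 0" if "R + norm (h n *\<^sub>R b) < norm x" for x
        using that norm_triangle_ineq4[of "x + h n *\<^sub>R b" "h n *\<^sub>R b"] by (intro supp) simp
    qed (use L in auto)
    with f show ?thesis unfolding s_def by (simp add: integral_lborel_shift)
  qed
  ultimately show ?thesis by (simp add: LIMSEQ_const_iff)
qed

section \<open>Splitting off one coordinate\<close>

definition hplane :: "'a::euclidean_space \<Rightarrow> ('a \<Rightarrow> real) measure" where
  "hplane e = (\<Pi>\<^sub>M i\<in>Basis - {e, - e}. lborel)"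

lemma measurable_hyperplane_point [measurable]: "hyperplane_point e \<in> borel_measurable (hplane e)"
  unfolding hyperplane_point_def hplane_def by measurable

lemma sigma_finite_hplane: "sigma_finite_measure (hplane (e::'a::euclidean_space))"
proof -
  interpret product_sigma_finite "\<lambda>i::'a. lborel :: real measure" by standard
  show ?thesis unfolding hplane_def by (rule sigma_finite) simp
qed

lemma minus_Basis: "e \<in> Basis \<Longrightarrow> - e \<notin> Basis"
  using inner_Basis[of e "- e"] inner_same_Basis[of e] by (auto split: if_splits)

lemma hyperplane_point_inner:
  assumes "e \<in> Basis \<or> - e \<in> Basis"
  shows "hyperplane_point e y \<bullet> e = 0"
  unfolding hyperplane_point_def inner_sum_left
proof (rule sum.neutral, rule ballI)
  fix i assume i: "i \<in> Basis - {e, - e}"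
  have "i \<bullet> e = 0 \<or> i \<bullet> (- e) = 0" using i assms inner_not_same_Basis by (metis Diff_iff insert_iff)
  then show "y i *\<^sub>R i \<bullet> e = 0" by simp
qed

text \<open>Tonelli with the coordinate in direction \<open>e\<close> split off. If \<open>e\<close>
  is the negative of a basis vector, reflecting the line variable reduces to the basis vector
  \<open>e0\<close>.\<close>

lemma nn_integral_hplane:
  fixes f :: "'a::euclidean_space \<Rightarrow> ennreal"
  assumes e: "e \<in> Basis \<or> - e \<in> Basis" and [measurable]: "f \<in> borel_measurable borel"
  shows "(\<integral>\<^sup>+x. f x \<partial>lborel) = (\<integral>\<^sup>+y. \<integral>\<^sup>+s. f (hyperplane_point e y + s *\<^sub>R e) \<partial>lborel \<partial>hplane e)"
proof -
  interpret product_sigma_finite "\<lambda>i::'a. lborel :: real measure" by standard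
  define e0 where "e0 = (if e \<in> Basis then e else - e)"
  have e0: "e0 \<in> Basis" "e = e0 \<or> e = - e0" using e by (auto simp: e0_def)
  define I where "I = Basis - {e, - e}"
  have I: "Basis = insert e0 I" "e0 \<notin> I" "finite I"
    using e0 minus_Basis[OF e0(1)] by (auto simp: I_def)
  have fin: "(\<Sum>b\<in>Basis. (y(e0 := s)) b *\<^sub>R b) = hyperplane_point e y + s *\<^sub>R e0" for y s
  proof -
    have "(\<Sum>b\<in>I. (y(e0 := s)) b *\<^sub>R b) = (\<Sum>b\<in>I. y b *\<^sub>R b)"
      using I(2) by (intro sum.cong) auto
    moreover have "(\<Sum>b\<in>Basis. X b) = X e0 + (\<Sum>b\<in>I. X b)" for X :: "'a \<Rightarrow> 'a"
      unfolding I(1) using I(2,3) by simp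
    ultimately show ?thesis by (simp add: hyperplane_point_def I_def[symmetric] add.commute)
  qed
  have m[measurable]: "(\<lambda>x. \<Sum>b\<in>Basis. x b *\<^sub>R b) \<in> borel_measurable (\<Pi>\<^sub>M b\<in>(Basis::'a set). lborel)"
    by measurable
  have "(\<integral>\<^sup>+x. f x \<partial>lborel) = (\<integral>\<^sup>+x. f (\<Sum>b\<in>Basis. x b *\<^sub>R b) \<partial>(\<Pi>\<^sub>M b\<in>(Basis::'a set). lborel))"
    by (subst lborel_eq) (simp add: nn_integral_distr)
  also have "\<dots> = (\<integral>\<^sup>+x. f (\<Sum>b\<in>Basis. x b *\<^sub>R b) \<partial>(\<Pi>\<^sub>M b\<in>insert e0 I. lborel))"
    using I(1) by simp
  also have "\<dots> = (\<integral>\<^sup>+y. \<integral>\<^sup>+s. f (\<Sum>b\<in>Basis. (y(e0 := s)) b *\<^sub>R b) \<partial>lborel \<partial>(\<Pi>\<^sub>M b\<in>I. lborel))"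
    using I m unfolding I(1) by (intro product_nn_integral_insert) auto
  also have "\<dots> = (\<integral>\<^sup>+y. \<integral>\<^sup>+s. f (hyperplane_point e y + s *\<^sub>R e0) \<partial>lborel \<partial>hplane e)"
    by (simp only: fin hplane_def I_def)
  also have "\<dots> = (\<integral>\<^sup>+y. \<integral>\<^sup>+s. f (hyperplane_point e y + s *\<^sub>R e) \<partial>lborel \<partial>hplane e)"
    using e0(2)
  proof
    assume "e = - e0"
    have "(\<integral>\<^sup>+s. f (hyperplane_point e y + s *\<^sub>R e0) \<partial>lborel)
        = (\<integral>\<^sup>+s. f (hyperplane_point e y + s *\<^sub>R e) \<partial>lborel)" for y
      using nn_integral_real_affine[of "\<lambda>s. f (hyperplane_point e y + s *\<^sub>R e0)" "-1" 0] \<open>e = - e0\<close>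
      by simp
    then show ?thesis by simp
  qed simp
  finally show ?thesis .
qed

lemma lborel_eq_distr_hplane:
  fixes e :: "'a::euclidean_space"
  assumes "e \<in> Basis \<or> - e \<in> Basis"
  shows "lborel = distr (hplane e \<Otimes>\<^sub>M lborel) borel (\<lambda>(y, s). hyperplane_point e y + s *\<^sub>R e)"
proof (rule measure_eqI)
  fix A :: "'a set" assume "A \<in> sets lborel"
  then have [measurable]: "A \<in> sets borel" by simp
  have "emeasure lborel A = (\<integral>\<^sup>+x. indicator A x \<partial>lborel)" by simp
  also have "\<dots> = (\<integral>\<^sup>+y. \<integral>\<^sup>+s. indicator A (hyperplane_point e y + s *\<^sub>R e) \<partial>lborel \<partial>hplane e)"
    by (rule nn_integral_hplane[OF assms]) measurable
  also have "\<dots> = (\<integral>\<^sup>+z. indicator A (case z of (y, s) \<Rightarrow> hyperplane_point e y + s *\<^sub>R e) \<partial>(hplane e \<Otimes>\<^sub>M lborel))"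
    by (subst lborel.nn_integral_fst[symmetric]) auto
  also have "\<dots> = (\<integral>\<^sup>+x. indicator A x \<partial>distr (hplane e \<Otimes>\<^sub>M lborel) borel (\<lambda>(y, s). hyperplane_point e y + s *\<^sub>R e))"
    by (subst nn_integral_distr) auto
  finally show "emeasure lborel A = emeasure (distr (hplane e \<Otimes>\<^sub>M lborel) borel (\<lambda>(y, s). hyperplane_point e y + s *\<^sub>R e)) A"
    by simp
qed simp

lemma integral_hplane:
  fixes f :: "'a::euclidean_space \<Rightarrow> real"
  assumes e: "e \<in> Basis \<or> - e \<in> Basis" and f: "integrable lborel f"
  shows "(LINT x|lborel. f x) = (LINT y|hplane e. LINT s|lborel. f (hyperplane_point e y + s *\<^sub>R e))"
proof -
  interpret sigma_finite_measure "hplane e" by (rule sigma_finite_hplane)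
  interpret pair_sigma_finite "hplane e" lborel ..
  let ?p = "\<lambda>(y, s). hyperplane_point e y + s *\<^sub>R e"
  have p[measurable]: "?p \<in> measurable (hplane e \<Otimes>\<^sub>M lborel) borel" by measurable
  have fm[measurable]: "f \<in> borel_measurable borel" using f by auto
  have "integrable (hplane e \<Otimes>\<^sub>M lborel) (\<lambda>z. f (?p z))"
    using f by (subst (asm) lborel_eq_distr_hplane[OF e]) (simp add: integrable_distr_eq)
  from integral_fst'[OF this] have "(LINT z|(hplane e \<Otimes>\<^sub>M lborel). f (?p z))
      = (LINT y|hplane e. LINT s|lborel. f (hyperplane_point e y + s *\<^sub>R e))" by simp
  moreover have "(LINT x|lborel. f x) = (LINT z|(hplane e \<Otimes>\<^sub>M lborel). f (?p z))"
    by (subst lborel_eq_distr_hplane[OF e]) (simp add: integral_distr)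
  ultimately show ?thesis by simp
qed

text \<open>On each line parallel to \<open>e\<close> the function \<open>g\<close> is constant, so
  the shear is a translation of that line. Tonelli and one-dimensional translation invariance then
  suffice, and no Jacobian appears.\<close>

lemma shear_lborel:
  fixes e :: "'a::euclidean_space" and g :: "'a \<Rightarrow> real"
  assumes e: "e \<in> Basis \<or> - e \<in> Basis" and [measurable]: "g \<in> borel_measurable borel"
    and inv: "\<And>x t. g (x + t *\<^sub>R e) = g x"
  shows "distr lborel borel (\<lambda>x. x + g x *\<^sub>R e) = lborel"
proof (rule measure_eqI)
  fix A assume "A \<in> sets (distr lborel borel (\<lambda>x. x + g x *\<^sub>R e))"
  then have [measurable]: "A \<in> sets borel" by simp
  have sh: "(\<integral>\<^sup>+s. indicator A (z + (s + c) *\<^sub>R e) \<partial>lborel) = (\<integral>\<^sup>+s. indicator A (z + s *\<^sub>R e) \<partial>lborel)"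
    for z and c :: real
    using nn_integral_real_affine[of "\<lambda>s. indicator A (z + s *\<^sub>R e)" 1 c] by (simp add: add.commute)
  have "emeasure (distr lborel borel (\<lambda>x. x + g x *\<^sub>R e)) A = (\<integral>\<^sup>+x. indicator A (x + g x *\<^sub>R e) \<partial>lborel)"
    by (subst nn_integral_indicator[symmetric], simp, subst nn_integral_distr) auto
  also have "\<dots> = (\<integral>\<^sup>+y. \<integral>\<^sup>+s. indicator A ((hyperplane_point e y + s *\<^sub>R e)
      + g (hyperplane_point e y + s *\<^sub>R e) *\<^sub>R e) \<partial>lborel \<partial>hplane e)"
    by (rule nn_integral_hplane[OF e]) measurable
  also have "\<dots> = (\<integral>\<^sup>+y. \<integral>\<^sup>+s. indicator A (hyperplane_point e y + (s + g (hyperplane_point e y)) *\<^sub>R e)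
      \<partial>lborel \<partial>hplane e)"
    by (simp add: inv algebra_simps)
  also have "\<dots> = (\<integral>\<^sup>+y. \<integral>\<^sup>+s. indicator A (hyperplane_point e y + s *\<^sub>R e) \<partial>lborel \<partial>hplane e)"
    by (simp add: sh)
  also have "\<dots> = (\<integral>\<^sup>+x. indicator A x \<partial>lborel)"
    by (rule nn_integral_hplane[OF e, symmetric]) measurable
  finally show "emeasure (distr lborel borel (\<lambda>x. x + g x *\<^sub>R e)) A = emeasure lborel A" by simp
qed simp

lemma norm_hyperplane_point_add:
  assumes "e \<in> Basis \<or> - e \<in> Basis"
  shows "\<bar>s\<bar> \<le> norm (hyperplane_point e y + s *\<^sub>R e)"
proof -
  have "norm e = 1" using assms by (metis norm_Basis norm_minus_cancel)
  then have "e \<bullet> e = 1" by (simp add: norm_eq_1)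
  then have "(hyperplane_point e y + s *\<^sub>R e) \<bullet> e = s"
    using hyperplane_point_inner[OF assms] by (simp add: inner_add_left)
  then show ?thesis
    using Cauchy_Schwarz_ineq2[of "hyperplane_point e y + s *\<^sub>R e" e] \<open>norm e = 1\<close> by simp
qed

lemma hyperplane_point_coord:
  assumes "i \<in> Basis - {e, - e}" "e \<in> Basis \<or> - e \<in> Basis"
  shows "(hyperplane_point e y + s *\<^sub>R e) \<bullet> i = y i"
proof -
  have ei: "e \<bullet> i = 0" using assms inner_not_same_Basis[of e i] inner_not_same_Basis[of "- e" i] by auto
  have "hyperplane_point e y \<bullet> i = (\<Sum>j\<in>Basis - {e, - e}. if j = i then y j else 0)"
    unfolding hyperplane_point_def inner_sum_left using assms by (intro sum.cong) (auto simp: inner_Basis)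
  then show ?thesis using assms(1) ei by (simp add: inner_add_left sum.delta')
qed

section \<open>The divergence theorem on epigraphs\<close>

lemma has_real_derivative_along_line:
  assumes "f differentiable (at (x + t *\<^sub>R b))"
  shows "((\<lambda>s. f (x + s *\<^sub>R b)) has_real_derivative grad f (x + t *\<^sub>R b) \<bullet> b) (at t)"
proof -
  have "((\<lambda>s. x + s *\<^sub>R b) has_derivative (\<lambda>s. s *\<^sub>R b)) (at t)"
    by (auto intro!: derivative_eq_intros)
  from has_derivative_compose[OF this has_derivative_grad[OF assms]]
  show ?thesis by (simp add: has_field_derivative_def mult_commute_abs)
qed

lemma grad_eq_0_outside:
  assumes "compact K" "\<And>x. x \<notin> K \<Longrightarrow> f x = (0::real)" "x \<notin> K"
  shows "grad f x = 0"
proof -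
  have "grad f x = grad (\<lambda>_. 0) x"
    by (rule grad_cong[of "- K"]) (use assms compact_imp_closed in auto)
  then show ?thesis by (simp add: grad_def)
qed

text \<open>The whole region above one graph, without the ball of \<open>boundary_graph\<close>. A
  field supported in a chart ball is extended by zero to this region, where integration by lines and
  shears is possible.\<close>

locale epigraph =
  fixes e :: "'a::euclidean_space" and \<gamma> :: "'a \<Rightarrow> real"
  assumes e: "e \<in> Basis \<or> - e \<in> Basis"
    and smooth: "smooth_on UNIV \<gamma>"
    and inv: "\<gamma> (x + t *\<^sub>R e) = \<gamma> x"
begin

definition U :: "'a set" where "U = {x. \<gamma> x < x \<bullet> e}"

text \<open>Functions are C1 in the open set \<open>U\<close> only. For \<open>t > 0\<close> the
  layer is a closed set inside \<open>U\<close>, so integrating over it keeps away from the boundary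
  until t tends to 0.\<close>

definition layer :: "real \<Rightarrow> 'a set" where "layer t = {x. \<gamma> x + t \<le> x \<bullet> e}"

definition graph_point :: "real \<Rightarrow> ('a \<Rightarrow> real) \<Rightarrow> 'a" where
  "graph_point t y = hyperplane_point e y + (\<gamma> (hyperplane_point e y) + t) *\<^sub>R e"

lemma e_e [simp]: "e \<bullet> e = 1" and norm_e: "norm e = 1"
proof -
  show "norm e = 1" using e by (metis norm_Basis norm_minus_cancel)
  then show "e \<bullet> e = 1" by (simp add: norm_eq_1)
qed

lemma C1_\<gamma>: "Ck_on 1 UNIV \<gamma>"
  using smooth by (rule smooth_onD)

lemma diff_\<gamma>: "\<gamma> differentiable (at x)"
  using C1_\<gamma> by simp

lemma cont_\<gamma>: "continuous_on S \<gamma>"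
  using Ck_on_imp_continuous_on[OF C1_\<gamma>] continuous_on_subset by blast

lemma cont_grad_\<gamma>: "continuous_on S (grad \<gamma>)"
  using C1_\<gamma> continuous_on_subset unfolding Ck_on_1_iff by blast

lemma C1_partial_\<gamma>: "b \<in> Basis \<Longrightarrow> Ck_on 1 UNIV (partial_deriv b \<gamma>)"
  using smooth_on_partial_deriv[OF smooth] smooth_onD by blast

lemma grad_invariant:
  assumes "\<And>x t. f (x + t *\<^sub>R e) = f x" "\<And>x. f differentiable (at x)"
  shows "grad f (x + t *\<^sub>R e) = grad f x" "grad f x \<bullet> e = 0"
proof -
  have "((\<lambda>y. f (y + t *\<^sub>R e)) has_derivative (\<lambda>h. grad f (x + t *\<^sub>R e) \<bullet> h)) (at x)"
    by (rule has_derivative_compose[where f="\<lambda>y. y + t *\<^sub>R e" and f'="\<lambda>h. h", simplified])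
      (auto intro!: derivative_eq_intros has_derivative_grad assms(2))
  then show "grad f (x + t *\<^sub>R e) = grad f x"
    using has_derivative_imp_grad[of f "grad f (x + t *\<^sub>R e)" x] by (simp add: assms(1))
  have "((\<lambda>s. f (x + s *\<^sub>R e)) has_real_derivative grad f (x + 0 *\<^sub>R e) \<bullet> e) (at 0)"
    by (rule has_real_derivative_along_line) (rule assms(2))
  then have "((\<lambda>s. f x) has_real_derivative grad f x \<bullet> e) (at (0::real))"
    by (simp add: assms(1))
  then show "grad f x \<bullet> e = 0" using DERIV_const DERIV_unique by blast
qed

lemma grad_\<gamma>_shift: "grad \<gamma> (x + t *\<^sub>R e) = grad \<gamma> x" and grad_\<gamma>_e: "grad \<gamma> x \<bullet> e = 0"
  using grad_invariant[of \<gamma>, OF inv diff_\<gamma>] by auto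

lemma partial_\<gamma>_shift: "b \<in> Basis \<Longrightarrow> partial_deriv b \<gamma> (x + t *\<^sub>R e) = partial_deriv b \<gamma> x"
  by (simp add: grad_inner[symmetric] grad_\<gamma>_shift)

lemma open_U: "open U" and closed_layer: "closed (layer t)"
  unfolding U_def layer_def
  by (intro open_Collect_less closed_Collect_le continuous_intros cont_\<gamma>)+

lemma borel_U [measurable]: "U \<in> sets borel" and borel_layer [measurable]: "layer t \<in> sets borel"
  using open_U closed_layer by auto

lemma layer_subset: "t > 0 \<Longrightarrow> layer t \<subseteq> U"
  by (auto simp: layer_def U_def)

lemma measurable_\<gamma> [measurable]: "\<gamma> \<in> borel_measurable borel"
  using cont_\<gamma> by (rule borel_measurable_continuous_onI)

lemma measurable_grad_\<gamma> [measurable]: "grad \<gamma> \<in> borel_measurable borel"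
  using cont_grad_\<gamma> by (rule borel_measurable_continuous_onI)

lemma measurable_graph_point [measurable]: "graph_point t \<in> borel_measurable (hplane e)"
  unfolding graph_point_def by measurable

lemma graph_point_inner: "graph_point t y \<bullet> e = \<gamma> (hyperplane_point e y) + t"
  by (simp add: graph_point_def inner_add_left hyperplane_point_inner[OF e])

lemma \<gamma>_graph_point: "\<gamma> (graph_point t y) = \<gamma> (hyperplane_point e y)"
  by (simp add: graph_point_def inv)

text \<open>The part of the compact support in the closed layer is a compact subset of
  \<open>U\<close>, so a function that is merely continuous on \<open>U\<close> is bounded
  there.\<close>

lemma cutoff:
  fixes h :: "'a \<Rightarrow> real"
  assumes h: "continuous_on U h" and h0: "\<And>x. x \<in> U \<Longrightarrow> x \<notin> K \<Longrightarrow> h x = 0"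
    and K: "compact K" and t: "t > 0"
  shows "(\<lambda>x. indicator (layer t) x * h x) \<in> borel_measurable borel" (is "?g \<in> _")
    and "\<exists>M. \<forall>x. \<bar>indicator (layer t) x * h x\<bar> \<le> M"
    and "integrable lborel (\<lambda>x. indicator (layer t) x * h x)"
proof -
  show m: "?g \<in> borel_measurable borel"
    using borel_measurable_continuous_on_indicator[OF borel_layer continuous_on_subset[OF h layer_subset[OF t]]]
    by simp
  have "compact (K \<inter> layer t)" using K closed_layer by (rule compact_Int_closed)
  then have "bounded (h ` (K \<inter> layer t))"
    using continuous_on_subset[OF h] layer_subset[OF t]
    by (intro compact_imp_bounded compact_continuous_image) blast+
  then obtain M where M: "\<And>x. x \<in> K \<inter> layer t \<Longrightarrow> \<bar>h x\<bar> \<le> M" "M > 0"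
    unfolding bounded_pos by auto
  have b: "\<bar>?g x\<bar> \<le> M" for x
    using M h0 layer_subset[OF t] by (cases "x \<in> K") (auto simp: indicator_def)
  then show "\<exists>M. \<forall>x. \<bar>?g x\<bar> \<le> M" by blast
  obtain R where R: "\<And>x. x \<in> K \<Longrightarrow> norm x \<le> R"
    using compact_imp_bounded[OF K] unfolding bounded_iff by blast
  show "integrable lborel ?g"
    by (rule integrable_bounded_support[of _ M R])
      (use m b R h0 layer_subset[OF t] in \<open>fastforce simp: indicator_def\<close>)+
qed

text \<open>The fundamental theorem of calculus on each line parallel to \<open>e\<close>, from the
  shifted graph up to a point beyond the support.\<close>

lemma integral_layer_e:
  assumes f: "Ck_on 1 U f" and K: "compact K" "\<And>x. x \<notin> K \<Longrightarrow> f x = 0" and t: "t > 0"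
  shows "(LINT x|lborel. indicator (layer t) x * (grad f x \<bullet> e)) = - (LINT y|hplane e. f (graph_point t y))"
proof -
  have gc: "continuous_on U (\<lambda>x. grad f x \<bullet> e)"
    using f unfolding Ck_on_1_iff by (intro continuous_intros) auto
  have "integrable lborel (\<lambda>x. indicator (layer t) x * (grad f x \<bullet> e))"
    by (rule cutoff(3)[OF gc _ K(1) t]) (simp add: grad_eq_0_outside[OF K])
  then have "(LINT x|lborel. indicator (layer t) x * (grad f x \<bullet> e)) =
    (LINT y|hplane e. LINT s|lborel. indicator (layer t) (hyperplane_point e y + s *\<^sub>R e)
        * (grad f (hyperplane_point e y + s *\<^sub>R e) \<bullet> e))"
    by (rule integral_hplane[OF e])
  also have "\<dots> = (LINT y|hplane e. - f (graph_point t y))"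
  proof (rule Bochner_Integration.integral_cong[OF refl])
    fix y
    define z where "z = hyperplane_point e y"
    define a where "a = \<gamma> z + t"
    obtain R where R: "\<And>x. x \<in> K \<Longrightarrow> norm x \<le> R"
      using compact_imp_bounded[OF K(1)] unfolding bounded_iff by blast
    \<comment> \<open>A height above the starting point \<open>a\<close> and beyond the radius
      \<open>R\<close> of the support. The norm of a point on the line is at least its height in
      absolute value, so from \<open>B\<close> on the line has left \<open>K\<close>.\<close>
    define B where "B = max (a + 1) (R + 1)"
    have out: "z + s *\<^sub>R e \<notin> K" if "s \<ge> B" for s
      using norm_hyperplane_point_add[OF e, of s y] R[of "z + s *\<^sub>R e"] that
      unfolding z_def[symmetric] B_def by auto
    have ze: "z \<bullet> e = 0" unfolding z_def by (rule hyperplane_point_inner[OF e])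
    have inU: "z + s *\<^sub>R e \<in> U" if "a \<le> s" for s
      using that t ze by (simp add: U_def inv inner_add_left a_def)
    have lay: "z + s *\<^sub>R e \<in> layer t \<longleftrightarrow> a \<le> s" for s
      using ze by (simp add: layer_def inv inner_add_left a_def)
    have "(LINT s|lborel. indicator (layer t) (z + s *\<^sub>R e) * (grad f (z + s *\<^sub>R e) \<bullet> e))
        = (LINT s|lborel. (grad f (z + s *\<^sub>R e) \<bullet> e) * indicator {a..B} s)"
      using out lay grad_eq_0_outside[OF K]
      by (intro Bochner_Integration.integral_cong) (auto simp: indicator_def not_le)
    also have "\<dots> = f (z + B *\<^sub>R e) - f (z + a *\<^sub>R e)"
    proof (rule integral_FTC_Icc_real)
      show "a \<le> B" by (simp add: B_def)
      fix s assume s: "a \<le> s" "s \<le> B"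
      show "((\<lambda>s. f (z + s *\<^sub>R e)) has_real_derivative grad f (z + s *\<^sub>R e) \<bullet> e) (at s)"
        using f inU[OF s(1)] by (intro has_real_derivative_along_line) simp
      have "isCont (\<lambda>x. grad f x \<bullet> e) (z + s *\<^sub>R e)"
        using gc inU[OF s(1)] open_U by (simp add: continuous_on_eq_continuous_at)
      then show "isCont (\<lambda>s. grad f (z + s *\<^sub>R e) \<bullet> e) s"
        by (intro isCont_o2[of s "\<lambda>s. z + s *\<^sub>R e" "\<lambda>x. grad f x \<bullet> e"]) (auto intro!: continuous_intros)
    qed
    also have "\<dots> = - f (graph_point t y)"
      using out[of B] K(2) by (simp add: graph_point_def a_def z_def)
    finally show "(LINT s|lborel. indicator (layer t) (hyperplane_point e y + s *\<^sub>R e)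
        * (grad f (hyperplane_point e y + s *\<^sub>R e) \<bullet> e)) = - f (graph_point t y)"
      by (simp add: z_def)
  qed
  finally show ?thesis by simp
qed

text \<open>The field \<open>b + \<partial>\<^sub>b\<gamma> e\<close> is tangent to all graphs \<open>\<gamma> + t\<close>. The shear \<open>x \<mapsto> x + \<gamma>(x) e\<close> turns
  it into the constant field \<open>b\<close> on a half space.\<close>

lemma integral_layer_tangential:
  assumes f: "Ck_on 1 U f" and K: "compact K" "\<And>x. x \<notin> K \<Longrightarrow> f x = 0" and t: "t > 0"
    and b: "b \<in> Basis" "b \<bullet> e = 0"
  shows "(LINT x|lborel. indicator (layer t) x * (grad f x \<bullet> b + partial_deriv b \<gamma> x * (grad f x \<bullet> e))) = 0"
proof -
  define h where "h x = grad f x \<bullet> b + partial_deriv b \<gamma> x * (grad f x \<bullet> e)" for x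
  define S where "S x = x + \<gamma> x *\<^sub>R e" for x
  define g where "g = (\<lambda>x. indicator (layer t) x * h x)"
  have pc: "continuous_on A (partial_deriv b \<gamma>)" for A
    using C1_partial_\<gamma>[OF b(1)] Ck_on_imp_continuous_on continuous_on_subset by blast
  have gf: "continuous_on U (grad f)" using f unfolding Ck_on_1_iff by simp
  have hc: "continuous_on U h"
    unfolding h_def by (intro continuous_intros pc gf)
  have h0: "h x = 0" if "x \<notin> K" for x
    using grad_eq_0_outside[OF K that] by (simp add: h_def)
  note hcut = cutoff[OF hc h0 K(1) t, folded g_def]
  note fcut = cutoff[OF Ck_on_imp_continuous_on[OF f] K(2) K(1) t]
  obtain M where M: "\<And>x. \<bar>g x\<bar> \<le> M" using hcut(2) by (auto simp: g_def)
  obtain L where L: "\<And>x. \<bar>indicator (layer t) x * f x\<bar> \<le> L" using fcut(2) by auto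
  \<comment> \<open>The inverse shear maps \<open>K\<close> to a bounded set; outside its radius
    \<open>R\<close> the sheared function vanishes.\<close>
  have "continuous_on K (\<lambda>x. x - \<gamma> x *\<^sub>R e)" by (intro continuous_intros cont_\<gamma>)
  then have "bounded ((\<lambda>x. x - \<gamma> x *\<^sub>R e) ` K)"
    by (intro compact_imp_bounded compact_continuous_image K(1))
  then obtain R where R: "\<And>x. x \<in> K \<Longrightarrow> norm (x - \<gamma> x *\<^sub>R e) \<le> R" unfolding bounded_iff by auto
  have \<gamma>S: "\<gamma> (S x) = \<gamma> x" for x by (simp add: S_def inv)
  have S_meas[measurable]: "S \<in> borel_measurable borel" unfolding S_def by measurable
  have g_meas[measurable]: "g \<in> borel_measurable borel" using hcut(1) by (simp add: g_def)
  have layS: "S x \<in> layer t \<longleftrightarrow> t \<le> x \<bullet> e" for x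
    unfolding layer_def by (simp add: \<gamma>S) (simp add: S_def inner_add_left)
  \<comment> \<open>After the shear the layer is the half space
    \<open>t \<le> x \<bullet> e\<close>. The truncated function jumps across its face, but
    \<open>b\<close> is parallel to the face, so no line in direction \<open>b\<close> crosses it
    and the derivative along \<open>b\<close> exists everywhere.\<close>
  have "(LINT x|lborel. g (S x)) = 0"
  proof (rule integral_directional_derivative_eq_0[where f="\<lambda>x. indicator (layer t) (S x) * f (S x)" and b=b])
    fix x
    show "((\<lambda>s. indicator (layer t) (S (x + s *\<^sub>R b)) * f (S (x + s *\<^sub>R b))) has_real_derivative g (S x)) (at 0)"
    proof (cases "t \<le> x \<bullet> e")
      case False
      then show ?thesis by (simp add: layS inner_add_left b(2) g_def)
    next
      case True
      then have SU: "S x \<in> U" using layS layer_subset[OF t] by blast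
      have "((\<lambda>s. \<gamma> (x + s *\<^sub>R b)) has_derivative (\<lambda>s. s * partial_deriv b \<gamma> x)) (at 0)"
        using has_real_derivative_along_line[of \<gamma> x 0 b] diff_\<gamma>
        by (simp add: has_field_derivative_def grad_inner[OF b(1)] mult_commute_abs)
      then have "((\<lambda>s. S (x + s *\<^sub>R b)) has_derivative (\<lambda>s. s *\<^sub>R (b + partial_deriv b \<gamma> x *\<^sub>R e))) (at 0)"
        unfolding S_def by (auto intro!: derivative_eq_intros simp: algebra_simps)
      moreover have "(f has_derivative (\<lambda>h. grad f (S x) \<bullet> h)) (at (S (x + 0 *\<^sub>R b)))"
        using Ck_on_1_grad[OF f SU] by simp
      ultimately have "((\<lambda>s. f (S (x + s *\<^sub>R b))) has_derivative
          (\<lambda>s. grad f (S x) \<bullet> (s *\<^sub>R (b + partial_deriv b \<gamma> x *\<^sub>R e)))) (at 0)"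
        by (rule has_derivative_compose)
      moreover have "partial_deriv b \<gamma> (S x) = partial_deriv b \<gamma> x"
        unfolding S_def by (rule partial_\<gamma>_shift[OF b(1)])
      ultimately have "((\<lambda>s. f (S (x + s *\<^sub>R b))) has_real_derivative h (S x)) (at 0)"
        by (simp add: has_field_derivative_def h_def inner_add_right mult_commute_abs)
      with True show ?thesis by (simp add: layS inner_add_left b(2) g_def)
    qed
    show "\<bar>g (S x)\<bar> \<le> M" "\<bar>indicator (layer t) (S x) * f (S x)\<bar> \<le> L" by (rule M L)+
    show "indicator (layer t) (S x) * f (S x) = 0" if "norm x > R"
    proof -
      have "x = S x - \<gamma> (S x) *\<^sub>R e" by (simp add: \<gamma>S) (simp add: S_def)
      then have "S x \<notin> K" using R[of "S x"] that by auto
      then show ?thesis using K(2) by simp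
    qed
  next
    show "(\<lambda>x. indicator (layer t) (S x) * f (S x)) \<in> borel_measurable borel"
      using measurable_compose[OF S_meas fcut(1)] .
  qed
  moreover have "(LINT x|lborel. g (S x)) = (LINT x|distr lborel borel S. g x)"
    by (subst integral_distr) auto
  moreover have "distr lborel borel S = lborel"
    unfolding S_def by (rule shear_lborel[OF e measurable_\<gamma> inv])
  ultimately show ?thesis by (simp add: g_def h_def)
qed

text \<open>For \<open>b\<close> orthogonal to \<open>e\<close>, the vanishing tangential integral
  trades the derivative along \<open>b\<close> for \<open>- p\<close> times the derivative along
  \<open>e\<close>, where \<open>p\<close> is the slope of \<open>\<gamma>\<close> in direction
  \<open>b\<close>. As \<open>p\<close> is constant along \<open>e\<close>, it moves inside that
  derivative, and \<open>integral_layer_e\<close> applies to \<open>p f\<close>. The factor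
  \<open>grad \<gamma> - e\<close> is the outward normal before normalization.\<close>

lemma integral_layer:
  assumes f: "Ck_on 1 U f" and K: "compact K" "\<And>x. x \<notin> K \<Longrightarrow> f x = 0" and t: "t > 0"
    and b: "b \<in> Basis"
  shows "(LINT x|lborel. indicator (layer t) x * (grad f x \<bullet> b)) =
    (LINT y|hplane e. f (graph_point t y) * ((grad \<gamma> (hyperplane_point e y) - e) \<bullet> b))"
proof (cases "b \<bullet> e = 0")
  case True
  define p where "p = partial_deriv b \<gamma>"
  have pC: "Ck_on 1 UNIV p" unfolding p_def by (rule C1_partial_\<gamma>[OF b])
  have pinv: "p (x + t *\<^sub>R e) = p x" for x t unfolding p_def by (rule partial_\<gamma>_shift[OF b])
  have pdiff: "p differentiable (at x)" for x using pC by simp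
  have ge: "grad p x \<bullet> e = 0" for x by (rule grad_invariant(2)[OF pinv pdiff])
  have pf: "Ck_on 1 U (\<lambda>x. p x * f x)"
    using Ck_on_subset[OF pC] f by (intro Ck_on_mult[OF open_U]) auto
  have gpf: "grad (\<lambda>x. p x * f x) x \<bullet> e = p x * (grad f x \<bullet> e)" if "x \<in> U" for x
    using f that pdiff[of x] by (subst grad_mult) (auto simp: inner_add_left ge)
  have gf: "continuous_on U (grad f)" using f unfolding Ck_on_1_iff by simp
  have i1: "integrable lborel (\<lambda>x. indicator (layer t) x * (grad f x \<bullet> b))"
    by (rule cutoff(3)[OF _ _ K(1) t]) (auto intro!: continuous_intros gf simp: grad_eq_0_outside[OF K])
  have i2: "integrable lborel (\<lambda>x. indicator (layer t) x * (p x * (grad f x \<bullet> e)))"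
    by (rule cutoff(3)[OF _ _ K(1) t])
      (auto intro!: continuous_intros gf continuous_on_subset[OF Ck_on_imp_continuous_on[OF pC]] simp: grad_eq_0_outside[OF K])
  have "(LINT x|lborel. indicator (layer t) x * (grad f x \<bullet> b)) =
      - (LINT x|lborel. indicator (layer t) x * (p x * (grad f x \<bullet> e)))"
    using integral_layer_tangential[OF f K t b True] Bochner_Integration.integral_add[OF i1 i2]
    by (simp add: p_def distrib_left)
  also have "(LINT x|lborel. indicator (layer t) x * (p x * (grad f x \<bullet> e))) =
      (LINT x|lborel. indicator (layer t) x * (grad (\<lambda>x. p x * f x) x \<bullet> e))"
    using gpf layer_subset[OF t] by (intro Bochner_Integration.integral_cong) (auto simp: indicator_def)
  also have "\<dots> = - (LINT y|hplane e. p (graph_point t y) * f (graph_point t y))"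
    by (rule integral_layer_e[OF pf K(1) _ t]) (simp add: K(2))
  also have "- (- (LINT y|hplane e. p (graph_point t y) * f (graph_point t y))) =
      (LINT y|hplane e. f (graph_point t y) * ((grad \<gamma> (hyperplane_point e y) - e) \<bullet> b))"
  proof -
    have "p (graph_point t y) = (grad \<gamma> (hyperplane_point e y) - e) \<bullet> b" for y
      using True unfolding graph_point_def pinv
      by (simp add: p_def grad_inner[OF b] inner_diff_left inner_commute[of e])
    then show ?thesis by (simp add: mult.commute)
  qed
  finally show ?thesis .
next
  case False
  then have "b = e \<or> b = - e" using e b inner_not_same_Basis[of b e] inner_not_same_Basis[of b "- e"] by auto
  then obtain c :: real where c: "b = c *\<^sub>R e" by (metis scaleR_minus1_left scaleR_one)
  have "(LINT x|lborel. indicator (layer t) x * (grad f x \<bullet> b)) =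
      (LINT x|lborel. c * (indicator (layer t) x * (grad f x \<bullet> e)))"
    by (intro Bochner_Integration.integral_cong) (auto simp: c)
  also have "\<dots> = - c * (LINT y|hplane e. f (graph_point t y))"
    using integral_layer_e[OF f K t] by simp
  finally show ?thesis by (simp add: c inner_diff_left grad_\<gamma>_e mult.commute)
qed

end

section \<open>Divergence of vector fields and the area measure of a graph\<close>

definition divergence :: "('a::euclidean_space \<Rightarrow> 'a) \<Rightarrow> 'a \<Rightarrow> real" where
  "divergence X x = (\<Sum>b\<in>Basis. grad (\<lambda>y. X y \<bullet> b) x \<bullet> b)"

definition C1_field :: "'a::euclidean_space set \<Rightarrow> ('a \<Rightarrow> 'a) \<Rightarrow> bool" where
  "C1_field S X \<longleftrightarrow> (\<forall>b\<in>Basis. Ck_on 1 S (\<lambda>x. X x \<bullet> b))"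

lemma C1_fieldD: "C1_field S X \<Longrightarrow> b \<in> Basis \<Longrightarrow> Ck_on 1 S (\<lambda>x. X x \<bullet> b)"
  by (simp add: C1_field_def)

lemma divergence_cong:
  assumes "open S" "\<And>y. y \<in> S \<Longrightarrow> X y = Y y" "x \<in> S"
  shows "divergence X x = divergence Y x"
  unfolding divergence_def using assms by (intro sum.cong arg_cong2[where f=inner] grad_cong[of S]) auto

lemma C1_field_cong:
  assumes "open S" "\<And>y. y \<in> S \<Longrightarrow> X y = Y y"
  shows "C1_field S X \<longleftrightarrow> C1_field S Y"
  unfolding C1_field_def using assms by (intro ball_cong refl Ck_on_cong) auto

lemma continuous_on_divergence:
  assumes "C1_field S X"
  shows "continuous_on S (divergence X)"
proof -
  have "continuous_on S (grad (\<lambda>x. X x \<bullet> b))" if "b \<in> Basis" for b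
    using C1_fieldD[OF assms that] unfolding Ck_on_1_iff by simp
  then show ?thesis unfolding divergence_def by (intro continuous_intros)
qed

lemma divergence_const [simp]: "divergence (\<lambda>_. c) x = 0"
proof -
  have "grad (\<lambda>_. d) x = 0" for d by (simp add: grad_def)
  then show ?thesis by (simp add: divergence_def)
qed

text \<open>The push-forward to the ambient space of the area density on the parameter plane;
  \<open>graph_area\<close> gives its values on Borel sets.\<close>

definition graph_measure :: "'a::euclidean_space \<Rightarrow> ('a \<Rightarrow> real) \<Rightarrow> 'a measure" where
  "graph_measure e \<gamma> =
     distr (density (hplane e) (\<lambda>y. ennreal (sqrt (1 + (norm (grad \<gamma> (hyperplane_point e y)))\<^sup>2))))
       borel (\<lambda>y. hyperplane_point e y + \<gamma> (hyperplane_point e y) *\<^sub>R e)"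

lemma sets_graph_measure [simp, measurable_cong]: "sets (graph_measure e \<gamma>) = sets borel"
  and space_graph_measure [simp]: "space (graph_measure e \<gamma>) = UNIV"
  by (simp_all add: graph_measure_def)

context epigraph
begin

text \<open>A parameter set of finite measure containing every \<open>y\<close> whose graph point
  lies in the ball of radius \<open>R\<close>. Its indicator supplies the integrable majorants on
  the parameter plane.\<close>

definition cube :: "real \<Rightarrow> ('a \<Rightarrow> real) set" where
  "cube R = PiE (Basis - {e, - e}) (\<lambda>_. {- R..R})"

lemma sets_cube [measurable]: "cube R \<in> sets (hplane e)"
  unfolding cube_def hplane_def by (intro sets_PiM_I_finite) auto

lemma emeasure_cube: "emeasure (hplane e) (cube R) < \<infinity>"
proof -
  interpret product_sigma_finite "\<lambda>i::'a. lborel :: real measure" by standard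
  have "emeasure (hplane e) (cube R) = (\<Prod>i\<in>Basis - {e, - e}. emeasure lborel {- R..R})"
    unfolding hplane_def cube_def by (intro emeasure_PiM) auto
  also have "\<dots> < \<infinity>" by (simp add: emeasure_lborel_Icc_eq power_less_top_ennreal)
  finally show ?thesis .
qed

lemma graph_point_in_cube:
  assumes "norm (graph_point t y) \<le> R" "y \<in> space (hplane e)"
  shows "y \<in> cube R"
proof -
  have "\<bar>y i\<bar> \<le> R" if "i \<in> Basis - {e, - e}" for i
    using hyperplane_point_coord[OF that e] Basis_le_norm[of i "graph_point t y"] that assms(1)
    by (simp add: graph_point_def)
  then have "\<forall>i\<in>Basis - {e, - e}. y i \<in> {- R..R}" unfolding atLeastAtMost_iff abs_le_iff by fastforce
  moreover have "y \<in> extensional (Basis - {e, - e})"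
    using assms(2) by (simp add: hplane_def space_PiM PiE_def)
  ultimately show ?thesis by (simp only: cube_def PiE_iff)
qed

lemma integrable_hplane_bounded:
  fixes F :: "('a \<Rightarrow> real) \<Rightarrow> real"
  assumes [measurable]: "F \<in> borel_measurable (hplane e)"
    and "\<And>y. y \<in> space (hplane e) \<Longrightarrow> \<bar>F y\<bar> \<le> C * indicator (cube R) y"
  shows "integrable (hplane e) F"
proof (rule Bochner_Integration.integrable_bound)
  show "integrable (hplane e) (\<lambda>y. C * indicator (cube R) y :: real)"
    using emeasure_cube[of R] by (intro integrable_mult_right integrable_real_indicator) auto
  show "AE y in hplane e. norm (F y) \<le> norm (C * indicator (cube R) y :: real)"
    using assms(2) by (intro AE_I2) (metis abs_ge_self order_trans real_norm_def)
qed simp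

definition Cl :: "'a set" where "Cl = {x. \<gamma> x \<le> x \<bullet> e}"
definition graph :: "'a set" where "graph = {x. \<gamma> x = x \<bullet> e}"

lemma closed_Cl: "closed Cl" and closed_graph: "closed graph"
  unfolding Cl_def graph_def
  by (intro closed_Collect_le closed_Collect_eq continuous_intros cont_\<gamma>)+

lemma borel_Cl [measurable]: "Cl \<in> sets borel" and borel_graph [measurable]: "graph \<in> sets borel"
  using closed_Cl closed_graph by auto

lemma graph_point_Cl: "t \<ge> 0 \<Longrightarrow> graph_point t y \<in> Cl"
  and graph_point_graph: "graph_point 0 y \<in> graph"
  unfolding Cl_def graph_def mem_Collect_eq \<gamma>_graph_point graph_point_inner by auto

lemma grad_\<gamma>_graph_point: "grad \<gamma> (graph_point t y) = grad \<gamma> (hyperplane_point e y)"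
  unfolding graph_point_def by (rule grad_\<gamma>_shift)

text \<open>The outward unit normal of the graph, extended constantly along \<open>e\<close>. Being
  a C1 field on the whole space, it can be used as a test field.\<close>

definition normal :: "'a \<Rightarrow> 'a" where
  "normal x = (1 / sqrt (1 + (norm (grad \<gamma> x))\<^sup>2)) *\<^sub>R (grad \<gamma> x - e)"

lemma norm_grad_e: "norm (grad \<gamma> x - e) = sqrt (1 + (norm (grad \<gamma> x))\<^sup>2)"
proof -
  have "(grad \<gamma> x - e) \<bullet> (grad \<gamma> x - e) = 1 + (norm (grad \<gamma> x))\<^sup>2"
    using grad_\<gamma>_e[of x] inner_commute[of e "grad \<gamma> x"]
    by (simp add: inner_diff_left inner_diff_right power2_norm_eq_inner)
  then show ?thesis by (subst norm_eq_sqrt_inner) (simp only:)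
qed

lemma sqrt_pos: "0 < sqrt (1 + (norm (grad \<gamma> x))\<^sup>2)"
  by (simp add: add_pos_nonneg)

lemma norm_normal: "norm (normal x) = 1"
  using sqrt_pos[of x] by (simp add: normal_def norm_grad_e)

lemma cont_normal: "continuous_on S normal"
  unfolding normal_def using sqrt_pos
  by (intro continuous_intros cont_grad_\<gamma>) (auto simp: less_le)

lemma integral_graph_measure:
  fixes g :: "'a \<Rightarrow> real"
  assumes [measurable]: "g \<in> borel_measurable borel"
  shows "(LINT x|graph_measure e \<gamma>. g x)
    = (LINT y|hplane e. sqrt (1 + (norm (grad \<gamma> (hyperplane_point e y)))\<^sup>2) * g (graph_point 0 y))"
  unfolding graph_measure_def by (simp add: integral_distr integral_density graph_point_def)

lemma emeasure_graph_measure: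
  assumes [measurable]: "A \<in> sets borel"
  shows "emeasure (graph_measure e \<gamma>) A = graph_area e \<gamma> A"
proof -
  have "emeasure (graph_measure e \<gamma>) A = (\<integral>\<^sup>+x. indicator A x \<partial>graph_measure e \<gamma>)" by simp
  also have "\<dots> = (\<integral>\<^sup>+y. ennreal (sqrt (1 + (norm (grad \<gamma> (hyperplane_point e y)))\<^sup>2)) *
            indicator A (hyperplane_point e y + \<gamma> (hyperplane_point e y) *\<^sub>R e) \<partial>hplane e)"
    unfolding graph_measure_def by (subst nn_integral_distr, simp, simp, subst nn_integral_density) auto
  finally show ?thesis by (simp add: graph_area_def hplane_def)
qed

lemma emeasure_graph_measure_bounded:
  assumes A: "bounded A" "A \<in> sets borel"
  shows "emeasure (graph_measure e \<gamma>) A < \<infinity>"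
proof -
  note [measurable] = A(2)
  obtain R where R: "\<And>x. x \<in> A \<Longrightarrow> norm x \<le> R" using A(1) by (auto simp: bounded_iff)
  have "bounded (grad \<gamma> ` cball 0 R)"
    by (intro compact_imp_bounded compact_continuous_image cont_grad_\<gamma>) auto
  then obtain G where "\<forall>x\<in>cball 0 R. norm (grad \<gamma> x) \<le> G" by (auto simp: bounded_iff)
  then have G: "norm (grad \<gamma> x) \<le> G" if "norm x \<le> R" for x using that by simp
  have "emeasure (graph_measure e \<gamma>) A = (\<integral>\<^sup>+y. ennreal (sqrt (1 + (norm (grad \<gamma> (hyperplane_point e y)))\<^sup>2)) *
            indicator A (graph_point 0 y) \<partial>hplane e)"
    using A(2) by (simp add: emeasure_graph_measure graph_area_def hplane_def graph_point_def)
  also have "\<dots> \<le> (\<integral>\<^sup>+y. ennreal (sqrt (1 + G\<^sup>2)) * indicator (cube R) y \<partial>hplane e)"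
  proof (rule nn_integral_mono)
    fix y assume y: "y \<in> space (hplane e)"
    show "ennreal (sqrt (1 + (norm (grad \<gamma> (hyperplane_point e y)))\<^sup>2)) * indicator A (graph_point 0 y)
        \<le> ennreal (sqrt (1 + G\<^sup>2)) * indicator (cube R) y"
    proof (cases "graph_point 0 y \<in> A")
      case True
      then have "y \<in> cube R" "norm (grad \<gamma> (hyperplane_point e y)) \<le> G"
        using R G graph_point_in_cube[OF _ y] by (auto simp: grad_\<gamma>_graph_point[of 0, symmetric])
      then show ?thesis using True by (auto intro!: ennreal_leI power_mono)
    qed simp
  qed
  also have "\<dots> = ennreal (sqrt (1 + G\<^sup>2)) * emeasure (hplane e) (cube R)"
    by (simp add: nn_integral_cmult_indicator)
  also have "\<dots> < \<infinity>" using emeasure_cube[of R] by (simp add: ennreal_mult_less_top)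
  finally show ?thesis .
qed

text \<open>The identity holds on every layer, component by component. As t tends to 0, bounded
  divergence gives convergence of the volume integrals, and continuity of \<open>X\<close> up to the
  graph that of the boundary integrals.\<close>

theorem divergence_epigraph:
  assumes X: "continuous_on Cl X" "C1_field U X" and K: "compact K" "\<And>x. x \<notin> K \<Longrightarrow> X x = 0"
    and M: "\<And>x. x \<in> U \<Longrightarrow> \<bar>divergence X x\<bar> \<le> M"
  shows "(LINT x|lborel. indicator U x * divergence X x) =
    (LINT x|graph_measure e \<gamma>. indicator graph x * (X x \<bullet> normal x))"
proof -
  define t :: "nat \<Rightarrow> real" where "t n = inverse (real (Suc n))" for n
  have t: "t n > 0" for n by (simp add: t_def)
  have t0: "t \<longlonglongrightarrow> 0" unfolding t_def by (rule LIMSEQ_inverse_real_of_nat)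
  define n where "n y = grad \<gamma> (hyperplane_point e y) - e" for y
  have nm[measurable]: "n \<in> borel_measurable (hplane e)" unfolding n_def by measurable
  \<comment> \<open>\<open>X\<close> is controlled on \<open>Cl\<close> only; cutting it off there
    yields a Borel function on the whole space with the same values at all graph points.\<close>
  define X1 where "X1 x = indicator Cl x *\<^sub>R X x" for x
  have [measurable]: "X1 \<in> borel_measurable borel"
    unfolding X1_def by (rule borel_measurable_continuous_on_indicator[OF borel_Cl X(1)])
  have X1: "X1 (graph_point s y) = X (graph_point s y)" if "s \<ge> 0" for s y
    using graph_point_Cl[OF that] by (simp add: X1_def)
  obtain R where R: "\<And>x. x \<in> K \<Longrightarrow> norm x \<le> R"
    using compact_imp_bounded[OF K(1)] unfolding bounded_iff by blast
  have "bounded (X ` (K \<inter> Cl))"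
    using X(1) K(1) closed_Cl by (intro compact_imp_bounded compact_continuous_image)
      (auto intro: continuous_on_subset)
  then obtain L where L: "\<And>x. x \<in> K \<inter> Cl \<Longrightarrow> norm (X x) \<le> L" "L > 0" unfolding bounded_pos by auto
  have "bounded ((\<lambda>x. grad \<gamma> x - e) ` K)"
    by (intro compact_imp_bounded compact_continuous_image continuous_intros cont_grad_\<gamma> K(1))
  then obtain G where G: "\<And>x. x \<in> K \<Longrightarrow> norm (grad \<gamma> x - e) \<le> G" "G > 0" unfolding bounded_pos by auto
  \<comment> \<open>One majorant for all heights \<open>s \<ge> 0\<close>; it gives both
    integrability on each shifted graph and domination in the limit.\<close>
  have bd: "norm (X (graph_point s y)) * norm (n y) \<le> (L * G) * indicator (cube R) y"
    if "s \<ge> 0" "y \<in> space (hplane e)" for s y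
  proof (cases "graph_point s y \<in> K")
    case True
    then have "norm (X (graph_point s y)) \<le> L" "norm (n y) \<le> G" "y \<in> cube R"
      using L(1) graph_point_Cl[OF that(1)] G(1)[OF True] graph_point_in_cube[OF R[OF True] that(2)]
      by (auto simp: n_def grad_\<gamma>_graph_point)
    then show ?thesis by (simp add: mult_mono')
  next
    case False
    have "0 \<le> (L * G) * indicator (cube R) y" using L(2) G(2) by simp
    with False K(2) show ?thesis by simp
  qed
  have comp: "(LINT x|lborel. indicator (layer s) x * divergence X x) = (LINT y|hplane e. X (graph_point s y) \<bullet> n y)"
    if s: "s > 0" for s
  proof -
    have i1: "integrable lborel (\<lambda>x. indicator (layer s) x * (grad (\<lambda>y. X y \<bullet> b) x \<bullet> b))" if "b \<in> Basis" for b
    proof (rule cutoff(3)[OF _ _ K(1) s])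
      show "continuous_on U (\<lambda>x. grad (\<lambda>y. X y \<bullet> b) x \<bullet> b)"
        using C1_fieldD[OF X(2) that] unfolding Ck_on_1_iff by (intro continuous_intros) auto
      show "grad (\<lambda>y. X y \<bullet> b) x \<bullet> b = 0" if "x \<notin> K" for x
        using grad_eq_0_outside[OF K(1), of "\<lambda>y. X y \<bullet> b" x] K(2) that by simp
    qed
    have i2: "integrable (hplane e) (\<lambda>y. (X1 (graph_point s y) \<bullet> b) * (n y \<bullet> b))" if b: "b \<in> Basis" for b
    proof (rule integrable_hplane_bounded)
      show "(\<lambda>y. (X1 (graph_point s y) \<bullet> b) * (n y \<bullet> b)) \<in> borel_measurable (hplane e)" by measurable
      fix y assume y: "y \<in> space (hplane e)"
      have "\<bar>(X1 (graph_point s y) \<bullet> b) * (n y \<bullet> b)\<bar> \<le> norm (X (graph_point s y)) * norm (n y)"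
        using s b unfolding abs_mult by (intro mult_mono') (auto simp: X1 Basis_le_norm)
      also have "\<dots> \<le> (L * G) * indicator (cube R) y" using bd s y by auto
      finally show "\<bar>(X1 (graph_point s y) \<bullet> b) * (n y \<bullet> b)\<bar> \<le> (L * G) * indicator (cube R) y" .
    qed
    have "(LINT x|lborel. indicator (layer s) x * divergence X x) =
        (LINT x|lborel. (\<Sum>b\<in>Basis. indicator (layer s) x * (grad (\<lambda>y. X y \<bullet> b) x \<bullet> b)))"
      by (simp add: divergence_def sum_distrib_left)
    also have "\<dots> = (\<Sum>b\<in>Basis. (LINT x|lborel. indicator (layer s) x * (grad (\<lambda>y. X y \<bullet> b) x \<bullet> b)))"
      by (rule Bochner_Integration.integral_sum[OF i1])
    also have "\<dots> = (\<Sum>b\<in>Basis. (LINT y|hplane e. (X1 (graph_point s y) \<bullet> b) * (n y \<bullet> b)))"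
    proof (rule sum.cong[OF refl])
      fix b :: 'a assume b: "b \<in> Basis"
      have "(LINT x|lborel. indicator (layer s) x * (grad (\<lambda>y. X y \<bullet> b) x \<bullet> b)) =
          (LINT y|hplane e. (X (graph_point s y) \<bullet> b) * ((grad \<gamma> (hyperplane_point e y) - e) \<bullet> b))"
        by (rule integral_layer[OF C1_fieldD[OF X(2) b] K(1) _ s b]) (simp add: K(2))
      then show "(LINT x|lborel. indicator (layer s) x * (grad (\<lambda>y. X y \<bullet> b) x \<bullet> b)) =
          (LINT y|hplane e. (X1 (graph_point s y) \<bullet> b) * (n y \<bullet> b))"
        using s by (simp add: X1 n_def)
    qed
    also have "\<dots> = (LINT y|hplane e. (\<Sum>b\<in>Basis. (X1 (graph_point s y) \<bullet> b) * (n y \<bullet> b)))"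
      by (rule Bochner_Integration.integral_sum[OF i2, symmetric])
    also have "\<dots> = (LINT y|hplane e. X (graph_point s y) \<bullet> n y)"
      using s by (simp add: euclidean_inner[symmetric] X1)
    finally show ?thesis .
  qed
  have div0: "divergence X x = 0" if "x \<notin> K" for x
    using divergence_cong[of "- K" X "\<lambda>_. 0" x] K compact_imp_closed that by auto
  have lim1: "(\<lambda>k. LINT x|lborel. indicator (layer (t k)) x * divergence X x) \<longlonglongrightarrow>
      (LINT x|lborel. indicator U x * divergence X x)"
  proof (rule integral_dominated_convergence[where w="\<lambda>x. \<bar>M\<bar> * indicator (cball 0 R) x"])
    have dc: "continuous_on U (divergence X)" by (rule continuous_on_divergence[OF X(2)])
    show "(\<lambda>x. indicator U x * divergence X x) \<in> borel_measurable lborel"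
      using borel_measurable_continuous_on_indicator[OF borel_U dc] by simp
    show "(\<lambda>x. indicator (layer (t k)) x * divergence X x) \<in> borel_measurable lborel" for k
      using cutoff(1)[OF dc _ K(1) t] div0 by simp
    show "integrable lborel (\<lambda>x::'a. \<bar>M\<bar> * indicator (cball 0 R) x)"
      using emeasure_lborel_cball_finite[of "0::'a" R]
      by (intro integrable_mult_right integrable_real_indicator) auto
    show "AE x in lborel. (\<lambda>k. indicator (layer (t k)) x * divergence X x) \<longlonglongrightarrow> indicator U x * divergence X x"
    proof (intro AE_I2 tendsto_mult tendsto_const)
      fix x
      show "(\<lambda>k. indicator (layer (t k)) x :: real) \<longlonglongrightarrow> indicator U x"
      proof (cases "x \<in> U")
        case True
        then have "0 < x \<bullet> e - \<gamma> x" by (simp add: U_def)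
        with t0 have "\<forall>\<^sub>F k in sequentially. t k < x \<bullet> e - \<gamma> x" by (rule order_tendstoD(2))
        then have "\<forall>\<^sub>F k in sequentially. indicator (layer (t k)) x = (1::real)"
          by eventually_elim (simp add: layer_def)
        then show ?thesis using True by (simp add: tendsto_eventually)
      next
        case False
        then have "x \<notin> layer (t k)" for k using layer_subset[OF t] by blast
        then show ?thesis using False by simp
      qed
    qed
    show "AE x in lborel. norm (indicator (layer (t k)) x * divergence X x) \<le> \<bar>M\<bar> * indicator (cball 0 R) x" for k
    proof (rule AE_I2)
      fix x
      show "norm (indicator (layer (t k)) x * divergence X x) \<le> \<bar>M\<bar> * indicator (cball 0 R) x"
      proof (cases "x \<in> K \<and> x \<in> layer (t k)")
        case True
        then show ?thesis using M[of x] layer_subset[OF t[of k]] R[of x] by auto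
      qed (auto simp: div0)
    qed
  qed
  have lim2: "(\<lambda>k. LINT y|hplane e. X1 (graph_point (t k) y) \<bullet> n y) \<longlonglongrightarrow> (LINT y|hplane e. X1 (graph_point 0 y) \<bullet> n y)"
  proof (rule integral_dominated_convergence[where w="\<lambda>y. (L * G) * indicator (cube R) y"])
    show "integrable (hplane e) (\<lambda>y. (L * G) * indicator (cube R) y :: real)"
      using emeasure_cube[of R] by (intro integrable_mult_right integrable_real_indicator) auto
    show "AE y in hplane e. (\<lambda>k. X1 (graph_point (t k) y) \<bullet> n y) \<longlonglongrightarrow> X1 (graph_point 0 y) \<bullet> n y"
    proof (intro AE_I2 tendsto_inner tendsto_const)
      fix y
      have "(\<lambda>k. graph_point (t k) y) \<longlonglongrightarrow> graph_point 0 y"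
        unfolding graph_point_def by (intro tendsto_intros t0)
      then have "(\<lambda>k. X (graph_point (t k) y)) \<longlonglongrightarrow> X (graph_point 0 y)"
        by (rule continuous_on_tendsto_compose[OF X(1)])
          (use graph_point_Cl t in \<open>auto simp: less_imp_le\<close>)
      then show "(\<lambda>k. X1 (graph_point (t k) y)) \<longlonglongrightarrow> X1 (graph_point 0 y)"
        using t by (simp add: X1 less_imp_le)
    qed
    show "AE y in hplane e. norm (X1 (graph_point (t k) y) \<bullet> n y) \<le> (L * G) * indicator (cube R) y" for k
    proof (rule AE_I2)
      fix y assume "y \<in> space (hplane e)"
      with bd[of "t k" y] t[of k]
      show "norm (X1 (graph_point (t k) y) \<bullet> n y) \<le> (L * G) * indicator (cube R) y"
        using Cauchy_Schwarz_ineq2[of "X1 (graph_point (t k) y)" "n y"] by (simp add: X1)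
    qed
  qed measurable
  have "(LINT x|lborel. indicator (layer (t k)) x * divergence X x) = (LINT y|hplane e. X1 (graph_point (t k) y) \<bullet> n y)" for k
    using comp[OF t] t[of k] by (simp add: X1)
  with LIMSEQ_unique[OF lim1] lim2
  have "(LINT x|lborel. indicator U x * divergence X x) = (LINT y|hplane e. X1 (graph_point 0 y) \<bullet> n y)"
    by simp
  \<comment> \<open>The area density equals the length of \<open>grad \<gamma> - e\<close>, so it
    cancels the normalization in \<open>normal\<close>.\<close>
  also have "\<dots> = (LINT y|hplane e. sqrt (1 + (norm (grad \<gamma> (hyperplane_point e y)))\<^sup>2) *
      (X1 (graph_point 0 y) \<bullet> normal (graph_point 0 y)))"
    using sqrt_pos by (intro Bochner_Integration.integral_cong)
      (auto simp: normal_def grad_\<gamma>_graph_point n_def less_le)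
  also have "\<dots> = (LINT y|hplane e. sqrt (1 + (norm (grad \<gamma> (hyperplane_point e y)))\<^sup>2) *
      (indicator graph (graph_point 0 y) * (X1 (graph_point 0 y) \<bullet> normal (graph_point 0 y))))"
    by (simp add: graph_point_graph)
  also have "\<dots> = (LINT x|graph_measure e \<gamma>. indicator graph x * (X1 x \<bullet> normal x))"
    using borel_measurable_continuous_onI[OF cont_normal] by (intro integral_graph_measure[symmetric]) measurable
  also have "\<dots> = (LINT x|graph_measure e \<gamma>. indicator graph x * (X x \<bullet> normal x))"
    by (intro Bochner_Integration.integral_cong) (auto simp: X1_def graph_def Cl_def indicator_def)
  finally show ?thesis .
qed

end

section \<open>Boundary charts\<close>

context epigraph
begin

lemma DERIV_height:
  "((\<lambda>t. \<gamma> (x + t *\<^sub>R v) - (x + t *\<^sub>R v) \<bullet> e) has_real_derivative (grad \<gamma> x - e) \<bullet> v) (at 0)"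
proof -
  have "((\<lambda>t. \<gamma> (x + t *\<^sub>R v)) has_real_derivative grad \<gamma> x \<bullet> v) (at 0)"
    using has_real_derivative_along_line[of \<gamma> x 0 v] diff_\<gamma> by simp
  moreover have "((\<lambda>t. (x + t *\<^sub>R v) \<bullet> e) has_real_derivative v \<bullet> e) (at 0)"
    by (auto intro!: derivative_eq_intros simp: inner_add_left)
  ultimately show ?thesis
    using DERIV_diff[of "\<lambda>t. \<gamma> (x + t *\<^sub>R v)" _ 0 UNIV "\<lambda>t. (x + t *\<^sub>R v) \<bullet> e"]
    by (simp add: inner_diff_left inner_commute[of e])
qed

lemma C1_field_normal: "C1_field UNIV normal"
  unfolding C1_field_def
proof
  fix b :: 'a assume b: "b \<in> Basis"
  define s where "s x = 1 + (\<Sum>c\<in>Basis. partial_deriv c \<gamma> x * partial_deriv c \<gamma> x)" for x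
  have s: "1 + (norm (grad \<gamma> x))\<^sup>2 = s x" for x
    unfolding s_def power2_norm_eq_inner by (subst euclidean_inner) (simp add: grad_inner)
  have sC: "Ck_on 1 UNIV s"
    unfolding s_def by (intro Ck_on_add Ck_on_sum Ck_on_mult Ck_on_const C1_partial_\<gamma>) auto
  have s1: "s x \<in> {0<..}" for x
    unfolding s_def by (simp add: add_pos_nonneg sum_nonneg)
  have d: "((\<lambda>t. 1 / sqrt t) has_real_derivative - (inverse (sqrt t) / 2) / (sqrt t)\<^sup>2) (at t)" if "t \<in> {0<..}" for t
    using that by (auto intro!: derivative_eq_intros simp: power2_eq_square)
  have "Ck_on 1 UNIV (\<lambda>x. 1 / sqrt (s x))"
    by (rule Ck_on_1_compose(1)[OF open_UNIV sC s1 d]) (auto intro!: continuous_intros)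
  then have "Ck_on 1 UNIV (\<lambda>x. 1 / sqrt (s x) * (partial_deriv b \<gamma> x - e \<bullet> b))"
    by (intro Ck_on_mult Ck_on_diff Ck_on_const C1_partial_\<gamma> b) auto
  moreover have "normal x \<bullet> b = 1 / sqrt (s x) * (partial_deriv b \<gamma> x - e \<bullet> b)" for x
    by (simp add: normal_def s inner_diff_left grad_inner[OF b])
  ultimately show "Ck_on 1 UNIV (\<lambda>x. normal x \<bullet> b)" by (simp del: Ck_on.simps)
qed

lemma normal_inner_e: "normal x \<bullet> e = - 1 / sqrt (1 + (norm (grad \<gamma> x))\<^sup>2)"
  by (simp add: normal_def inner_diff_left grad_\<gamma>_e)

end

locale chart =
  fixes \<Omega> :: "'a::euclidean_space set" and p :: 'a and r :: real and e :: 'a and \<gamma> :: "'a \<Rightarrow> real"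
  assumes open_\<Omega>: "open \<Omega>" and bg: "boundary_graph \<Omega> p r e \<gamma>"

sublocale chart \<subseteq> epigraph e \<gamma>
  using bg by unfold_locales (auto simp: boundary_graph_def)

context chart
begin

lemma r_pos: "r > 0"
  using bg by (simp add: boundary_graph_def)

lemma \<Omega>_ball: "x \<in> ball p r \<Longrightarrow> x \<in> \<Omega> \<longleftrightarrow> x \<in> U"
  using bg by (auto simp: boundary_graph_def U_def)

lemma U_Cl: "U \<subseteq> Cl"
  by (auto simp: U_def Cl_def)

lemma closure_ball:
  assumes x: "x \<in> ball p r"
  shows "x \<in> closure \<Omega> \<longleftrightarrow> x \<in> Cl"
proof
  assume c: "x \<in> closure \<Omega>"
  show "x \<in> Cl"
  proof (rule ccontr)
    assume "x \<notin> Cl"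
    then have "x \<in> (- Cl \<inter> ball p r) \<inter> closure \<Omega>" using x c by simp
    moreover have "open (- Cl \<inter> ball p r)" using closed_Cl by (intro open_Int) auto
    ultimately have "(- Cl \<inter> ball p r) \<inter> \<Omega> \<noteq> {}"
      using open_Int_closure_eq_empty by blast
    then obtain y where "y \<notin> Cl" "y \<in> ball p r" "y \<in> \<Omega>" by auto
    then show False using \<Omega>_ball U_Cl by auto
  qed
next
  assume c: "x \<in> Cl"
  show "x \<in> closure \<Omega>"
  proof (rule ccontr)
    assume "x \<notin> closure \<Omega>"
    then have "open (- closure \<Omega> \<inter> ball p r)" "x \<in> - closure \<Omega> \<inter> ball p r" using x by auto
    then obtain d where d: "d > 0" "ball x d \<subseteq> - closure \<Omega> \<inter> ball p r"
      by (meson open_contains_ball)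
    define y where "y = x + (d / 2) *\<^sub>R e"
    have "y \<in> ball x d" using d(1) by (simp add: y_def dist_norm norm_e)
    moreover have "y \<in> U"
      using c d(1) by (simp add: y_def U_def Cl_def inv inner_add_left)
    ultimately have "y \<in> \<Omega>" "y \<notin> closure \<Omega>" using \<Omega>_ball[of y] d(2) by auto
    then show False using closure_subset by auto
  qed
qed

lemma frontier_ball: "x \<in> ball p r \<Longrightarrow> x \<in> frontier \<Omega> \<longleftrightarrow> x \<in> graph"
  using closure_ball \<Omega>_ball open_\<Omega>
  by (auto simp: frontier_def interior_open U_def Cl_def graph_def)

text \<open>A curve in the boundary keeps \<open>\<gamma> y - y \<bullet> e\<close> at zero, so its
  velocity is orthogonal to the gradient of this function. Conversely, the line through
  \<open>x\<close> in direction \<open>w\<close>, moved along \<open>e\<close> back to the graph, is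
  a curve in the boundary; the correction has derivative zero, so the velocity is still
  \<open>w\<close>.\<close>

lemma tangent_vector_iff:
  assumes x: "x \<in> ball p r" "x \<in> graph"
  shows "tangent_vector (frontier \<Omega>) x w \<longleftrightarrow> (grad \<gamma> x - e) \<bullet> w = 0"
proof
  assume "tangent_vector (frontier \<Omega>) x w"
  then obtain c d where c: "c 0 = x" "d > 0" "\<And>t. \<bar>t\<bar> < d \<Longrightarrow> c t \<in> frontier \<Omega>"
    and cD: "(c has_vector_derivative w) (at (0::real))"
    unfolding tangent_vector_def by blast
  have "(c \<longlongrightarrow> x) (at 0)"
    using has_vector_derivative_continuous[OF cD] c(1) by (simp add: isCont_def)
  then have ev: "\<forall>\<^sub>F t in at 0. c t \<in> ball p r"
    using x(1) by (intro topological_tendstoD) auto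
  have "(c has_derivative (\<lambda>t. t *\<^sub>R w)) (at 0)" using cD by (simp add: has_vector_derivative_def)
  moreover have "((\<lambda>y. \<gamma> y - y \<bullet> e) has_derivative (\<lambda>h. (grad \<gamma> x - e) \<bullet> h)) (at (c 0))"
    unfolding c(1) by (auto intro!: derivative_eq_intros has_derivative_grad[OF diff_\<gamma>]
        simp: inner_diff_left inner_commute[of e])
  ultimately have D: "((\<lambda>t. \<gamma> (c t) - c t \<bullet> e) has_real_derivative (grad \<gamma> x - e) \<bullet> w) (at 0)"
    unfolding has_field_derivative_def
    using has_derivative_compose[of c "\<lambda>t. t *\<^sub>R w" 0 UNIV "\<lambda>y. \<gamma> y - y \<bullet> e" "\<lambda>h. (grad \<gamma> x - e) \<bullet> h"]
    by (simp add: mult_commute_abs)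
  have "\<forall>\<^sub>F t in at (0::real). \<bar>t\<bar> < d"
    using c(2) by (auto simp: eventually_at dist_real_def intro: exI[of _ d])
  with ev have "\<forall>\<^sub>F t in at 0. \<gamma> (c t) - c t \<bullet> e = 0"
    by eventually_elim (use c(3) frontier_ball in \<open>auto simp: graph_def\<close>)
  moreover have "\<gamma> (c 0) - c 0 \<bullet> e = 0" using x(2) c(1) by (simp add: graph_def)
  ultimately have "\<forall>\<^sub>F t in nhds 0. \<gamma> (c t) - c t \<bullet> e = 0"
    by (simp add: eventually_nhds_conv_at)
  then have "((\<lambda>t. 0) has_real_derivative (grad \<gamma> x - e) \<bullet> w) (at (0::real))"
    using D DERIV_cong_ev[OF refl _ refl, of "\<lambda>t. \<gamma> (c t) - c t \<bullet> e" "\<lambda>t. 0" 0] by simp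
  then show "(grad \<gamma> x - e) \<bullet> w = 0" using DERIV_const DERIV_unique by blast
next
  assume w: "(grad \<gamma> x - e) \<bullet> w = 0"
  define c where "c t = x + t *\<^sub>R w + (\<gamma> (x + t *\<^sub>R w) - (x + t *\<^sub>R w) \<bullet> e) *\<^sub>R e" for t
  have "((\<lambda>t. \<gamma> (x + t *\<^sub>R w) - (x + t *\<^sub>R w) \<bullet> e) has_vector_derivative 0) (at 0)"
    using DERIV_height[of x w] w by (simp add: has_real_derivative_iff_has_vector_derivative)
  then have cD: "(c has_vector_derivative w) (at 0)"
  proof -
    assume H: "((\<lambda>t. \<gamma> (x + t *\<^sub>R w) - (x + t *\<^sub>R w) \<bullet> e) has_vector_derivative 0) (at 0)"
    have "((\<lambda>t. x + t *\<^sub>R w) has_vector_derivative w) (at 0)"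
      by (auto intro!: derivative_eq_intros)
    from has_vector_derivative_add[OF this
        bounded_linear.has_vector_derivative[OF bounded_linear_scaleR_left H, of e]]
    show ?thesis by (simp add: c_def[abs_def])
  qed
  have c0: "c 0 = x" using x(2) by (simp add: c_def graph_def)
  have graph: "c t \<in> graph" for t
    unfolding graph_def c_def by (simp add: inv inner_add_left)
  have "isCont c 0" using cD by (rule has_vector_derivative_continuous)
  then have "\<forall>\<^sub>F t in nhds 0. c t \<in> ball p r"
    using x(1) c0 by (intro topological_tendstoD) (auto simp: isCont_def tendsto_at_iff_tendsto_nhds)
  then obtain d where "d > 0" "\<And>t. dist t 0 < d \<Longrightarrow> c t \<in> ball p r"
    unfolding eventually_nhds_metric by blast
  then show "tangent_vector (frontier \<Omega>) x w"
    unfolding tangent_vector_def using c0 cD graph frontier_ball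
    by (intro exI[of _ c] exI[of _ d]) (auto simp: dist_real_def)
qed

text \<open>The function \<open>\<gamma> y - y \<bullet> e\<close> is negative exactly inside and
  vanishes at \<open>x\<close>, so the sign of its derivative along \<open>v\<close> decides on
  which side short segments lie.\<close>

lemma eventually_side:
  assumes x: "x \<in> ball p r" "x \<in> graph"
  shows "0 < (grad \<gamma> x - e) \<bullet> v \<Longrightarrow> \<forall>\<^sub>F t in at_right 0. x + t *\<^sub>R v \<notin> \<Omega>"
    and "(grad \<gamma> x - e) \<bullet> v < 0 \<Longrightarrow> \<forall>\<^sub>F t in at_right 0. x + t *\<^sub>R v \<in> \<Omega>"
proof -
  have x0: "\<gamma> (x + 0 *\<^sub>R v) - (x + 0 *\<^sub>R v) \<bullet> e = 0" using x(2) by (simp add: graph_def)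
  have "((\<lambda>t. x + t *\<^sub>R v) \<longlongrightarrow> x + 0 *\<^sub>R v) (at_right 0)" by (intro tendsto_intros)
  then have ev: "\<forall>\<^sub>F t in at_right 0. x + t *\<^sub>R v \<in> ball p r"
    using x(1) by (intro topological_tendstoD) auto
  show "\<forall>\<^sub>F t in at_right 0. x + t *\<^sub>R v \<notin> \<Omega>" if pos: "0 < (grad \<gamma> x - e) \<bullet> v"
  proof -
    obtain d where "d > 0" "\<And>t. 0 < t \<Longrightarrow> t < d \<Longrightarrow> 0 < \<gamma> (x + t *\<^sub>R v) - (x + t *\<^sub>R v) \<bullet> e"
      using DERIV_pos_inc_right[OF DERIV_height pos] x0 by auto
    then have "\<forall>\<^sub>F t in at_right 0. 0 < \<gamma> (x + t *\<^sub>R v) - (x + t *\<^sub>R v) \<bullet> e"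
      by (auto simp: eventually_at_right_field)
    with ev show ?thesis by eventually_elim (use \<Omega>_ball in \<open>auto simp: U_def\<close>)
  qed
  show "\<forall>\<^sub>F t in at_right 0. x + t *\<^sub>R v \<in> \<Omega>" if neg: "(grad \<gamma> x - e) \<bullet> v < 0"
  proof -
    obtain d where "d > 0" "\<And>t. 0 < t \<Longrightarrow> t < d \<Longrightarrow> \<gamma> (x + t *\<^sub>R v) - (x + t *\<^sub>R v) \<bullet> e < 0"
      using DERIV_neg_dec_right[OF DERIV_height neg] x0 by auto
    then have "\<forall>\<^sub>F t in at_right 0. \<gamma> (x + t *\<^sub>R v) - (x + t *\<^sub>R v) \<bullet> e < 0"
      by (auto simp: eventually_at_right_field)
    with ev show ?thesis by eventually_elim (use \<Omega>_ball in \<open>auto simp: U_def\<close>)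
  qed
qed

text \<open>Resolves the description: a vector orthogonal to all tangent vectors is a multiple of
  \<open>grad \<gamma> x - e\<close>; unit length fixes the modulus of the factor, and the side
  condition excludes a negative sign.\<close>

lemma outward_normal_eq:
  assumes x: "x \<in> ball p r" "x \<in> graph"
  shows "outward_normal \<Omega> x = normal x"
proof -
  define n where "n = grad \<gamma> x - e"
  define k where "k = sqrt (1 + (norm (grad \<gamma> x))\<^sup>2)"
  have k: "k > 0" unfolding k_def by (rule sqrt_pos)
  have nn: "n \<bullet> n = k * k" "norm n = k"
    using norm_grad_e[of x] by (simp_all add: n_def k_def dot_square_norm power2_eq_square)
  have N: "normal x = (1 / k) *\<^sub>R n" by (simp add: normal_def n_def k_def)
  show ?thesis unfolding outward_normal_def
  proof (rule the_equality)
    have "0 < n \<bullet> normal x" using k nn(1) by (simp add: N)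
    then show "norm (normal x) = 1 \<and> (\<forall>w. tangent_vector (frontier \<Omega>) x w \<longrightarrow> normal x \<bullet> w = 0) \<and>
        (\<forall>\<^sub>F t in at_right 0. x + t *\<^sub>R normal x \<notin> \<Omega>)"
    proof (intro conjI)
      show "norm (normal x) = 1" by (rule norm_normal)
      show "\<forall>w. tangent_vector (frontier \<Omega>) x w \<longrightarrow> normal x \<bullet> w = 0"
        by (simp add: N n_def tangent_vector_iff[OF x])
      show "\<forall>\<^sub>F t in at_right 0. x + t *\<^sub>R normal x \<notin> \<Omega>"
        using \<open>0 < n \<bullet> normal x\<close> unfolding n_def by (rule eventually_side(1)[OF x])
    qed
    fix v assume v: "norm v = 1 \<and> (\<forall>w. tangent_vector (frontier \<Omega>) x w \<longrightarrow> v \<bullet> w = 0) \<and>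
        (\<forall>\<^sub>F t in at_right 0. x + t *\<^sub>R v \<notin> \<Omega>)"
    define c where "c = (v \<bullet> n) / (n \<bullet> n)"
    \<comment> \<open>The part of \<open>v\<close> orthogonal to \<open>n\<close> is a tangent
      vector, hence orthogonal to \<open>v\<close> as well as to \<open>n\<close>, and therefore to
      itself.\<close>
    define w where "w = v - c *\<^sub>R n"
    have "n \<bullet> w = 0" using nn k by (simp add: w_def c_def inner_diff_right inner_commute)
    then have "v \<bullet> w = 0" using v tangent_vector_iff[OF x, of w] by (simp add: n_def)
    with \<open>n \<bullet> w = 0\<close> have "(v - c *\<^sub>R n) \<bullet> w = 0" by (simp add: inner_diff_left)
    then have "w \<bullet> w = 0" by (simp only: w_def[symmetric])
    then have vc: "v = c *\<^sub>R n" by (simp add: w_def)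
    then have "\<bar>c\<bar> * k = 1" using v nn by simp
    moreover have "c \<ge> 0"
    proof (rule ccontr)
      assume "\<not> c \<ge> 0"
      then have "n \<bullet> v < 0" using k nn by (simp add: vc mult_neg_pos)
      then have "\<forall>\<^sub>F t in at_right 0. x + t *\<^sub>R v \<in> \<Omega>"
        using eventually_side(2)[OF x, of v] by (simp add: n_def)
      moreover have "\<forall>\<^sub>F t in at_right 0. x + t *\<^sub>R v \<notin> \<Omega>" using v by simp
      ultimately have "\<forall>\<^sub>F t in at_right (0::real). False" by eventually_elim simp
      then show False by simp
    qed
    ultimately have "c = 1 / k" using k by (simp add: field_simps)
    then show "v = normal x" by (simp add: N vc)
  qed
qed

text \<open>A field supported inside the ball sees only one graph. Extended by zero it becomes a
  field on the whole epigraph, with regularity glued from the ball and the complement of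
  \<open>K\<close>.\<close>

theorem divergence_chart:
  assumes X: "continuous_on (closure \<Omega>) X" "C1_field \<Omega> X"
    and K: "compact K" "K \<subseteq> ball p r" "\<And>x. x \<in> closure \<Omega> \<Longrightarrow> x \<notin> K \<Longrightarrow> X x = 0"
    and M: "\<And>x. x \<in> \<Omega> \<Longrightarrow> \<bar>divergence X x\<bar> \<le> M"
  shows "(LINT x|lborel. indicator \<Omega> x * divergence X x) =
    (LINT x|graph_measure e \<gamma>. indicator (frontier \<Omega> \<inter> ball p r) x * (X x \<bullet> outward_normal \<Omega> x))"
proof -
  \<comment> \<open>The cutoff includes the closure of \<Omega>, since the values of
    \<open>X\<close> outside it are arbitrary.\<close>
  define Y where "Y x = (if x \<in> K \<and> x \<in> closure \<Omega> then X x else 0)" for x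
  have cK: "closed K" using K(1) compact_imp_closed by blast
  have YX: "Y x = X x" if "x \<in> closure \<Omega>" for x using K(3) that by (auto simp: Y_def)
  have Y0: "Y x = 0" if "x \<notin> K" for x using that by (simp add: Y_def)
  have YC: "continuous_on Cl Y"
  proof -
    have "Cl = (Cl \<inter> ball p r) \<union> (Cl - K)" using K(2) by auto
    moreover have "continuous_on ((Cl \<inter> ball p r) \<union> (Cl - K)) Y"
    proof (rule continuous_on_Un_local_open)
      have o: "openin (top_of_set Cl) (Cl \<inter> ball p r)" "openin (top_of_set Cl) (Cl - K)"
        using cK by (auto simp: openin_open Diff_eq)
      then show "openin (top_of_set (Cl \<inter> ball p r \<union> (Cl - K))) (Cl \<inter> ball p r)"
        "openin (top_of_set (Cl \<inter> ball p r \<union> (Cl - K))) (Cl - K)"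
        using K(2) by (simp_all add: Un_Diff_Int Int_Un_distrib flip: \<open>Cl = (Cl \<inter> ball p r) \<union> (Cl - K)\<close>)
      have "continuous_on (Cl \<inter> ball p r) X"
        using X(1) closure_ball by (elim continuous_on_subset) auto
      then show "continuous_on (Cl \<inter> ball p r) Y"
        using YX closure_ball by (subst continuous_on_cong[OF refl, of _ Y X]) auto
      show "continuous_on (Cl - K) Y"
        using Y0 by (subst continuous_on_cong[OF refl, of _ Y "\<lambda>_. 0"]) auto
    qed
    ultimately show ?thesis by simp
  qed
  have o1: "open (U \<inter> ball p r)" and o2: "open (U - K)" and o3: "open (\<Omega> - K)"
    using open_U cK open_\<Omega> by auto
  have YO: "Y x = X x" if "x \<in> U \<inter> ball p r" for x
    using that YX \<Omega>_ball closure_subset by blast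
  have YU: "C1_field U Y"
    unfolding C1_field_def
  proof
    fix b :: 'a assume b: "b \<in> Basis"
    have "U \<inter> ball p r \<subseteq> \<Omega>" using \<Omega>_ball by blast
    then have "Ck_on 1 (U \<inter> ball p r) (\<lambda>x. X x \<bullet> b)"
      by (rule Ck_on_subset[OF C1_fieldD[OF X(2) b]])
    then have *: "Ck_on 1 (U \<inter> ball p r) (\<lambda>x. Y x \<bullet> b)"
      using Ck_on_cong[OF o1, of "\<lambda>x. Y x \<bullet> b" "\<lambda>x. X x \<bullet> b"] YO by (simp del: Ck_on.simps)
    have "Ck_on 1 (U - K) (\<lambda>x. Y x \<bullet> b)"
      using Y0 by (subst Ck_on_cong[OF o2, of _ "\<lambda>x. 0"]) (auto simp del: Ck_on.simps)
    note Ck = this[unfolded Ck_on_1_iff] *[unfolded Ck_on_1_iff]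
    have "U = (U \<inter> ball p r) \<union> (U - K)" using K(2) by auto
    moreover have "continuous_on ((U \<inter> ball p r) \<union> (U - K)) (grad (\<lambda>x. Y x \<bullet> b))"
      using Ck by (intro continuous_on_open_Un o1 o2) auto
    moreover have "\<forall>x\<in>(U \<inter> ball p r) \<union> (U - K). (\<lambda>x. Y x \<bullet> b) differentiable at x" using Ck by auto
    ultimately show "Ck_on 1 U (\<lambda>x. Y x \<bullet> b)" unfolding Ck_on_1_iff by metis
  qed
  have dY: "divergence Y x = divergence X x" if "x \<in> U \<inter> ball p r" for x
    by (rule divergence_cong[OF o1 YO that])
  have dY0: "divergence Y x = 0" if "x \<notin> K" for x
    using divergence_cong[of "- K" Y "\<lambda>_. 0" x] Y0 cK that by auto
  have dX0: "divergence X x = 0" if "x \<in> \<Omega>" "x \<notin> K" for x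
    using divergence_cong[OF o3, of X "\<lambda>_. 0" x] K(3) that closure_subset by auto
  have "(LINT x|lborel. indicator \<Omega> x * divergence X x) = (LINT x|lborel. indicator U x * divergence Y x)"
  proof (rule Bochner_Integration.integral_cong[OF refl])
    fix x show "indicator \<Omega> x * divergence X x = indicator U x * divergence Y x"
      using dX0[of x] dY[of x] dY0[of x] \<Omega>_ball[of x] K(2) by (cases "x \<in> K") (auto simp: indicator_def)
  qed
  also have "\<dots> = (LINT x|graph_measure e \<gamma>. indicator graph x * (Y x \<bullet> normal x))"
  proof (rule divergence_epigraph[OF YC YU K(1) Y0])
    fix x assume "x \<in> U"
    then show "\<bar>divergence Y x\<bar> \<le> \<bar>M\<bar>"
      using M[of x] dY[of x] dY0[of x] \<Omega>_ball[of x] K(2) by (cases "x \<in> K") auto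
  qed
  also have "\<dots> = (LINT x|graph_measure e \<gamma>. indicator (frontier \<Omega> \<inter> ball p r) x * (X x \<bullet> outward_normal \<Omega> x))"
  proof (rule Bochner_Integration.integral_cong[OF refl])
    fix x show "indicator graph x * (Y x \<bullet> normal x) = indicator (frontier \<Omega> \<inter> ball p r) x * (X x \<bullet> outward_normal \<Omega> x)"
    proof (cases "x \<in> ball p r")
      case True
      then show ?thesis
        using frontier_ball[OF True] outward_normal_eq[OF True] YX[of x] by (auto simp: indicator_def frontier_def)
    next
      case False
      then have "x \<notin> K" using K(2) by blast
      then show ?thesis using Y0[of x] False by simp
    qed
  qed
  finally show ?thesis .
qed

end

section \<open>The surface measure\<close>

text \<open>Testing the divergence theorem with \<open>X = \<phi> \<nu>\<close> shows that the area of a boundary piece does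
  not depend on the graph representation; no change of variables is needed.\<close>

lemma graph_area_consistent:
  fixes \<Omega> :: "'a::euclidean_space set"
  assumes c: "chart \<Omega> p r e \<gamma>" and c': "chart \<Omega> p' r' e' \<gamma>'" and bdd: "bounded \<Omega>"
    and A: "A \<in> sets borel" "A \<subseteq> frontier \<Omega> \<inter> ball p r \<inter> ball p' r'"
  shows "graph_area e \<gamma> A = graph_area e' \<gamma>' A"
proof -
  interpret chart \<Omega> p r e \<gamma> by (rule c)
  interpret c': chart \<Omega> p' r' e' \<gamma>' by (rule c')
  define F where "F = frontier \<Omega> \<inter> ball p r"
  define F' where "F' = frontier \<Omega> \<inter> ball p' r'"
  have F[measurable]: "F \<in> sets borel" "F' \<in> sets borel"
    unfolding F_def F'_def by (auto intro!: borel_closed frontier_closed)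
  have bF: "bounded F" "bounded F'" unfolding F_def F'_def by (auto intro: bounded_subset[OF bounded_ball])
  define M where "M = density (graph_measure e \<gamma>) (indicator F)"
  define N where "N = density (graph_measure e' \<gamma>') (indicator F')"
  have M: "emeasure M B = emeasure (graph_measure e \<gamma>) (F \<inter> B)" if [measurable]: "B \<in> sets borel" for B
    unfolding M_def by (subst emeasure_density)
      (auto simp: indicator_inter_arith[symmetric] simp flip: nn_integral_indicator)
  have N: "emeasure N B = emeasure (graph_measure e' \<gamma>') (F' \<inter> B)" if [measurable]: "B \<in> sets borel" for B
    unfolding N_def by (subst emeasure_density)
      (auto simp: indicator_inter_arith[symmetric] simp flip: nn_integral_indicator)
  have fin: "emeasure (graph_measure e \<gamma>) (F \<inter> B) < \<infinity>" "emeasure (graph_measure e' \<gamma>') (F' \<inter> B) < \<infinity>"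
    if "B \<in> sets borel" for B
    using that F bF emeasure_graph_measure_bounded[of "F \<inter> B"]
      c'.emeasure_graph_measure_bounded[of "F' \<inter> B"] by (auto simp: bounded_Int)
  \<comment> \<open>With the closed box inside both balls, a field supported in it has compact
    support in both charts, so both chart versions of the divergence theorem apply.\<close>
  have boxes: "emeasure M (box a b) = emeasure N (box a b)" if ab: "cbox a b \<subseteq> ball p r \<inter> ball p' r'" for a b
  proof (cases "box a b = {}")
    case False
    define \<phi> where "\<phi> j = box_bump a b (real (Suc j))" for j
    have \<phi>0: "\<phi> j x = 0" if "x \<notin> cbox a b" for j x
      using box_bump_support[of "real (Suc j)" a b] False that by (auto simp: \<phi>_def)
    have \<phi>C: "Ck_on 1 UNIV (\<phi> j)" for j
      unfolding \<phi>_def by (rule smooth_onD[OF smooth_on_box_bump])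
    have \<phi>m[measurable]: "\<phi> j \<in> borel_measurable borel" for j
      using Ck_on_imp_continuous_on[OF \<phi>C] by (rule borel_measurable_continuous_onI)
    \<comment> \<open>Since \<open>G\<close> has finite area, its indicator dominates the bumps, and
      their integrals tend to the area of the part of \<open>G\<close> in the box.\<close>
    have lim: "(\<lambda>j. LINT x|graph_measure e0 \<gamma>0. indicator G x * \<phi> j x) \<longlonglongrightarrow> measure (graph_measure e0 \<gamma>0) (G \<inter> box a b)"
      if G: "G \<in> sets borel" "emeasure (graph_measure e0 \<gamma>0) G < \<infinity>" for e0 \<gamma>0 G
    proof -
      note [measurable] = G(1)
      have "(\<lambda>j. LINT x|graph_measure e0 \<gamma>0. indicator G x * \<phi> j x) \<longlonglongrightarrow>
          (LINT x|graph_measure e0 \<gamma>0. indicator G x * indicator (box a b) x)"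
      proof (rule integral_dominated_convergence[where w="indicator G"])
        show "integrable (graph_measure e0 \<gamma>0) (indicator G :: 'a \<Rightarrow> real)"
          using G by (intro integrable_real_indicator) auto
        show "AE x in graph_measure e0 \<gamma>0. (\<lambda>j. indicator G x * \<phi> j x) \<longlonglongrightarrow> indicator G x * indicator (box a b) x"
          unfolding \<phi>_def by (intro AE_I2 tendsto_mult tendsto_const box_bump_tendsto[OF False])
        show "AE x in graph_measure e0 \<gamma>0. norm (indicator G x * \<phi> j x) \<le> indicator G x" for j
          by (intro AE_I2) (auto simp: indicator_def \<phi>_def box_bump_nonneg box_bump_le_1)
      qed (auto simp: \<phi>m)
      moreover have "(LINT x|graph_measure e0 \<gamma>0. indicator G x * indicator (box a b) x) = measure (graph_measure e0 \<gamma>0) (G \<inter> box a b)"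
        by (simp add: indicator_inter_arith[symmetric])
      ultimately show ?thesis by simp
    qed
    have eq: "(LINT x|graph_measure e \<gamma>. indicator F x * \<phi> j x) = (LINT x|graph_measure e' \<gamma>'. indicator F' x * \<phi> j x)" for j
    proof -
      define X where "X x = \<phi> j x *\<^sub>R normal x" for x
      have X1: "C1_field UNIV X"
        unfolding C1_field_def X_def inner_scaleR_left
        by (intro ballI Ck_on_mult \<phi>C C1_fieldD[OF C1_field_normal]) auto
      have Xc: "continuous_on (closure \<Omega>) X"
        unfolding X_def using continuous_on_subset[OF Ck_on_imp_continuous_on[OF \<phi>C]]
        by (intro continuous_intros cont_normal) auto
      have XO: "C1_field \<Omega> X"
        using C1_fieldD[OF X1] unfolding C1_field_def by (meson Ck_on_subset subset_UNIV)
      have "continuous_on (closure \<Omega>) (divergence X)"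
        using continuous_on_divergence[OF X1] continuous_on_subset by blast
      then have "bounded (divergence X ` closure \<Omega>)"
        using bdd by (intro compact_imp_bounded compact_continuous_image) (auto simp: compact_closure)
      then obtain D where "\<forall>x\<in>closure \<Omega>. \<bar>divergence X x\<bar> \<le> D" by (auto simp: bounded_iff)
      then have D: "\<bar>divergence X x\<bar> \<le> D" if "x \<in> \<Omega>" for x using that closure_subset by auto
      have X0: "X x = 0" if "x \<notin> cbox a b" for x using \<phi>0[OF that] by (simp add: X_def)
      have Xn: "indicator F x * (X x \<bullet> outward_normal \<Omega> x) = indicator F x * \<phi> j x" for x
      proof (cases "x \<in> F")
        case True
        then have "outward_normal \<Omega> x = normal x"
          using frontier_ball outward_normal_eq by (auto simp: F_def)
        then show ?thesis using norm_normal[of x] by (simp add: X_def dot_square_norm)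
      qed simp
      \<comment> \<open>The normal of the first chart also serves in the second: inside the box the
        two boundary pieces coincide and \<open>outward_normal\<close> does not refer to a chart,
        while off the box both sides vanish.\<close>
      have Xn': "indicator F' x * (X x \<bullet> outward_normal \<Omega> x) = indicator F' x * \<phi> j x" for x
      proof (cases "x \<in> cbox a b")
        case True
        then have "indicator F x = (indicator F' x :: real)" using ab by (auto simp: F_def F'_def indicator_def)
        then show ?thesis using Xn[of x] by simp
      qed (simp add: X0 \<phi>0)
      have "(LINT x|graph_measure e \<gamma>. indicator F x * \<phi> j x) = (LINT x|lborel. indicator \<Omega> x * divergence X x)"
        using divergence_chart[OF Xc XO _ _ X0 D, of "cbox a b"] ab by (simp add: F_def[symmetric] Xn)
      also have "\<dots> = (LINT x|graph_measure e' \<gamma>'. indicator F' x * \<phi> j x)"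
        using c'.divergence_chart[OF Xc XO _ _ X0 D, of "cbox a b"] ab by (simp add: F'_def[symmetric] Xn')
      finally show ?thesis .
    qed
    have "measure (graph_measure e \<gamma>) (F \<inter> box a b) = measure (graph_measure e' \<gamma>') (F' \<inter> box a b)"
      using LIMSEQ_unique[OF lim[of F e \<gamma>] lim[of F' e' \<gamma>', folded eq]] F fin[of UNIV] by simp
    then have "emeasure (graph_measure e \<gamma>) (F \<inter> box a b) = emeasure (graph_measure e' \<gamma>') (F' \<inter> box a b)"
      using fin[of "box a b"] by (simp add: emeasure_eq_ennreal_measure less_top)
    then show ?thesis by (simp add: M N)
  qed simp
  have "emeasure M A = emeasure N A"
  proof (rule measures_eq_on_open[where W="ball p r \<inter> ball p' r'", OF _ _ _ boxes])
    show "sets M = sets borel" "sets N = sets borel" by (simp_all add: M_def N_def)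
    show "emeasure M (box a b) \<noteq> \<infinity>" for a b using fin(1)[of "box a b"] by (simp add: M)
  qed (use A in auto)
  moreover have "F \<inter> A = A" "F' \<inter> A = A" using A(2) by (auto simp: F_def F'_def)
  ultimately show ?thesis
    using A(1) by (simp add: M N emeasure_graph_measure c'.emeasure_graph_measure)
qed

text \<open>Used to glue the chart areas: for disjoint \<open>D i\<close> the sum is the measure
  that agrees with \<open>M i\<close> on each piece.\<close>

lemma exists_sum_of_restrictions:
  fixes M :: "nat \<Rightarrow> 'a::topological_space measure"
  assumes s: "\<And>i. sets (M i) = sets borel" and D: "\<And>i. D i \<in> sets borel"
  shows "\<exists>\<mu>. sets \<mu> = sets borel \<and> (\<forall>A\<in>sets borel. emeasure \<mu> A = (\<Sum>i<n. emeasure (M i) (A \<inter> D i)))"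
proof -
  define f where "f A = (\<Sum>i<n. emeasure (M i) (A \<inter> D i))" for A
  define \<mu> where "\<mu> = measure_of UNIV (sets borel) f"
  have "sets \<mu> = sets borel" unfolding \<mu>_def by (simp add: sets.sigma_sets_eq[of borel, simplified])
  moreover have "emeasure \<mu> A = f A" if "A \<in> sets borel" for A
    unfolding \<mu>_def
  proof (rule emeasure_measure_of_sigma[OF _ _ _ that])
    show "sigma_algebra UNIV (sets (borel::'a measure))" using sets.sigma_algebra_axioms[of borel] by simp
    show "positive (sets borel) f" by (simp add: positive_def f_def)
    show "countably_additive (sets borel) f"
      unfolding countably_additive_def
    proof (intro allI impI)
      fix A :: "nat \<Rightarrow> 'a set" assume A: "range A \<subseteq> sets borel" "disjoint_family A"
      have "(\<Sum>j. f (A j)) = (\<Sum>i<n. \<Sum>j. emeasure (M i) (A j \<inter> D i))"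
        unfolding f_def by (rule suminf_sum) simp
      also have "\<dots> = (\<Sum>i<n. emeasure (M i) (\<Union>j. A j \<inter> D i))"
        using A D s by (intro sum.cong refl suminf_emeasure) (auto simp: disjoint_family_on_def)
      finally show "(\<Sum>j. f (A j)) = f (\<Union> (range A))" by (simp add: f_def)
    qed
  qed
  ultimately show ?thesis by (intro exI[of _ \<mu>]) (simp add: f_def)
qed

section \<open>Existence and uniqueness of the surface measure\<close>

locale smooth_domain =
  fixes \<Omega> :: "'a::euclidean_space set"
  assumes dom: "smooth_bounded_domain \<Omega>"
begin

lemma open_dom: "open \<Omega>" and bounded_dom: "bounded \<Omega>" and dom_ne: "\<Omega> \<noteq> {}"
  using dom by (auto simp: smooth_bounded_domain_def)

lemma chartI: "boundary_graph \<Omega> p r e \<gamma> \<Longrightarrow> chart \<Omega> p r e \<gamma>"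
  using open_dom by (simp add: chart_def)

lemma compact_closure_dom: "compact (closure \<Omega>)"
  using bounded_dom by (simp add: compact_closure)

lemma compact_frontier_dom: "compact (frontier \<Omega>)"
  using bounded_dom by (rule compact_frontier_bounded)

lemma finite_chart_cover:
  "\<exists>(n::nat) P R E G. (\<forall>i<n. boundary_graph \<Omega> (P i) (R i) (E i) (G i)) \<and>
     frontier \<Omega> \<subseteq> (\<Union>i<n. ball (P i) (R i / 2))"
proof -
  have "\<forall>p\<in>frontier \<Omega>. \<exists>r e \<gamma>. boundary_graph \<Omega> p r e \<gamma>"
    using dom by (simp add: smooth_bounded_domain_def)
  then obtain r e \<gamma> where bg: "\<And>p. p \<in> frontier \<Omega> \<Longrightarrow> boundary_graph \<Omega> p (r p) (e p) (\<gamma> p)"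
    by metis
  then have "r p > 0" if "p \<in> frontier \<Omega>" for p using that by (auto simp: boundary_graph_def)
  then have "frontier \<Omega> \<subseteq> (\<Union>p\<in>frontier \<Omega>. ball p (r p / 2))" by (auto intro!: bexI)
  then obtain C where C: "C \<subseteq> frontier \<Omega>" "finite C" "frontier \<Omega> \<subseteq> (\<Union>p\<in>C. ball p (r p / 2))"
    using compactE_image[OF compact_frontier_dom, of "frontier \<Omega>" "\<lambda>p. ball p (r p / 2)"] by auto
  \<comment> \<open>Indexing the centres by natural numbers orders the charts, so that the cover can
    be made disjoint by keeping the first chart at each point.\<close>
  obtain P where P: "C = P ` {i::nat. i < card C}" using C(2) by (metis finite_imp_nat_seg_image_inj_on card_image card_Collect_less_nat)
  have "boundary_graph \<Omega> (P i) (r (P i)) (e (P i)) (\<gamma> (P i))" if "i < card C" for i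
  proof (rule bg)
    have "P i \<in> P ` {i. i < card C}" using that by simp
    then show "P i \<in> frontier \<Omega>" using C(1) P by (metis subsetD)
  qed
  moreover have "frontier \<Omega> \<subseteq> (\<Union>i<card C. ball (P i) (r (P i) / 2))"
  proof
    fix x assume "x \<in> frontier \<Omega>"
    then obtain p where "p \<in> C" "x \<in> ball p (r p / 2)" using C(3) by blast
    moreover from this(1) have "p \<in> P ` {i. i < card C}" using P by (rule subst[rotated])
    then obtain i where "i < card C" "p = P i" by blast
    ultimately show "x \<in> (\<Union>i<card C. ball (P i) (r (P i) / 2))" by auto
  qed
  ultimately show ?thesis
    by (intro exI[of _ "card C"] exI[of _ P]) (rule exI[of _ "\<lambda>i. r (P i)"],
        rule exI[of _ "\<lambda>i. e (P i)"], rule exI[of _ "\<lambda>i. \<gamma> (P i)"], blast)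
qed

text \<open>Replaces the condition over all charts by one explicit formula in a finite atlas, from
  which existence and uniqueness can both be read off. One direction is additivity over the pieces
  \<open>D i\<close>; the other needs the consistency of chart areas.\<close>

lemma is_surface_measure_cover:
  assumes bgs: "\<forall>i<n::nat. boundary_graph \<Omega> (P i) (R i) (E i) (G i)"
    and cov: "frontier \<Omega> \<subseteq> (\<Union>i<n. ball (P i) (R i))"
  defines "D \<equiv> \<lambda>i. frontier \<Omega> \<inter> (ball (P i) (R i) - (\<Union>j<i. ball (P j) (R j)))"
  shows "is_surface_measure \<Omega> \<sigma> \<longleftrightarrow> sets \<sigma> = sets (restrict_space borel (frontier \<Omega>)) \<and>
    (\<forall>A\<in>sets borel. A \<subseteq> frontier \<Omega> \<longrightarrow> emeasure \<sigma> A = (\<Sum>i<n. graph_area (E i) (G i) (A \<inter> D i)))"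
proof -
  have DB: "D i \<in> sets borel" for i
    unfolding D_def using frontier_closed[of \<Omega>] by (intro sets.Int sets.Diff sets.finite_UN) auto
  have DU: "(\<Union>i<n. D i) = frontier \<Omega>"
  proof (intro equalityI subsetI)
    fix x assume x: "x \<in> frontier \<Omega>"
    then obtain i0 where i0: "i0 < n" "x \<in> ball (P i0) (R i0)" using cov by blast
    \<comment> \<open>The piece containing \<open>x\<close> is that of the first chart whose ball
      contains it.\<close>
    define i where "i = (LEAST i. x \<in> ball (P i) (R i))"
    have "x \<in> ball (P i) (R i)" unfolding i_def using i0(2) by (rule LeastI)
    moreover have "i \<le> i0" unfolding i_def using i0(2) by (rule Least_le)
    moreover have "x \<notin> ball (P j) (R j)" if "j < i" for j using not_less_Least that unfolding i_def by blast
    ultimately show "x \<in> (\<Union>i<n. D i)" using x i0(1) by (auto simp: D_def)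
  qed (auto simp: D_def)
  have disj: "D i \<inter> D j = {}" if "i < j" for i j using that by (auto simp: D_def)
  then have disj: "disjoint_family_on (\<lambda>i. A \<inter> D i) {..<n}" for A
    unfolding disjoint_family_on_def by (metis Int_assoc Int_commute Int_empty_right neq_iff)
  show ?thesis
  proof (intro iffI conjI)
    assume \<sigma>: "is_surface_measure \<Omega> \<sigma>"
    then show s: "sets \<sigma> = sets (restrict_space borel (frontier \<Omega>))" by (simp add: is_surface_measure_def)
    show "\<forall>A\<in>sets borel. A \<subseteq> frontier \<Omega> \<longrightarrow> emeasure \<sigma> A = (\<Sum>i<n. graph_area (E i) (G i) (A \<inter> D i))"
    proof (intro ballI impI)
      fix A assume A: "A \<in> sets borel" "A \<subseteq> frontier \<Omega>"
      have sA: "A \<inter> D i \<in> sets \<sigma>" for i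
        unfolding s using A DB by (auto simp: sets_restrict_space_iff)
      have "emeasure \<sigma> A = emeasure \<sigma> (\<Union>i<n. A \<inter> D i)" using DU A(2) by (metis Int_UN_distrib Int_absorb2)
      also have "\<dots> = (\<Sum>i<n. emeasure \<sigma> (A \<inter> D i))"
        using sA disj by (intro sum_emeasure[symmetric]) auto
      also have "\<dots> = (\<Sum>i<n. graph_area (E i) (G i) (A \<inter> D i))"
      proof (rule sum.cong[OF refl])
        fix i assume "i \<in> {..<n}"
        then have "boundary_graph \<Omega> (P i) (R i) (E i) (G i)" using bgs by simp
        moreover have "A \<inter> D i \<in> sets borel" "A \<inter> D i \<subseteq> frontier \<Omega> \<inter> ball (P i) (R i)"
          using A DB by (auto simp: D_def)
        ultimately show "emeasure \<sigma> (A \<inter> D i) = graph_area (E i) (G i) (A \<inter> D i)"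
          using \<sigma> unfolding is_surface_measure_def by blast
      qed
      finally show "emeasure \<sigma> A = (\<Sum>i<n. graph_area (E i) (G i) (A \<inter> D i))" .
    qed
  next
    assume \<sigma>: "sets \<sigma> = sets (restrict_space borel (frontier \<Omega>)) \<and>
      (\<forall>A\<in>sets borel. A \<subseteq> frontier \<Omega> \<longrightarrow> emeasure \<sigma> A = (\<Sum>i<n. graph_area (E i) (G i) (A \<inter> D i)))"
    show "is_surface_measure \<Omega> \<sigma>"
      unfolding is_surface_measure_def
    proof (intro conjI allI impI)
      fix p r e \<gamma> A assume b: "boundary_graph \<Omega> p r e \<gamma>" and A: "A \<in> sets borel" "A \<subseteq> frontier \<Omega> \<inter> ball p r"
      interpret chart \<Omega> p r e \<gamma> by (rule chartI[OF b])
      have "emeasure \<sigma> A = (\<Sum>i<n. graph_area (E i) (G i) (A \<inter> D i))" using \<sigma> A by auto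
      \<comment> \<open>Each set \<open>A \<inter> D i\<close> lies in the ball of the given chart
        and in that of the i-th chart, where the two areas agree.\<close>
      also have "\<dots> = (\<Sum>i<n. emeasure (graph_measure e \<gamma>) (A \<inter> D i))"
      proof (rule sum.cong[OF refl])
        fix i assume "i \<in> {..<n}"
        then have "chart \<Omega> (P i) (R i) (E i) (G i)" using bgs chartI by auto
        moreover have AD: "A \<inter> D i \<in> sets borel" using A DB by auto
        ultimately have "graph_area (E i) (G i) (A \<inter> D i) = graph_area e \<gamma> (A \<inter> D i)"
          using A by (intro graph_area_consistent[OF _ chartI[OF b] bounded_dom]) (auto simp: D_def)
        then show "graph_area (E i) (G i) (A \<inter> D i) = emeasure (graph_measure e \<gamma>) (A \<inter> D i)"
          using AD by (simp add: emeasure_graph_measure)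
      qed
      also have "\<dots> = emeasure (graph_measure e \<gamma>) (\<Union>i<n. A \<inter> D i)"
        using A DB disj by (intro sum_emeasure) auto
      also have "(\<Union>i<n. A \<inter> D i) = A" using DU A(2) by (metis Int_UN_distrib Int_absorb2 le_inf_iff)
      finally show "emeasure \<sigma> A = graph_area e \<gamma> A" using A by (simp add: emeasure_graph_measure)
    qed (use \<sigma> in blast)
  qed
qed

abbreviation "\<sigma> \<equiv> surface_measure \<Omega>"

text \<open>The atlas formula fixes the value on every measurable set, which gives uniqueness, and
  the glued chart areas satisfy it, which gives existence. So the description in
  \<open>surface_measure\<close> is meaningful. Finiteness follows because each of the finitely many
  bounded pieces has finite area.\<close>

lemma is_surface_measure: "is_surface_measure \<Omega> \<sigma>"
  and finite_surface_measure: "finite_measure \<sigma>"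
proof -
  obtain n :: nat and P R E G where bg: "\<And>i. i < n \<Longrightarrow> boundary_graph \<Omega> (P i) (R i) (E i) (G i)"
    and cov: "frontier \<Omega> \<subseteq> (\<Union>i<n. ball (P i) (R i / 2))"
    using finite_chart_cover by blast
  have sub: "ball (P i) (R i / 2) \<subseteq> ball (P i) (R i)" if "i \<in> {..<n}" for i
    using bg[of i] that by (intro subset_ball) (simp add: boundary_graph_def)
  have cov: "frontier \<Omega> \<subseteq> (\<Union>i<n. ball (P i) (R i))"
    by (rule order_trans[OF cov UN_mono[OF order_refl sub]])
  define D where "D i = frontier \<Omega> \<inter> (ball (P i) (R i) - (\<Union>j<i. ball (P j) (R j)))" for i
  have DB: "D i \<in> sets borel" for i
    unfolding D_def using frontier_closed[of \<Omega>] by (intro sets.Int sets.Diff sets.finite_UN) auto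
  have "\<forall>i<n. boundary_graph \<Omega> (P i) (R i) (E i) (G i)" using bg by simp
  note iff = is_surface_measure_cover[OF this cov, folded D_def]
  have em: "graph_area (E i) (G i) A = emeasure (graph_measure (E i) (G i)) A" if "i < n" "A \<in> sets borel" for i A
  proof -
    interpret chart \<Omega> "P i" "R i" "E i" "G i" by (rule chartI[OF bg[OF that(1)]])
    show ?thesis using that by (simp add: emeasure_graph_measure)
  qed
  obtain \<mu> where \<mu>: "sets \<mu> = sets borel"
    "\<And>A. A \<in> sets borel \<Longrightarrow> emeasure \<mu> A = (\<Sum>i<n. emeasure (graph_measure (E i) (G i)) (A \<inter> D i))"
    using exists_sum_of_restrictions[of "\<lambda>i. graph_measure (E i) (G i)" D n] DB by auto
  have Fb: "frontier \<Omega> \<in> sets borel" by (simp add: borel_closed frontier_closed)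
  have ex: "is_surface_measure \<Omega> (restrict_space \<mu> (frontier \<Omega>))"
    unfolding iff
  proof (intro conjI ballI impI)
    show "sets (restrict_space \<mu> (frontier \<Omega>)) = sets (restrict_space borel (frontier \<Omega>))"
      by (rule sets_restrict_space_cong[OF \<mu>(1)])
    fix A assume A: "A \<in> sets borel" "A \<subseteq> frontier \<Omega>"
    then have "emeasure (restrict_space \<mu> (frontier \<Omega>)) A = emeasure \<mu> A"
      using Fb \<mu>(1) sets_eq_imp_space_eq[OF \<mu>(1)] by (intro emeasure_restrict_space) auto
    also have "\<dots> = (\<Sum>i<n. graph_area (E i) (G i) (A \<inter> D i))"
      using A DB by (simp add: \<mu>(2) em)
    finally show "emeasure (restrict_space \<mu> (frontier \<Omega>)) A = (\<Sum>i<n. graph_area (E i) (G i) (A \<inter> D i))" .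
  qed
  have un: "\<tau> = \<tau>'" if \<tau>: "is_surface_measure \<Omega> \<tau>" "is_surface_measure \<Omega> \<tau>'" for \<tau> \<tau>'
  proof (rule measure_eqI)
    show "sets \<tau> = sets \<tau>'" using \<tau> by (simp add: is_surface_measure_def)
    fix A assume "A \<in> sets \<tau>"
    then have "A \<in> sets (restrict_space borel (frontier \<Omega>))" using \<tau>(1) by (simp add: is_surface_measure_def)
    then have "A \<in> sets borel" "A \<subseteq> frontier \<Omega>" using Fb by (auto simp: sets_restrict_space_iff)
    then show "emeasure \<tau> A = emeasure \<tau>' A" using \<tau> unfolding iff by simp
  qed
  show i: "is_surface_measure \<Omega> \<sigma>"
    unfolding surface_measure_def by (rule theI[of "is_surface_measure \<Omega>", OF ex un[OF _ ex]])
  have sp: "space \<sigma> = frontier \<Omega>"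
    using i sets_eq_imp_space_eq[of \<sigma> "restrict_space borel (frontier \<Omega>)"]
    by (simp add: is_surface_measure_def space_restrict_space)
  have "emeasure \<sigma> (frontier \<Omega>) = (\<Sum>i<n. graph_area (E i) (G i) (frontier \<Omega> \<inter> D i))"
    using i Fb unfolding iff by auto
  also have "\<dots> < \<infinity>"
  proof -
    have "graph_area (E i) (G i) (frontier \<Omega> \<inter> D i) < \<infinity>" if "i < n" for i
    proof -
      interpret chart \<Omega> "P i" "R i" "E i" "G i" by (rule chartI[OF bg[OF that(1)]])
      have "bounded (frontier \<Omega> \<inter> D i)" using compact_imp_bounded[OF compact_frontier_dom] by (rule bounded_Int[OF disjI1])
      then show ?thesis using emeasure_graph_measure_bounded[of "frontier \<Omega> \<inter> D i"] Fb DB em[OF that] by auto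
    qed
    then show ?thesis by (simp add: less_top)
  qed
  finally show "finite_measure \<sigma>" by (intro finite_measureI) (simp add: sp less_top)
qed

lemma sets_surface_measure: "sets \<sigma> = sets (restrict_space borel (frontier \<Omega>))"
  using is_surface_measure by (simp add: is_surface_measure_def)

lemma space_surface_measure: "space \<sigma> = frontier \<Omega>"
  using sets_eq_imp_space_eq[OF sets_surface_measure] by (simp add: space_restrict_space)

lemma frontier_borel: "frontier \<Omega> \<in> sets borel"
  by (simp add: borel_closed frontier_closed)

lemma borel_measurable_surface:
  fixes f :: "'a \<Rightarrow> 'b::topological_space"
  assumes "continuous_on (frontier \<Omega>) f"
  shows "f \<in> borel_measurable \<sigma>"
  using borel_measurable_continuous_on_restrict[OF assms]
  by (simp add: measurable_cong_sets[OF sets_surface_measure refl])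

lemma integrable_surface_continuous:
  fixes f :: "'a \<Rightarrow> real"
  assumes "continuous_on (frontier \<Omega>) f"
  shows "integrable \<sigma> f"
proof -
  interpret finite_measure \<sigma> by (rule finite_surface_measure)
  have "bounded (f ` frontier \<Omega>)"
    by (intro compact_imp_bounded compact_continuous_image assms compact_frontier_dom)
  then obtain B where "\<forall>x\<in>frontier \<Omega>. \<bar>f x\<bar> \<le> B" by (auto simp: bounded_iff)
  then show ?thesis
    by (intro integrable_const_bound[of _ B] borel_measurable_surface assms AE_I2) (auto simp: space_surface_measure)
qed

text \<open>The two measures have the same restriction to the boundary piece in the ball; this
  carries the chart version of the divergence theorem over to \<sigma>.\<close>

lemma integral_surface_chart:
  fixes g :: "'a \<Rightarrow> real"
  assumes bg: "boundary_graph \<Omega> p r e \<gamma>"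
  shows "(LINT x|\<sigma>. indicator (ball p r) x * g x) =
    (LINT x|graph_measure e \<gamma>. indicator (frontier \<Omega> \<inter> ball p r) x * g x)"
proof -
  interpret chart \<Omega> p r e \<gamma> by (rule chartI[OF bg])
  define S where "S = frontier \<Omega> \<inter> ball p r"
  have S: "S \<in> sets borel" unfolding S_def using frontier_borel by auto
  have SS: "S \<in> sets \<sigma>"
    unfolding sets_surface_measure using S frontier_borel by (auto simp: sets_restrict_space_iff S_def)
  have eq: "restrict_space \<sigma> S = restrict_space (graph_measure e \<gamma>) S"
  proof (rule measure_eqI)
    have "sets (restrict_space \<sigma> S) = sets (restrict_space (restrict_space borel (frontier \<Omega>)) S)"
      by (rule sets_restrict_space_cong[OF sets_surface_measure])
    also have "\<dots> = sets (restrict_space borel S)"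
      by (subst sets_restrict_restrict_space) (simp add: S_def Int_absorb1)
    also have "\<dots> = sets (restrict_space (graph_measure e \<gamma>) S)"
      by (rule sets_restrict_space_cong) simp
    finally show s: "sets (restrict_space \<sigma> S) = sets (restrict_space (graph_measure e \<gamma>) S)" .
    fix A assume "A \<in> sets (restrict_space \<sigma> S)"
    then have A: "A \<in> sets borel" "A \<subseteq> S" using S unfolding s by (auto simp: sets_restrict_space_iff)
    have "emeasure (restrict_space \<sigma> S) A = emeasure \<sigma> A"
      using SS A by (intro emeasure_restrict_space) auto
    also have "\<dots> = graph_area e \<gamma> A"
      using is_surface_measure bg A unfolding is_surface_measure_def S_def by blast
    also have "\<dots> = emeasure (restrict_space (graph_measure e \<gamma>) S) A"
      using S A by (subst emeasure_restrict_space) (auto simp: emeasure_graph_measure)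
    finally show "emeasure (restrict_space \<sigma> S) A = emeasure (restrict_space (graph_measure e \<gamma>) S) A" .
  qed
  have "(LINT x|\<sigma>. indicator (ball p r) x * g x) = (LINT x|\<sigma>. indicator S x *\<^sub>R g x)"
    by (intro Bochner_Integration.integral_cong) (auto simp: S_def space_surface_measure indicator_def)
  also have "\<dots> = (LINT x|restrict_space \<sigma> S. g x)"
    using SS by (intro integral_restrict_space[symmetric]) auto
  also have "\<dots> = (LINT x|graph_measure e \<gamma>. indicator S x *\<^sub>R g x)"
    unfolding eq using S by (intro integral_restrict_space) auto
  finally show ?thesis by (simp add: S_def)
qed

lemma continuous_outward_normal: "continuous_on (frontier \<Omega>) (outward_normal \<Omega>)"
  unfolding continuous_on_eq_continuous_within
proof
  fix x assume x: "x \<in> frontier \<Omega>"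
  then obtain r e \<gamma> where bg: "boundary_graph \<Omega> x r e \<gamma>" using dom unfolding smooth_bounded_domain_def by meson
  interpret chart \<Omega> x r e \<gamma> by (rule chartI[OF bg])
  have N: "outward_normal \<Omega> y = normal y" if "y \<in> frontier \<Omega>" "dist y x < r" for y
    using that outward_normal_eq[of y] frontier_ball[of y] by (auto simp: dist_commute)
  have "continuous (at x within frontier \<Omega>) normal"
    using cont_normal[of "frontier \<Omega>"] x by (simp add: continuous_on_eq_continuous_within)
  then show "continuous (at x within frontier \<Omega>) (outward_normal \<Omega>)"
    by (rule continuous_transform_within[OF _ r_pos x]) (simp add: N)
qed

end

section \<open>The divergence theorem\<close>

lemma integral_grad_compact_support:
  assumes f: "Ck_on 1 UNIV f" and K: "compact K" "\<And>x. x \<notin> K \<Longrightarrow> f x = 0"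
  shows "integrable lborel (\<lambda>x. grad f x \<bullet> b)" "(LINT x|lborel. grad f x \<bullet> b) = 0"
proof -
  have gc: "continuous_on UNIV (grad f)" using f unfolding Ck_on_1_iff by simp
  have fc: "continuous_on UNIV f" by (rule Ck_on_imp_continuous_on[OF f])
  have g0: "grad f x = 0" if "x \<notin> K" for x by (rule grad_eq_0_outside[OF K that])
  have "bounded ((\<lambda>x. grad f x \<bullet> b) ` K)" "bounded (f ` K)"
    using gc fc by (intro compact_imp_bounded compact_continuous_image K(1) continuous_intros;
        blast intro: continuous_on_subset)+
  then obtain M L where "\<And>x. x \<in> K \<Longrightarrow> \<bar>grad f x \<bullet> b\<bar> \<le> M" "M > 0" "\<And>x. x \<in> K \<Longrightarrow> \<bar>f x\<bar> \<le> L" "L > 0"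
    unfolding bounded_pos by auto
  then have M: "\<bar>grad f x \<bullet> b\<bar> \<le> M" and L: "\<bar>f x\<bar> \<le> L" for x
    using g0 K(2) by (cases "x \<in> K"; simp)+
  obtain R where R: "\<And>x. x \<in> K \<Longrightarrow> norm x \<le> R"
    using compact_imp_bounded[OF K(1)] unfolding bounded_iff by blast
  have out: "x \<notin> K" if "norm x > R" for x using R[of x] that by auto
  have "(\<lambda>x. grad f x \<bullet> b) \<in> borel_measurable borel"
    by (intro borel_measurable_continuous_onI continuous_intros gc)
  then show "integrable lborel (\<lambda>x. grad f x \<bullet> b)"
    by (rule integrable_bounded_support[OF _ M, where R=R]) (use g0 out in auto)
  show "(LINT x|lborel. grad f x \<bullet> b) = 0"
  proof (rule integral_directional_derivative_eq_0[OF _ _ M L])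
    show "((\<lambda>t. f (x + t *\<^sub>R b)) has_real_derivative grad f x \<bullet> b) (at 0)" for x
      using has_real_derivative_along_line[of f x 0 b] f by simp
    show "f \<in> borel_measurable borel" using fc by (rule borel_measurable_continuous_onI)
    show "f x = 0" if "norm x > R" for x using out[OF that] by (rule K(2))
  qed
qed

lemma grad_sum:
  assumes "\<And>i. i \<in> I \<Longrightarrow> f i differentiable (at x)"
  shows "grad (\<lambda>x. \<Sum>i\<in>I. f i x) x = (\<Sum>i\<in>I. grad (f i) x)"
proof (rule has_derivative_imp_grad)
  have "((\<lambda>x. \<Sum>i\<in>I. f i x) has_derivative (\<lambda>h. \<Sum>i\<in>I. grad (f i) x \<bullet> h)) (at x)"
    by (intro has_derivative_sum has_derivative_grad assms)
  then show "((\<lambda>x. \<Sum>i\<in>I. f i x) has_derivative (\<lambda>h. (\<Sum>i\<in>I. grad (f i) x) \<bullet> h)) (at x)"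
    by (simp add: inner_sum_left)
qed

lemma divergence_sum:
  assumes "\<And>i. i \<in> I \<Longrightarrow> C1_field S (X i)" "x \<in> S"
  shows "divergence (\<lambda>x. \<Sum>i\<in>I. X i x) x = (\<Sum>i\<in>I. divergence (X i) x)"
proof -
  have "grad (\<lambda>y. (\<Sum>i\<in>I. X i y) \<bullet> b) x \<bullet> b = (\<Sum>i\<in>I. grad (\<lambda>y. X i y \<bullet> b) x \<bullet> b)" if b: "b \<in> Basis" for b
    unfolding inner_sum_left
    using Ck_on_1_differentiable[OF C1_fieldD[OF assms(1) b] assms(2)]
    by (subst grad_sum) (auto simp: inner_sum_left)
  then show ?thesis by (simp add: divergence_def sum.swap[of _ Basis])
qed

lemma C1_field_scale:
  assumes "open S" "Ck_on 1 S f" "C1_field S X"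
  shows "C1_field S (\<lambda>x. f x *\<^sub>R X x)"
  using assms Ck_on_mult unfolding C1_field_def inner_scaleR_left by blast

lemma divergence_scale:
  assumes "Ck_on 1 S f" "C1_field S X" "x \<in> S"
  shows "divergence (\<lambda>x. f x *\<^sub>R X x) x = f x * divergence X x + grad f x \<bullet> X x"
proof -
  have "grad (\<lambda>y. (f y *\<^sub>R X y) \<bullet> b) x \<bullet> b = f x * (grad (\<lambda>y. X y \<bullet> b) x \<bullet> b) + (grad f x \<bullet> b) * (X x \<bullet> b)"
    if b: "b \<in> Basis" for b
    unfolding inner_scaleR_left
    using Ck_on_1_differentiable[OF assms(1,3)] Ck_on_1_differentiable[OF C1_fieldD[OF assms(2) b] assms(3)]
    by (subst grad_mult) (auto simp: inner_add_left)
  then show ?thesis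
    using euclidean_inner[of "grad f x" "X x"]
    by (simp add: divergence_def sum.distrib sum_distrib_left)
qed

lemma Ck_on_UNIV_subset: "Ck_on k UNIV f \<Longrightarrow> Ck_on k S f"
  by (rule Ck_on_subset[OF _ subset_UNIV])

context smooth_domain
begin

lemma bounded_on_closure:
  fixes f :: "'a \<Rightarrow> 'b::real_normed_vector"
  assumes "continuous_on (closure \<Omega>) f"
  shows "\<exists>B>0. \<forall>x\<in>closure \<Omega>. norm (f x) \<le> B"
  using compact_imp_bounded[OF compact_continuous_image[OF assms compact_closure_dom]]
  unfolding bounded_pos by auto

lemma frontier_subset_closure: "frontier \<Omega> \<subseteq> closure \<Omega>"
  by (auto simp: frontier_def)

lemma frontier_disjoint: "x \<in> frontier \<Omega> \<Longrightarrow> x \<notin> \<Omega>"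
  using open_dom by (simp add: frontier_def interior_open)

lemma integrable_dom:
  fixes f :: "'a \<Rightarrow> real"
  assumes "continuous_on \<Omega> f" "\<And>x. x \<in> \<Omega> \<Longrightarrow> \<bar>f x\<bar> \<le> M"
  shows "integrable lborel (\<lambda>x. indicator \<Omega> x * f x)"
proof -
  obtain R where R: "\<And>x. x \<in> \<Omega> \<Longrightarrow> norm x \<le> R" using bounded_dom by (auto simp: bounded_iff)
  have "(\<lambda>x. indicator \<Omega> x * f x) \<in> borel_measurable borel"
    using borel_measurable_continuous_on_indicator[OF _ assms(1)] open_dom by auto
  then show ?thesis
    by (rule integrable_bounded_support[where L="\<bar>M\<bar>" and R=R])
      (use assms(2) R in \<open>fastforce simp: indicator_def\<close>)+
qed

lemma continuous_surface_flux:
  assumes "continuous_on (closure \<Omega>) X"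
  shows "continuous_on (frontier \<Omega>) (\<lambda>x. X x \<bullet> outward_normal \<Omega> x)"
  by (intro continuous_on_inner continuous_outward_normal continuous_on_subset[OF assms] frontier_subset_closure)

definition flux_identity :: "('a \<Rightarrow> 'a) \<Rightarrow> bool" where
  "flux_identity X \<longleftrightarrow>
     (LINT x|lborel. indicator \<Omega> x * divergence X x) = (LINT x|\<sigma>. X x \<bullet> outward_normal \<Omega> x)"

text \<open>A class that is stable under multiplication by C1 cutoffs with bounded gradient: the
  divergence of \<open>\<eta> X\<close> is \<open>\<eta>\<close> times that of \<open>X\<close> plus
  \<open>grad \<eta> \<bullet> X\<close>, and all of these factors are bounded.\<close>

definition admissible :: "('a \<Rightarrow> 'a) \<Rightarrow> bool" where
  "admissible X \<longleftrightarrow> continuous_on (closure \<Omega>) X \<and> C1_field \<Omega> X \<and> (\<exists>M. \<forall>x\<in>\<Omega>. \<bar>divergence X x\<bar> \<le> M)"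

text \<open>Vanishing outside the open ball of half radius leaves the closed ball of half radius as
  the compact support inside the chart that \<open>divergence_chart\<close> requires.\<close>

lemma flux_identity_boundary:
  assumes bg: "boundary_graph \<Omega> p r e \<gamma>" and X: "admissible X"
    and K: "\<And>x. x \<in> closure \<Omega> \<Longrightarrow> x \<notin> ball p (r / 2) \<Longrightarrow> X x = 0"
  shows "flux_identity X"
proof -
  interpret chart \<Omega> p r e \<gamma> by (rule chartI[OF bg])
  obtain M where M: "\<And>x. x \<in> \<Omega> \<Longrightarrow> \<bar>divergence X x\<bar> \<le> M" using X by (auto simp: admissible_def)
  have sub: "cball p (r / 2) \<subseteq> ball p r" using r_pos by (auto simp: subset_iff)
  have K': "X x = 0" if "x \<in> closure \<Omega>" "x \<notin> cball p (r / 2)" for x using that by (intro K) auto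
  have "(LINT x|lborel. indicator \<Omega> x * divergence X x) =
      (LINT x|\<sigma>. indicator (ball p r) x * (X x \<bullet> outward_normal \<Omega> x))"
    using divergence_chart[OF _ _ compact_cball sub K' M] X
    by (simp add: admissible_def integral_surface_chart[OF bg])
  also have "\<dots> = (LINT x|\<sigma>. X x \<bullet> outward_normal \<Omega> x)"
  proof (rule Bochner_Integration.integral_cong[OF refl])
    fix x assume "x \<in> space \<sigma>"
    then have "x \<in> closure \<Omega>" using frontier_subset_closure by (auto simp: space_surface_measure)
    then show "indicator (ball p r) x * (X x \<bullet> outward_normal \<Omega> x) = X x \<bullet> outward_normal \<Omega> x"
    proof (cases "x \<in> ball p r")
      case False
      then have "x \<notin> cball p (r / 2)" using sub by blast
      then show ?thesis using K'[OF \<open>x \<in> closure \<Omega>\<close>] by simp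
    qed simp
  qed
  finally show ?thesis by (simp add: flux_identity_def)
qed

text \<open>Extended by zero, each component is C1 with compact support on the whole space, so its
  derivatives integrate to zero; the boundary term vanishes as well.\<close>

lemma flux_identity_interior:
  assumes r: "cball p r \<subseteq> \<Omega>" and X: "admissible X"
    and K: "\<And>x. x \<in> closure \<Omega> \<Longrightarrow> x \<notin> ball p (r / 2) \<Longrightarrow> X x = 0" and rp: "r > 0"
  shows "flux_identity X"
proof -
  define C where "C = cball p (r / 2)"
  have C: "compact C" "C \<subseteq> \<Omega>" using r rp by (auto simp: C_def subset_iff)
  have K': "X x = 0" if "x \<in> closure \<Omega>" "x \<notin> C" for x using that by (intro K) (auto simp: C_def)
  define Z where "Z x = (if x \<in> \<Omega> then X x else 0)" for x
  have Z0: "Z x = 0" if "x \<notin> C" for x using K' closure_subset that by (auto simp: Z_def)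
  have ZX: "Z x = X x" if "x \<in> \<Omega>" for x using that by (simp add: Z_def)
  have oC: "open (- C)" using C(1) compact_imp_closed by blast
  have Zb: "Ck_on 1 UNIV (\<lambda>x. Z x \<bullet> b)" if b: "b \<in> Basis" for b
  proof -
    have "Ck_on 1 \<Omega> (\<lambda>x. X x \<bullet> b)" using X C1_fieldD b by (auto simp: admissible_def simp del: Ck_on.simps)
    then have "Ck_on 1 \<Omega> (\<lambda>x. Z x \<bullet> b)"
      using Ck_on_cong[OF open_dom, of "\<lambda>x. Z x \<bullet> b" "\<lambda>x. X x \<bullet> b"] ZX by (simp del: Ck_on.simps)
    moreover have "Ck_on 1 (- C) (\<lambda>x. Z x \<bullet> b)"
      using Ck_on_cong[OF oC, of "\<lambda>x. Z x \<bullet> b" "\<lambda>x. 0" 1] Z0 Ck_on_const[of 1 "- C" 0] by (simp del: Ck_on.simps)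
    moreover have U: "UNIV = \<Omega> \<union> - C" using C(2) by auto
    ultimately show ?thesis
      unfolding Ck_on_1_iff using continuous_on_open_Un[OF open_dom oC, of "grad (\<lambda>x. Z x \<bullet> b)"]
      by (metis UnE)
  qed
  have g: "integrable lborel (\<lambda>x. grad (\<lambda>y. Z y \<bullet> b) x \<bullet> b)" "(LINT x|lborel. grad (\<lambda>y. Z y \<bullet> b) x \<bullet> b) = 0"
    if "b \<in> Basis" for b
    using integral_grad_compact_support[OF Zb[OF that] C(1)] Z0 by auto
  have dZ: "divergence Z x = 0" if "x \<notin> C" for x
    using divergence_cong[OF oC, of Z "\<lambda>_. 0" x] Z0 that by auto
  have "indicator \<Omega> x * divergence X x = divergence Z x" for x
    using divergence_cong[OF open_dom, of X Z x] ZX dZ[of x] C(2) by (auto simp: indicator_def)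
  then have "(LINT x|lborel. indicator \<Omega> x * divergence X x) = (LINT x|lborel. divergence Z x)" by simp
  also have "\<dots> = (\<Sum>b\<in>Basis. (LINT x|lborel. grad (\<lambda>y. Z y \<bullet> b) x \<bullet> b))"
    unfolding divergence_def by (rule Bochner_Integration.integral_sum[OF g(1)])
  also have "\<dots> = 0" using g(2) by simp
  also have "0 = (LINT x|\<sigma>. X x \<bullet> outward_normal \<Omega> x)"
  proof -
    have "X x = 0" if "x \<in> frontier \<Omega>" for x
      using K' C(2) frontier_disjoint[OF that] frontier_subset_closure that by blast
    then have "(LINT x|\<sigma>. X x \<bullet> outward_normal \<Omega> x) = (LINT x|\<sigma>. 0)"
      by (intro Bochner_Integration.integral_cong) (auto simp: space_surface_measure)
    then show ?thesis by simp
  qed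
  finally show ?thesis by (simp add: flux_identity_def)
qed

text \<open>Puts interior and boundary points on the same footing: each point contributes only a
  radius below which supported fields satisfy the flux identity.\<close>

lemma finite_local_flux_cover:
  "\<exists>C R. finite C \<and> C \<subseteq> closure \<Omega> \<and> (\<forall>p\<in>C. 0 < R p) \<and> closure \<Omega> \<subseteq> (\<Union>p\<in>C. ball p (R p / 2)) \<and>
    (\<forall>p\<in>C. \<forall>X. admissible X \<longrightarrow> (\<forall>x\<in>closure \<Omega>. x \<notin> ball p (R p / 2) \<longrightarrow> X x = 0) \<longrightarrow> flux_identity X)"
proof -
  have "\<exists>r>0. \<forall>X. admissible X \<longrightarrow> (\<forall>x\<in>closure \<Omega>. x \<notin> ball p (r / 2) \<longrightarrow> X x = 0) \<longrightarrow> flux_identity X"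
    if p: "p \<in> closure \<Omega>" for p
  proof (cases "p \<in> \<Omega>")
    case True
    then obtain r where "r > 0" "cball p r \<subseteq> \<Omega>" using open_dom open_contains_cball by blast
    then show ?thesis using flux_identity_interior[of p r] by blast
  next
    case False
    then have "p \<in> frontier \<Omega>" using p open_dom by (simp add: frontier_def interior_open)
    then obtain r e \<gamma> where bg: "boundary_graph \<Omega> p r e \<gamma>" using dom unfolding smooth_bounded_domain_def by meson
    then have "r > 0" by (simp add: boundary_graph_def)
    with flux_identity_boundary[OF bg] show ?thesis by blast
  qed
  then obtain R where R: "\<And>p. p \<in> closure \<Omega> \<Longrightarrow> 0 < R p \<and> (\<forall>X. admissible X \<longrightarrow>
      (\<forall>x\<in>closure \<Omega>. x \<notin> ball p (R p / 2) \<longrightarrow> X x = 0) \<longrightarrow> flux_identity X)" by metis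
  then have "closure \<Omega> \<subseteq> (\<Union>p\<in>closure \<Omega>. ball p (R p / 2))" by (auto intro!: bexI)
  then obtain C where C: "C \<subseteq> closure \<Omega>" "finite C" "closure \<Omega> \<subseteq> (\<Union>p\<in>C. ball p (R p / 2))"
    using compactE_image[OF compact_closure_dom, of "closure \<Omega>" "\<lambda>p. ball p (R p / 2)"] by auto
  then have R': "0 < R p" "admissible X \<Longrightarrow> (\<forall>x\<in>closure \<Omega>. x \<notin> ball p (R p / 2) \<longrightarrow> X x = 0) \<Longrightarrow> flux_identity X"
    if "p \<in> C" for p X using R[of p] that by blast+
  show ?thesis
    by (intro exI[of _ C] exI[of _ R] conjI ballI allI impI) (fact C | rule R'; assumption)+
qed

text \<open>Both sides are linear in the field, so a partition of unity reduces the claim to fields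
  supported in one ball of the cover.\<close>

theorem divergence_theorem:
  assumes X: "continuous_on (closure \<Omega>) X" "C1_field \<Omega> X" and M: "\<And>x. x \<in> \<Omega> \<Longrightarrow> \<bar>divergence X x\<bar> \<le> M"
  shows "(LINT x|lborel. indicator \<Omega> x * divergence X x) = (LINT x|\<sigma>. X x \<bullet> outward_normal \<Omega> x)"
proof -
  obtain C R where C: "finite C" "C \<subseteq> closure \<Omega>" and R: "\<forall>p\<in>C. 0 < R p"
    and cov: "closure \<Omega> \<subseteq> (\<Union>p\<in>C. ball p (R p / 2))"
    and loc: "\<forall>p\<in>C. \<forall>X. admissible X \<longrightarrow>
        (\<forall>x\<in>closure \<Omega>. x \<notin> ball p (R p / 2) \<longrightarrow> X x = 0) \<longrightarrow> flux_identity X"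
    using finite_local_flux_cover by (elim exE conjE) (rule that)
  have C3: "0 < R p" if "p \<in> C" for p using R that by simp
  define \<beta> where "\<beta> p = ball_bump p (R p / 2)" for p
  define S where "S x = (\<Sum>p\<in>C. \<beta> p x)" for x
  have \<beta>C: "Ck_on 1 UNIV (\<beta> p)" for p unfolding \<beta>_def by (rule smooth_onD[OF smooth_on_ball_bump])
  have SC: "Ck_on 1 UNIV S" unfolding S_def by (intro Ck_on_sum \<beta>C) auto
  \<comment> \<open>The normalizing sum is positive on an open set containing the closure of
    \<Omega>. This makes the quotients C1 beyond the boundary and their gradients bounded on
    \<Omega>.\<close>
  define V where "V = {x. 0 < S x}"
  have V: "open V" unfolding V_def
    by (intro open_Collect_less continuous_on_const Ck_on_imp_continuous_on[OF SC])
  have clV: "closure \<Omega> \<subseteq> V"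
  proof
    fix x assume "x \<in> closure \<Omega>"
    then obtain p where p: "p \<in> C" "x \<in> ball p (R p / 2)" using cov by blast
    then have "0 < \<beta> p x" using ball_bump_pos_iff[of "R p / 2" p x] C3[OF p(1)] by (simp add: \<beta>_def)
    then show "x \<in> V"
      unfolding V_def S_def mem_Collect_eq using p(1) C(1)
      by (intro sum_pos2[of _ p]) (auto simp: \<beta>_def ball_bump_nonneg)
  qed
  have inv: "((\<lambda>t. inverse t) has_real_derivative - (inverse t * inverse t)) (at t)" if "t \<in> {0<..}" for t :: real
    using that by (auto intro!: derivative_eq_intros)
  have iS: "Ck_on 1 V (\<lambda>x. inverse (S x))"
    by (rule Ck_on_1_compose(1)[OF V Ck_on_UNIV_subset[OF SC] _ inv])
      (auto simp: V_def intro!: continuous_intros)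
  define \<eta> where "\<eta> p x = \<beta> p x * inverse (S x)" for p x
  have \<eta>V: "Ck_on 1 V (\<eta> p)" for p
    unfolding \<eta>_def by (rule Ck_on_mult[OF V Ck_on_UNIV_subset[OF \<beta>C] iS])
  have \<Omega>V: "\<Omega> \<subseteq> V" using clV closure_subset by blast
  have \<eta>\<Omega>: "Ck_on 1 \<Omega> (\<eta> p)" for p by (rule Ck_on_subset[OF \<eta>V \<Omega>V])
  have \<eta>c: "continuous_on (closure \<Omega>) (\<eta> p)" for p
    by (rule continuous_on_subset[OF Ck_on_imp_continuous_on[OF \<eta>V] clV])
  have \<eta>g: "continuous_on (closure \<Omega>) (grad (\<eta> p))" for p
    using \<eta>V[of p] clV unfolding Ck_on_1_iff by (blast intro: continuous_on_subset)
  have sum1: "(\<Sum>p\<in>C. \<eta> p x) = 1" if "x \<in> closure \<Omega>" for x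
    using clV that by (auto simp: \<eta>_def sum_distrib_right[symmetric] S_def[symmetric] V_def)
  define Y where "Y p x = \<eta> p x *\<^sub>R X x" for p x
  have YC: "C1_field \<Omega> (Y p)" for p
    unfolding Y_def by (rule C1_field_scale[OF open_dom \<eta>\<Omega> X(2)])
  have Yc: "continuous_on (closure \<Omega>) (Y p)" for p
    unfolding Y_def by (intro continuous_intros \<eta>c X(1))
  have Yd: "\<exists>M. \<forall>x\<in>\<Omega>. \<bar>divergence (Y p) x\<bar> \<le> M" for p
  proof -
    obtain B1 where B1: "B1 > 0" "\<And>x. x \<in> closure \<Omega> \<Longrightarrow> \<bar>\<eta> p x\<bar> \<le> B1"
      using bounded_on_closure[OF \<eta>c[of p]] by auto
    have "continuous_on (closure \<Omega>) (\<lambda>x. grad (\<eta> p) x \<bullet> X x)" by (intro continuous_intros \<eta>g X(1))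
    then obtain B2 where B2: "\<And>x. x \<in> closure \<Omega> \<Longrightarrow> \<bar>grad (\<eta> p) x \<bullet> X x\<bar> \<le> B2"
      using bounded_on_closure[of "\<lambda>x. grad (\<eta> p) x \<bullet> X x"] by auto
    have "\<bar>divergence (Y p) x\<bar> \<le> B1 * M + B2" if x: "x \<in> \<Omega>" for x
    proof -
      have xc: "x \<in> closure \<Omega>" using x closure_subset by blast
      have "\<bar>divergence (Y p) x\<bar> \<le> \<bar>\<eta> p x\<bar> * \<bar>divergence X x\<bar> + \<bar>grad (\<eta> p) x \<bullet> X x\<bar>"
        unfolding Y_def divergence_scale[OF \<eta>\<Omega> X(2) x] using abs_triangle_ineq by (simp add: abs_mult[symmetric])
      also have "\<dots> \<le> B1 * M + B2"
        using B1(1) B1(2)[OF xc] B2[OF xc] M[OF x] by (intro add_mono mult_mono) auto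
      finally show ?thesis .
    qed
    then show ?thesis by blast
  qed
  have adm: "admissible (Y p)" for p using YC Yc Yd by (simp add: admissible_def)
  have fl: "flux_identity (Y p)" if p: "p \<in> C" for p
  proof -
    have "Y p x = 0" if "x \<notin> ball p (R p / 2)" for x
    proof -
      have "\<beta> p x = 0" using C3[OF p] that by (auto simp: \<beta>_def intro!: ball_bump_eq_0)
      then show ?thesis by (simp add: Y_def \<eta>_def)
    qed
    then show ?thesis using loc p adm by simp
  qed
  have XY: "X x = (\<Sum>p\<in>C. Y p x)" if "x \<in> closure \<Omega>" for x
    using sum1[OF that] by (simp add: Y_def scaleR_sum_left[symmetric])
  have dXY: "divergence X x = (\<Sum>p\<in>C. divergence (Y p) x)" if x: "x \<in> \<Omega>" for x
    using divergence_cong[OF open_dom, of X "\<lambda>x. \<Sum>p\<in>C. Y p x" x] XY closure_subset x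
      divergence_sum[of C \<Omega> Y x, OF YC x] by auto
  have i1: "integrable lborel (\<lambda>x. indicator \<Omega> x * divergence (Y p) x)" for p
    using Yd[of p] integrable_dom[OF continuous_on_divergence[OF YC]] by blast
  have i2: "integrable \<sigma> (\<lambda>x. Y p x \<bullet> outward_normal \<Omega> x)" for p
    by (intro integrable_surface_continuous continuous_surface_flux Yc)
  have "(LINT x|lborel. indicator \<Omega> x * divergence X x) = (LINT x|lborel. (\<Sum>p\<in>C. indicator \<Omega> x * divergence (Y p) x))"
    using dXY by (intro Bochner_Integration.integral_cong) (auto simp: indicator_def)
  also have "\<dots> = (\<Sum>p\<in>C. (LINT x|lborel. indicator \<Omega> x * divergence (Y p) x))"
    by (rule Bochner_Integration.integral_sum[OF i1])
  also have "\<dots> = (\<Sum>p\<in>C. (LINT x|\<sigma>. Y p x \<bullet> outward_normal \<Omega> x))"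
    using fl by (intro sum.cong) (auto simp: flux_identity_def)
  also have "\<dots> = (LINT x|\<sigma>. (\<Sum>p\<in>C. Y p x \<bullet> outward_normal \<Omega> x))"
    by (rule Bochner_Integration.integral_sum[OF i2, symmetric])
  also have "\<dots> = (LINT x|\<sigma>. X x \<bullet> outward_normal \<Omega> x)"
    using XY frontier_subset_closure
    by (intro Bochner_Integration.integral_cong) (auto simp: space_surface_measure inner_sum_left[symmetric] subset_iff)
  finally show ?thesis .
qed

end

section \<open>Weak gradients\<close>

lemma integral_Cauchy_Schwarz:
  fixes f g :: "'a \<Rightarrow> real"
  assumes f: "integrable M (\<lambda>x. (f x)\<^sup>2)" and g: "integrable M (\<lambda>x. (g x)\<^sup>2)" and fg: "integrable M (\<lambda>x. f x * g x)"
  shows "(LINT x|M. f x * g x)\<^sup>2 \<le> (LINT x|M. (f x)\<^sup>2) * (LINT x|M. (g x)\<^sup>2)"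
proof -
  define a b c where "a = (LINT x|M. (f x)\<^sup>2)" and "b = (LINT x|M. f x * g x)" and "c = (LINT x|M. (g x)\<^sup>2)"
  have q: "0 \<le> t\<^sup>2 * a - 2 * t * b + c" for t
  proof -
    have "0 \<le> (LINT x|M. (t * f x - g x)\<^sup>2)" by simp
    also have "\<dots> = (LINT x|M. t\<^sup>2 * (f x)\<^sup>2 - 2 * t * (f x * g x) + (g x)\<^sup>2)"
      by (intro Bochner_Integration.integral_cong) (auto simp: power2_eq_square algebra_simps)
    also have "\<dots> = t\<^sup>2 * a - 2 * t * b + c"
      using f g fg by (simp add: a_def b_def c_def)
    finally show ?thesis .
  qed
  have ac: "0 \<le> a" "0 \<le> c" by (simp_all add: a_def c_def)
  have "b\<^sup>2 \<le> a * c"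
  proof (cases "a = 0")
    case True
    have "b = 0"
    proof (rule ccontr)
      assume "b \<noteq> 0"
      \<comment> \<open>For \<open>a = 0\<close> the quadratic is affine in \<open>t\<close>, and
        this \<open>t\<close> gives it the value -1.\<close>
      then show False using q[of "(c + 1) / (2 * b)"] True by simp
    qed
    then show ?thesis using ac by simp
  next
    case False
    \<comment> \<open>The point \<open>b / a\<close> is the minimizer of the quadratic.\<close>
    then have "0 \<le> a * ((b / a)\<^sup>2 * a - 2 * (b / a) * b + c)" using q[of "b / a"] ac by simp
    also have "\<dots> = a * c - b\<^sup>2" using False by (simp add: power2_eq_square field_simps)
    finally show ?thesis by simp
  qed
  then show ?thesis by (simp add: a_def b_def c_def)
qed

lemma C1_closureE:
  assumes "C1_closure \<Omega> v"
  obtains G where "continuous_on (closure \<Omega>) G" "\<And>x. x \<in> \<Omega> \<Longrightarrow> G x = grad v x"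
    "Ck_on 1 \<Omega> v" "continuous_on (closure \<Omega>) v"
  using assms unfolding C1_closure_def by blast

lemma C1_closure_diff:
  assumes "open \<Omega>" "C1_closure \<Omega> v" "C1_closure \<Omega> w"
  shows "C1_closure \<Omega> (\<lambda>x. v x - w x)"
proof -
  obtain G where G: "continuous_on (closure \<Omega>) G" "\<And>x. x \<in> \<Omega> \<Longrightarrow> G x = grad v x"
    "Ck_on 1 \<Omega> v" "continuous_on (closure \<Omega>) v" using C1_closureE[OF assms(2)] by metis
  obtain H where H: "continuous_on (closure \<Omega>) H" "\<And>x. x \<in> \<Omega> \<Longrightarrow> H x = grad w x"
    "Ck_on 1 \<Omega> w" "continuous_on (closure \<Omega>) w" using C1_closureE[OF assms(3)] by metis
  have "grad (\<lambda>x. v x - w x) x = G x - H x" if "x \<in> \<Omega>" for x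
    using G(2,3) H(2,3) that Ck_on_1_differentiable by (metis grad_diff)
  then have "\<forall>x\<in>\<Omega>. G x - H x = grad (\<lambda>x. v x - w x) x" by simp
  then show ?thesis
    unfolding C1_closure_def using Ck_on_diff[OF assms(1) G(3) H(3)] G(1,4) H(1,4)
    by (intro conjI exI[of _ "\<lambda>x. G x - H x"] continuous_intros)
qed

context smooth_domain
begin

definition dom_int :: "('a \<Rightarrow> real) \<Rightarrow> real" where
  "dom_int f = (LINT x|lborel. indicator \<Omega> x * f x)"

lemma dom_sets [measurable]: "\<Omega> \<in> sets borel" and dom_lebesgue: "\<Omega> \<in> sets lebesgue"
  using open_dom by auto

lemma indicator_measurable:
  fixes f :: "'a \<Rightarrow> real"
  assumes "continuous_on \<Omega> f"
  shows "(\<lambda>x. indicator \<Omega> x * f x) \<in> borel_measurable borel"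
  using borel_measurable_continuous_on_indicator[OF dom_sets assms] by simp

lemma integral_lebesgue_on_dom:
  fixes f :: "'a \<Rightarrow> real"
  assumes "continuous_on \<Omega> f"
  shows "(LINT x|lebesgue_on \<Omega>. f x) = dom_int f"
proof -
  have "(LINT x|lebesgue_on \<Omega>. f x) = (LINT x|lebesgue. indicator \<Omega> x *\<^sub>R f x)"
    using dom_lebesgue by (intro integral_restrict_space) auto
  also have "\<dots> = dom_int f"
    using indicator_measurable[OF assms] by (simp add: dom_int_def integral_completion)
  finally show ?thesis .
qed

lemma integrable_lebesgue_on_dom:
  fixes f :: "'a \<Rightarrow> real"
  assumes "continuous_on \<Omega> f"
  shows "integrable (lebesgue_on \<Omega>) f \<longleftrightarrow> integrable lborel (\<lambda>x. indicator \<Omega> x * f x)"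
  using integrable_restrict_space[of \<Omega> lebesgue f] dom_lebesgue
    integrable_completion[of "\<lambda>x. indicator \<Omega> x * f x" lborel] indicator_measurable[OF assms]
  by simp

text \<open>The recurring form of hypotheses on gradients: \<open>g\<close> is a continuous
  extension of what \<open>f\<close> is inside \<Omega>. For \<open>f = grad v\<close> the values of
  the formal expression \<open>grad v\<close> on the boundary carry no information.\<close>

lemma integrable_closure:
  fixes f :: "'a \<Rightarrow> real"
  assumes "continuous_on (closure \<Omega>) g" "\<And>x. x \<in> \<Omega> \<Longrightarrow> g x = f x"
  shows "integrable lborel (\<lambda>x. indicator \<Omega> x * f x)"
proof -
  obtain B where "\<forall>x\<in>closure \<Omega>. \<bar>g x\<bar> \<le> B" using bounded_on_closure[OF assms(1)] by auto
  then have "\<bar>f x\<bar> \<le> B" if "x \<in> \<Omega>" for x using that assms(2) closure_subset by (metis subsetD)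
  moreover have "continuous_on \<Omega> f"
    using continuous_on_subset[OF assms(1) closure_subset] assms(2) by (simp cong: continuous_on_cong)
  ultimately show ?thesis by (intro integrable_dom)
qed

lemma borel_measurable_lebesgue_on_dom:
  fixes f :: "'a \<Rightarrow> 'b::euclidean_space"
  assumes "continuous_on \<Omega> f"
  shows "f \<in> borel_measurable (lebesgue_on \<Omega>)"
  using assms dom_lebesgue by (rule continuous_imp_measurable_on_sets_lebesgue)

lemma finite_lebesgue_on_dom: "finite_measure (lebesgue_on \<Omega>)"
proof (rule finite_measureI)
  have "emeasure lborel \<Omega> < \<infinity>" using bounded_dom by (rule emeasure_bounded_finite)
  then show "emeasure (lebesgue_on \<Omega>) (space (lebesgue_on \<Omega>)) \<noteq> \<infinity>"
    using dom_lebesgue by (simp add: space_restrict_space emeasure_restrict_space less_top)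
qed

text \<open>Bumps tend to indicators of boxes, so the integral over every small box vanishes.
  Positive and negative part then define two measures that agree on small boxes, hence on all Borel
  subsets of \<Omega>, among them the sets where the function is positive or negative.\<close>

lemma fundamental_lemma:
  assumes f: "integrable (lebesgue_on \<Omega>) f"
    and 0: "\<And>\<phi>. test_function \<Omega> \<phi> \<Longrightarrow> (LINT x|lebesgue_on \<Omega>. f x * \<phi> x) = 0"
  shows "AE x in lebesgue_on \<Omega>. f x = (0::real)"
proof -
  have F: "integrable lebesgue (\<lambda>x. indicator \<Omega> x * f x)"
    using integrable_restrict_space[of \<Omega> lebesgue f] f dom_lebesgue by simp
  \<comment> \<open>The function is only Lebesgue measurable; a Borel representative is needed for
    measures on the Borel sets.\<close>
  then obtain g where g: "g \<in> borel_measurable borel" and eq: "AE x in lborel. indicator \<Omega> x * f x = g x"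
    using completion_ex_borel_measurable_real[of "\<lambda>x. indicator \<Omega> x * f x" lborel] by auto
  note [measurable] = g
  have eq': "AE x in lebesgue. indicator \<Omega> x * f x = g x" using eq by (rule AE_completion)
  have "integrable lebesgue g"
    using F eq' borel_measurable_integrable[OF F] measurable_completion[of g lborel borel] g
    by (subst integrable_cong_AE[of _ _ "\<lambda>x. indicator \<Omega> x * f x"]) auto
  then have gi: "integrable lborel g" using integrable_completion[of g lborel] g by simp
  have g\<phi>: "(LINT x|lborel. g x * \<phi> x) = 0" if \<phi>: "test_function \<Omega> \<phi>" for \<phi>
  proof -
    have "Ck_on 0 UNIV \<phi>" using \<phi> smooth_onD unfolding test_function_def by blast
    then have [measurable]: "\<phi> \<in> borel_measurable borel" by (simp add: borel_measurable_continuous_onI)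
    have "0 = (LINT x|lebesgue. indicator \<Omega> x *\<^sub>R (f x * \<phi> x))"
      using 0[OF \<phi>] integral_restrict_space[of \<Omega> lebesgue "\<lambda>x. f x * \<phi> x"] dom_lebesgue by simp
    also have "\<dots> = (LINT x|lebesgue. g x * \<phi> x)"
    proof (rule integral_cong_AE)
      have "(\<lambda>x. (indicator \<Omega> x * f x) * \<phi> x) \<in> borel_measurable lebesgue"
        using measurable_completion[of \<phi> lborel borel]
        by (intro borel_measurable_times[OF borel_measurable_integrable[OF F]]) auto
      then show "(\<lambda>x. indicator \<Omega> x *\<^sub>R (f x * \<phi> x)) \<in> borel_measurable lebesgue" by (simp add: mult.assoc)
      show "(\<lambda>x. g x * \<phi> x) \<in> borel_measurable lebesgue"
        by (rule measurable_completion) measurable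
      show "AE x in lebesgue. indicator \<Omega> x *\<^sub>R (f x * \<phi> x) = g x * \<phi> x"
        using eq' by eventually_elim (simp add: mult.assoc[symmetric])
    qed
    also have "\<dots> = (LINT x|lborel. g x * \<phi> x)" by (intro integral_completion) measurable
    finally show ?thesis by simp
  qed
  have gbox: "(LINT x|lborel. g x * indicator (box a b) x) = 0" if ab: "cbox a b \<subseteq> \<Omega>" "box a b \<noteq> {}" for a b
  proof -
    have "(\<lambda>j. LINT x|lborel. g x * box_bump a b (real (Suc j)) x) \<longlonglongrightarrow> (LINT x|lborel. g x * indicator (box a b) x)"
    proof (rule integral_dominated_convergence[where w="\<lambda>x. \<bar>g x\<bar>"])
      show "integrable lborel (\<lambda>x. \<bar>g x\<bar>)" using gi by simp
      show "AE x in lborel. (\<lambda>j. g x * box_bump a b (real (Suc j)) x) \<longlonglongrightarrow> g x * indicator (box a b) x"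
        by (intro AE_I2 tendsto_mult tendsto_const box_bump_tendsto[OF ab(2)])
      show "AE x in lborel. norm (g x * box_bump a b (real (Suc j)) x) \<le> \<bar>g x\<bar>" for j
        by (intro AE_I2) (simp add: abs_mult mult_left_le abs_of_nonneg[OF box_bump_nonneg] box_bump_le_1)
      have "box_bump a b (real (Suc j)) \<in> borel_measurable borel" for j
        using Ck_on_imp_continuous_on[OF smooth_onD[OF smooth_on_box_bump]] by (rule borel_measurable_continuous_onI)
      then show "(\<lambda>x. g x * box_bump a b (real (Suc j)) x) \<in> borel_measurable lborel" for j by simp
    qed simp
    moreover have "(LINT x|lborel. g x * box_bump a b (real (Suc j)) x) = 0" for j
      by (rule g\<phi>[OF test_function_box_bump[OF _ ab(2,1)]]) simp
    ultimately show ?thesis by (simp add: LIMSEQ_const_iff)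
  qed
  \<comment> \<open>As \<open>ennreal\<close> sends negative reals to 0, the two densities are the
    positive and the negative part of \<open>g\<close>.\<close>
  define M where "M = density lborel (\<lambda>x. ennreal (g x))"
  define N where "N = density lborel (\<lambda>x. ennreal (- g x))"
  have M: "emeasure M A = (\<integral>\<^sup>+x. ennreal (g x * indicator A x) \<partial>lborel)"
    and N: "emeasure N A = (\<integral>\<^sup>+x. ennreal (- g x * indicator A x) \<partial>lborel)" if [measurable]: "A \<in> sets borel" for A
    unfolding M_def N_def
    by (subst emeasure_density; (auto intro!: nn_integral_cong split: split_indicator)?)+
  have fin: "emeasure M A < \<infinity>" "emeasure N A < \<infinity>" if [measurable]: "A \<in> sets borel" for A
  proof -
    have fin: "(\<integral>\<^sup>+x. ennreal \<bar>g x\<bar> \<partial>lborel) < \<infinity>" using gi unfolding integrable_iff_bounded by simp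
    have "(\<integral>\<^sup>+x. ennreal (g x * indicator A x) \<partial>lborel) \<le> (\<integral>\<^sup>+x. ennreal \<bar>g x\<bar> \<partial>lborel)"
      "(\<integral>\<^sup>+x. ennreal (- g x * indicator A x) \<partial>lborel) \<le> (\<integral>\<^sup>+x. ennreal \<bar>g x\<bar> \<partial>lborel)"
      by (intro nn_integral_mono ennreal_leI; simp add: indicator_def abs_ge_self abs_ge_minus_self)+
    with fin show "emeasure M A < \<infinity>" "emeasure N A < \<infinity>"
      unfolding M[OF that] N[OF that] by (simp_all add: le_less_trans)
  qed
  have boxes: "emeasure M (box a b) = emeasure N (box a b)" if ab: "cbox a b \<subseteq> \<Omega>" for a b
  proof (cases "box a b = {}")
    case False
    have i: "integrable lborel (\<lambda>x. g x * indicator (box a b) x)"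
      using integrable_mult_indicator[of "box a b" lborel g] gi by (simp add: mult.commute)
    have "(LINT x|lborel. g x * indicator (box a b) x) = enn2real (emeasure M (box a b)) - enn2real (emeasure N (box a b))"
      using real_lebesgue_integral_def[OF i] by (simp add: M N)
    then have "enn2real (emeasure M (box a b)) = enn2real (emeasure N (box a b))"
      using gbox[OF ab False] by simp
    moreover have "emeasure M (box a b) < top" "emeasure N (box a b) < top" using fin[of "box a b"] by simp_all
    ultimately show ?thesis by (metis ennreal_enn2real)
  qed simp
  have MN: "emeasure M A = emeasure N A" if "A \<in> sets borel" "A \<subseteq> \<Omega>" for A
  proof (rule measures_eq_on_open[OF _ _ open_dom boxes _ that])
    show "sets M = sets borel" "sets N = sets borel" by (simp_all add: M_def N_def)
    show "emeasure M (box a b) \<noteq> \<infinity>" for a b using fin(1)[of "box a b"] by simp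
  qed
  \<comment> \<open>On the set where \<open>g\<close> is positive \<open>N\<close> vanishes, so
    \<open>M\<close> vanishes too; the integral of \<open>g\<close> over this set is zero.\<close>
  have "AE x in lborel. g x * indicator {x \<in> \<Omega>. 0 < g x} x \<le> 0"
  proof -
    have [measurable]: "{x \<in> \<Omega>. 0 < g x} \<in> sets borel" by measurable
    have "emeasure N {x \<in> \<Omega>. 0 < g x} = 0"
      unfolding N[OF \<open>{x \<in> \<Omega>. 0 < g x} \<in> sets borel\<close>]
      by (subst nn_integral_0_iff_AE) (auto simp: ennreal_neg split: split_indicator)
    then have "(\<integral>\<^sup>+x. ennreal (g x * indicator {x \<in> \<Omega>. 0 < g x} x) \<partial>lborel) = 0"
      using MN[of "{x \<in> \<Omega>. 0 < g x}"] M[of "{x \<in> \<Omega>. 0 < g x}"] by simp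
    then show ?thesis by (subst (asm) nn_integral_0_iff_AE) (auto simp: ennreal_eq_0_iff)
  qed
  moreover have "AE x in lborel. - g x * indicator {x \<in> \<Omega>. g x < 0} x \<le> 0"
  proof -
    have [measurable]: "{x \<in> \<Omega>. g x < 0} \<in> sets borel" by measurable
    have "emeasure M {x \<in> \<Omega>. g x < 0} = 0"
      unfolding M[OF \<open>{x \<in> \<Omega>. g x < 0} \<in> sets borel\<close>]
      by (subst nn_integral_0_iff_AE) (auto simp: ennreal_neg split: split_indicator)
    then have "(\<integral>\<^sup>+x. ennreal (- g x * indicator {x \<in> \<Omega>. g x < 0} x) \<partial>lborel) = 0"
      using MN[of "{x \<in> \<Omega>. g x < 0}"] N[of "{x \<in> \<Omega>. g x < 0}"] by simp
    then show ?thesis by (subst (asm) nn_integral_0_iff_AE) (auto simp: ennreal_eq_0_iff)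
  qed
  ultimately have "AE x in lborel. x \<in> \<Omega> \<longrightarrow> f x = 0"
    using eq
  proof eventually_elim
    case (elim x)
    show ?case
    proof
      assume "x \<in> \<Omega>"
      with elim show "f x = 0"
        by (cases "g x" "0::real" rule: linorder_cases) auto
    qed
  qed
  then have "AE x in lebesgue. x \<in> \<Omega> \<longrightarrow> f x = 0" by (rule AE_completion)
  then show ?thesis using dom_lebesgue by (subst AE_restrict_space_iff) auto
qed

lemma integrable_lebesgue_on_closure:
  fixes f :: "'a \<Rightarrow> real"
  assumes "continuous_on (closure \<Omega>) g" "\<And>x. x \<in> \<Omega> \<Longrightarrow> g x = f x"
  shows "integrable (lebesgue_on \<Omega>) f" "(LINT x|lebesgue_on \<Omega>. f x) = dom_int f"
proof -
  have "continuous_on \<Omega> f"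
    using continuous_on_subset[OF assms(1) closure_subset] assms(2) by (simp cong: continuous_on_cong)
  then show "integrable (lebesgue_on \<Omega>) f" "(LINT x|lebesgue_on \<Omega>. f x) = dom_int f"
    using integrable_closure[OF assms] by (auto simp: integrable_lebesgue_on_dom integral_lebesgue_on_dom)
qed

text \<open>The product of \<open>v\<close> with a test function, extended by zero, is C1 with
  compact support on the whole space, so its partial derivatives integrate to zero. The product rule
  turns this into the weak identity.\<close>

lemma C1_closure_weak_grad:
  assumes v: "C1_closure \<Omega> v"
  shows "L2_on \<Omega> v" "L2_on \<Omega> (grad v)" "is_weak_grad \<Omega> v (grad v)"
proof -
  obtain G where G: "continuous_on (closure \<Omega>) G" "\<And>x. x \<in> \<Omega> \<Longrightarrow> G x = grad v x"
    and v1: "Ck_on 1 \<Omega> v" and vc: "continuous_on (closure \<Omega>) v" using C1_closureE[OF v] by metis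
  show "L2_on \<Omega> v" unfolding L2_on_def
    by (intro conjI borel_measurable_lebesgue_on_dom Ck_on_imp_continuous_on[OF v1]
        integrable_lebesgue_on_closure(1)[of "\<lambda>x. (norm (v x))\<^sup>2"] continuous_intros vc refl)
  have gc: "continuous_on \<Omega> (grad v)" using v1 unfolding Ck_on_1_iff by simp
  show "L2_on \<Omega> (grad v)" unfolding L2_on_def
    by (intro conjI borel_measurable_lebesgue_on_dom gc
        integrable_lebesgue_on_closure(1)[of "\<lambda>x. (norm (G x))\<^sup>2"] continuous_intros G(1)) (simp add: G(2))
  show "is_weak_grad \<Omega> v (grad v)"
    unfolding is_weak_grad_def
  proof (intro allI impI ballI)
    fix \<phi> and b :: 'a assume \<phi>: "test_function \<Omega> \<phi>" and b: "b \<in> Basis"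
    define K where "K = closure {x. \<phi> x \<noteq> 0}"
    have K: "compact K" "K \<subseteq> \<Omega>" using \<phi> by (auto simp: test_function_def K_def)
    have \<phi>0: "\<phi> x = 0" if "x \<notin> K" for x using that closure_subset[of "{x. \<phi> x \<noteq> 0}"] unfolding K_def by blast
    have \<phi>1: "Ck_on 1 UNIV \<phi>" using \<phi> smooth_onD unfolding test_function_def by blast
    have \<phi>c: "continuous_on S \<phi>" "continuous_on S (grad \<phi>)" for S
      using Ck_on_imp_continuous_on[OF \<phi>1] \<phi>1 unfolding Ck_on_1_iff by (auto intro: continuous_on_subset)
    define f where "f x = (if x \<in> \<Omega> then v x * \<phi> x else 0)" for x
    have f0: "f x = 0" if "x \<notin> K" for x using \<phi>0[OF that] by (simp add: f_def)
    have oK: "open (- K)" using K(1) compact_imp_closed by blast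
    have f\<Omega>: "f x = v x * \<phi> x" if "x \<in> \<Omega>" for x using that by (simp add: f_def)
    have "Ck_on 1 \<Omega> f"
      using Ck_on_cong[OF open_dom, of f "\<lambda>x. v x * \<phi> x"] f\<Omega>
        Ck_on_mult[OF open_dom v1 Ck_on_UNIV_subset[OF \<phi>1]] by (simp del: Ck_on.simps)
    moreover have "Ck_on 1 (- K) f"
      using Ck_on_cong[OF oK, of f "\<lambda>x. 0" 1] f0 Ck_on_const[of 1 "- K" 0] by (simp del: Ck_on.simps)
    moreover have U: "UNIV = \<Omega> \<union> - K" using K(2) by auto
    ultimately have f1: "Ck_on 1 UNIV f"
      unfolding Ck_on_1_iff using continuous_on_open_Un[OF open_dom oK, of "grad f"] by (metis UnE)
    have gf: "grad f x \<bullet> b = indicator \<Omega> x * (v x * partial_deriv b \<phi> x) + indicator \<Omega> x * ((grad v x \<bullet> b) * \<phi> x)" for x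
    proof (cases "x \<in> \<Omega>")
      case True
      have "grad f x = grad (\<lambda>x. v x * \<phi> x) x" by (rule grad_cong[OF open_dom f\<Omega> True])
      also have "\<dots> = v x *\<^sub>R grad \<phi> x + \<phi> x *\<^sub>R grad v x"
        using Ck_on_1_differentiable[OF v1 True] Ck_on_1_differentiable[OF \<phi>1] by (intro grad_mult) auto
      finally show ?thesis using True by (simp add: inner_add_left grad_inner[OF b])
    next
      case False
      then have "x \<notin> K" using K(2) by auto
      then show ?thesis using grad_eq_0_outside[OF K(1) f0] False by simp
    qed
    have p: "partial_deriv b \<phi> x = grad \<phi> x \<bullet> b" for x by (simp add: grad_inner[OF b])
    have c1: "continuous_on (closure \<Omega>) (\<lambda>x. v x * partial_deriv b \<phi> x)" unfolding p
      by (intro continuous_intros vc \<phi>c)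
    have c2: "continuous_on (closure \<Omega>) (\<lambda>x. (G x \<bullet> b) * \<phi> x)" by (intro continuous_intros G(1) \<phi>c)
    have e2: "(G x \<bullet> b) * \<phi> x = (grad v x \<bullet> b) * \<phi> x" if "x \<in> \<Omega>" for x using G(2)[OF that] by simp
    have "0 = (LINT x|lborel. grad f x \<bullet> b)"
      using integral_grad_compact_support(2)[OF f1 K(1) f0] by simp
    also have "\<dots> = dom_int (\<lambda>x. v x * partial_deriv b \<phi> x) + dom_int (\<lambda>x. (grad v x \<bullet> b) * \<phi> x)"
      unfolding gf dom_int_def
      by (intro Bochner_Integration.integral_add integrable_closure[OF c1] integrable_closure[OF c2] refl e2)
    finally show "(LINT x|lebesgue_on \<Omega>. v x * partial_deriv b \<phi> x) = - (LINT x|lebesgue_on \<Omega>. (grad v x \<bullet> b) * \<phi> x)"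
      using integrable_lebesgue_on_closure(2)[OF c1 refl] integrable_lebesgue_on_closure(2)[OF c2 e2] by simp
  qed
qed

text \<open>The domain has finite volume, so \<open>1 + (norm (g x))\<^sup>2\<close> is an
  integrable majorant of the norm.\<close>

lemma L2_on_inner_integrable:
  assumes "L2_on \<Omega> g"
  shows "integrable (lebesgue_on \<Omega>) (\<lambda>x. g x \<bullet> b)"
proof (rule Bochner_Integration.integrable_bound)
  interpret finite_measure "lebesgue_on \<Omega>" by (rule finite_lebesgue_on_dom)
  have g[measurable]: "g \<in> borel_measurable (lebesgue_on \<Omega>)" and g2: "integrable (lebesgue_on \<Omega>) (\<lambda>x. (norm (g x))\<^sup>2)"
    using assms by (auto simp: L2_on_def)
  show "integrable (lebesgue_on \<Omega>) (\<lambda>x. (1 + (norm (g x))\<^sup>2) * norm b)" using g2 by simp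
  show "(\<lambda>x. g x \<bullet> b) \<in> borel_measurable (lebesgue_on \<Omega>)" by measurable
  show "AE x in lebesgue_on \<Omega>. norm (g x \<bullet> b) \<le> norm ((1 + (norm (g x))\<^sup>2) * norm b)"
  proof (rule AE_I2)
    fix x
    have "norm (g x) \<le> 1 + (norm (g x))\<^sup>2"
      using sum_squares_bound[of "norm (g x)" 1] zero_le_power2[of "norm (g x)"] norm_ge_zero[of "g x"] by (simp, linarith)
    then have "norm (g x) * norm b \<le> (1 + (norm (g x))\<^sup>2) * norm b" by (rule mult_right_mono) simp
    then show "norm (g x \<bullet> b) \<le> norm ((1 + (norm (g x))\<^sup>2) * norm b)"
      using Cauchy_Schwarz_ineq2[of "g x" b] by (simp add: abs_mult)
  qed
qed

text \<open>Makes the choice in \<open>weak_grad\<close> harmless: it agrees almost everywhere with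
  the classical gradient of a function that is C1 up to the boundary.\<close>

lemma weak_grad_unique:
  assumes g: "L2_on \<Omega> g" "is_weak_grad \<Omega> v g" and h: "L2_on \<Omega> h" "is_weak_grad \<Omega> v h"
  shows "AE x in lebesgue_on \<Omega>. g x = h x"
proof -
  have "AE x in lebesgue_on \<Omega>. g x \<bullet> b - h x \<bullet> b = 0" if b: "b \<in> Basis" for b
  proof (rule fundamental_lemma)
    note gi = L2_on_inner_integrable[OF g(1), of b] and hi = L2_on_inner_integrable[OF h(1), of b]
    show "integrable (lebesgue_on \<Omega>) (\<lambda>x. g x \<bullet> b - h x \<bullet> b)" using gi hi by simp
    fix \<phi> assume \<phi>: "test_function \<Omega> \<phi>"
    have "continuous_on UNIV \<phi>" using \<phi> smooth_onD[of UNIV \<phi> 0] by (simp add: test_function_def)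
    then have \<phi>c: "continuous_on S \<phi>" for S by (rule continuous_on_subset) simp
    obtain B where B: "\<And>x. x \<in> closure \<Omega> \<Longrightarrow> \<bar>\<phi> x\<bar> \<le> B" using bounded_on_closure[OF \<phi>c] by auto
    have i: "integrable (lebesgue_on \<Omega>) (\<lambda>x. (k x \<bullet> b) * \<phi> x)" if "integrable (lebesgue_on \<Omega>) (\<lambda>x. k x \<bullet> b)" for k
    proof (rule Bochner_Integration.integrable_bound)
      show "integrable (lebesgue_on \<Omega>) (\<lambda>x. \<bar>k x \<bullet> b\<bar> * \<bar>B\<bar>)" using that by simp
      show "(\<lambda>x. (k x \<bullet> b) * \<phi> x) \<in> borel_measurable (lebesgue_on \<Omega>)"
        by (rule borel_measurable_times[OF borel_measurable_integrable[OF that]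
              borel_measurable_lebesgue_on_dom[OF \<phi>c]])
      show "AE x in lebesgue_on \<Omega>. norm ((k x \<bullet> b) * \<phi> x) \<le> norm (\<bar>k x \<bullet> b\<bar> * \<bar>B\<bar>)"
      proof (rule AE_I2)
        fix x assume "x \<in> space (lebesgue_on \<Omega>)"
        then have "x \<in> closure \<Omega>" using closure_subset by (auto simp: space_restrict_space)
        then show "norm ((k x \<bullet> b) * \<phi> x) \<le> norm (\<bar>k x \<bullet> b\<bar> * \<bar>B\<bar>)"
          using B[of x] by (auto simp: abs_mult intro!: mult_left_mono)
      qed
    qed
    have "(LINT x|lebesgue_on \<Omega>. (g x \<bullet> b) * \<phi> x) = (LINT x|lebesgue_on \<Omega>. (h x \<bullet> b) * \<phi> x)"
    proof -
      have "- (LINT x|lebesgue_on \<Omega>. (g x \<bullet> b) * \<phi> x) = - (LINT x|lebesgue_on \<Omega>. (h x \<bullet> b) * \<phi> x)"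
        using g(2)[unfolded is_weak_grad_def, rule_format, OF \<phi> b]
          h(2)[unfolded is_weak_grad_def, rule_format, OF \<phi> b] by (rule trans[OF sym])
      then show ?thesis by (simp only: neg_equal_iff_equal)
    qed
    then show "(LINT x|lebesgue_on \<Omega>. (g x \<bullet> b - h x \<bullet> b) * \<phi> x) = 0"
      using i[OF gi] i[OF hi] by (simp add: left_diff_distrib)
  qed
  then have "AE x in lebesgue_on \<Omega>. \<forall>b\<in>Basis. g x \<bullet> b - h x \<bullet> b = 0"
    by (intro AE_finite_allI) auto
  then show ?thesis
  proof eventually_elim
    case (elim x)
    show ?case by (rule euclidean_eqI) (use elim in simp)
  qed
qed

lemma C1_closure_in_H1:
  assumes v: "C1_closure \<Omega> v"
  shows "v \<in> H1 \<Omega>"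
    and "(LINT x|lebesgue_on \<Omega>. (v x)\<^sup>2) = dom_int (\<lambda>x. (v x)\<^sup>2)"
    and "(LINT x|lebesgue_on \<Omega>. (norm (weak_grad \<Omega> v x))\<^sup>2) = dom_int (\<lambda>x. (norm (grad v x))\<^sup>2)"
proof -
  note wg = C1_closure_weak_grad[OF v]
  show "v \<in> H1 \<Omega>" using wg by (auto simp: H1_def)
  obtain G where G: "continuous_on (closure \<Omega>) G" "\<And>x. x \<in> \<Omega> \<Longrightarrow> G x = grad v x"
    and vc: "continuous_on (closure \<Omega>) v" using C1_closureE[OF v] by metis
  show "(LINT x|lebesgue_on \<Omega>. (v x)\<^sup>2) = dom_int (\<lambda>x. (v x)\<^sup>2)"
    by (rule integrable_lebesgue_on_closure(2)[OF _ refl]) (intro continuous_intros vc)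
  have W: "L2_on \<Omega> (weak_grad \<Omega> v) \<and> is_weak_grad \<Omega> v (weak_grad \<Omega> v)"
    unfolding weak_grad_def by (rule someI[of _ "grad v"]) (use wg in blast)
  then have "AE x in lebesgue_on \<Omega>. weak_grad \<Omega> v x = grad v x"
    using wg by (intro weak_grad_unique) auto
  then have "(LINT x|lebesgue_on \<Omega>. (norm (weak_grad \<Omega> v x))\<^sup>2) = (LINT x|lebesgue_on \<Omega>. (norm (grad v x))\<^sup>2)"
    using W wg by (intro integral_cong_AE) (auto simp: L2_on_def)
  also have "\<dots> = dom_int (\<lambda>x. (norm (grad v x))\<^sup>2)"
    by (rule integrable_lebesgue_on_closure(2)[of "\<lambda>x. (norm (G x))\<^sup>2"]) (auto intro!: continuous_intros G(1) simp: G(2))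
  finally show "(LINT x|lebesgue_on \<Omega>. (norm (weak_grad \<Omega> v x))\<^sup>2) = dom_int (\<lambda>x. (norm (grad v x))\<^sup>2)" .
qed

lemma H1_norm_C1_closure:
  assumes "C1_closure \<Omega> v"
  shows "H1_norm \<Omega> v = sqrt (dom_int (\<lambda>x. (v x)\<^sup>2) + dom_int (\<lambda>x. (norm (grad v x))\<^sup>2))"
  using C1_closure_in_H1[OF assms] by (simp add: H1_norm_def)

end

section \<open>Boundary integrals of absolute values\<close>

context smooth_domain
begin

lemma dom_int_add:
  assumes "integrable lborel (\<lambda>x. indicator \<Omega> x * f x)" "integrable lborel (\<lambda>x. indicator \<Omega> x * g x)"
  shows "dom_int (\<lambda>x. f x + g x) = dom_int f + dom_int g"
  using assms by (simp add: dom_int_def distrib_left)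

lemma dom_int_mono:
  assumes "integrable lborel (\<lambda>x. indicator \<Omega> x * f x)" "integrable lborel (\<lambda>x. indicator \<Omega> x * g x)"
    and "\<And>x. x \<in> \<Omega> \<Longrightarrow> f x \<le> g x"
  shows "dom_int f \<le> dom_int g"
  unfolding dom_int_def using assms by (intro integral_mono) (auto simp: indicator_def)

lemma dom_int_cmult: "dom_int (\<lambda>x. c * f x) = c * dom_int f"
  by (simp add: dom_int_def mult.left_commute)

lemma dom_int_nonneg: "(\<And>x. x \<in> \<Omega> \<Longrightarrow> 0 \<le> f x) \<Longrightarrow> 0 \<le> dom_int f"
  unfolding dom_int_def by (intro Bochner_Integration.integral_nonneg) (auto simp: indicator_def)

lemma abs_dom_int_le:
  assumes "integrable lborel (\<lambda>x. indicator \<Omega> x * f x)" "integrable lborel (\<lambda>x. indicator \<Omega> x * g x)"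
    and "\<And>x. x \<in> \<Omega> \<Longrightarrow> \<bar>f x\<bar> \<le> g x"
  shows "\<bar>dom_int f\<bar> \<le> dom_int g"
proof -
  have "dom_int f \<le> dom_int g" by (rule dom_int_mono[OF assms(1,2) abs_le_D1[OF assms(3)]])
  moreover have "dom_int (\<lambda>x. - 1 * f x) \<le> dom_int g"
    using assms by (intro dom_int_mono) (auto simp: abs_le_iff)
  ultimately show ?thesis unfolding dom_int_cmult by linarith
qed

lemma dom_int_Cauchy_Schwarz:
  assumes "continuous_on (closure \<Omega>) F" "\<And>x. x \<in> \<Omega> \<Longrightarrow> F x = f x"
    and "continuous_on (closure \<Omega>) G" "\<And>x. x \<in> \<Omega> \<Longrightarrow> G x = g x"
  shows "(dom_int (\<lambda>x. f x * g x))\<^sup>2 \<le> dom_int (\<lambda>x. (f x)\<^sup>2) * dom_int (\<lambda>x. (g x)\<^sup>2)"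
proof -
  have sq: "indicator \<Omega> x * (k x)\<^sup>2 = (indicator \<Omega> x * k x)\<^sup>2"
    "indicator \<Omega> x * (k x * l x) = (indicator \<Omega> x * k x) * (indicator \<Omega> x * l x)" for k l :: "'a \<Rightarrow> real" and x
    by (auto simp: indicator_def)
  show ?thesis
    unfolding dom_int_def sq
  proof (rule integral_Cauchy_Schwarz; unfold sq[symmetric])
    show "integrable lborel (\<lambda>x. indicator \<Omega> x * (f x)\<^sup>2)"
      by (rule integrable_closure[of "\<lambda>x. (F x)\<^sup>2"]) (auto intro!: continuous_intros assms(1) simp: assms(2))
    show "integrable lborel (\<lambda>x. indicator \<Omega> x * (g x)\<^sup>2)"
      by (rule integrable_closure[of "\<lambda>x. (G x)\<^sup>2"]) (auto intro!: continuous_intros assms(3) simp: assms(4))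
    show "integrable lborel (\<lambda>x. indicator \<Omega> x * (f x * g x))"
      by (rule integrable_closure[of "\<lambda>x. F x * G x"]) (auto intro!: continuous_intros assms simp: assms(2,4))
  qed
qed

definition vol :: real where "vol = dom_int (\<lambda>_. 1)"

lemma dom_int_abs_le:
  assumes "continuous_on (closure \<Omega>) F" "\<And>x. x \<in> \<Omega> \<Longrightarrow> F x = f x"
  shows "(dom_int (\<lambda>x. \<bar>f x\<bar>))\<^sup>2 \<le> vol * dom_int (\<lambda>x. (f x)\<^sup>2)"
  using dom_int_Cauchy_Schwarz[of "\<lambda>_. 1" "\<lambda>_. 1" "\<lambda>x. \<bar>F x\<bar>" "\<lambda>x. \<bar>f x\<bar>"] assms
  by (simp add: vol_def continuous_on_rabs)

lemma vol_nonneg: "0 \<le> vol"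
  unfolding vol_def by (rule dom_int_nonneg) simp

text \<open>The field \<open>|v| Y\<close> is approximated by \<open>\<surd>(v\<^sup>2 + \<epsilon>\<^sup>2) Y\<close>.\<close>

lemma abs_flux:
  assumes v: "C1_closure \<Omega> v" and Y: "C1_field UNIV Y" "\<And>x. x \<in> closure \<Omega> \<Longrightarrow> norm (Y x) \<le> B"
    and Yc: "continuous_on UNIV Y"
  shows "\<bar>(LINT x|\<sigma>. \<bar>v x\<bar> * (Y x \<bullet> outward_normal \<Omega> x)) - dom_int (\<lambda>x. \<bar>v x\<bar> * divergence Y x)\<bar>
    \<le> B * dom_int (\<lambda>x. norm (grad v x))"
proof -
  obtain G where G: "continuous_on (closure \<Omega>) G" "\<And>x. x \<in> \<Omega> \<Longrightarrow> G x = grad v x"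
    and v1: "Ck_on 1 \<Omega> v" and vc: "continuous_on (closure \<Omega>) v" using C1_closureE[OF v] by metis
  have vf: "continuous_on (frontier \<Omega>) v" by (rule continuous_on_subset[OF vc frontier_subset_closure])
  have Yc': "continuous_on S Y" for S using Yc by (rule continuous_on_subset) simp
  have dYc: "continuous_on S (divergence Y)" for S
    using continuous_on_divergence[OF Y(1)] by (rule continuous_on_subset) simp
  have Y\<Omega>: "C1_field \<Omega> Y" using Y(1) Ck_on_UNIV_subset unfolding C1_field_def by blast
  have nu: "continuous_on (frontier \<Omega>) (\<lambda>x. Y x \<bullet> outward_normal \<Omega> x)"
    by (rule continuous_surface_flux[OF Yc'])
  define c1 where "c1 = (LINT x|\<sigma>. \<bar>Y x \<bullet> outward_normal \<Omega> x\<bar>)"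
  define c2 where "c2 = dom_int (\<lambda>x. \<bar>divergence Y x\<bar>)"
  let ?L = "LINT x|\<sigma>. \<bar>v x\<bar> * (Y x \<bullet> outward_normal \<Omega> x)"
  let ?D = "dom_int (\<lambda>x. \<bar>v x\<bar> * divergence Y x)"
  let ?E = "B * dom_int (\<lambda>x. norm (grad v x))"
  \<comment> \<open>The factor \<open>q\<close> is the derivative of the regularized modulus at
    \<open>v\<close> and has modulus at most 1, so the gradient term is bounded by \<open>?E\<close>
    for every \<epsilon>. Replacing \<open>w\<close> by the modulus of \<open>v\<close> costs
    \<epsilon> times \<open>c1\<close> on the boundary and \<epsilon> times \<open>c2\<close>
    inside.\<close>
  have key: "\<bar>?L - ?D\<bar> \<le> \<epsilon> * (c1 + c2) + ?E" if \<epsilon>: "\<epsilon> > 0" for \<epsilon>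
  proof -
    define w where "w x = sqrt ((v x)\<^sup>2 + \<epsilon>\<^sup>2)" for x
    define q where "q x = v x / w x" for x
    have pos: "0 < t\<^sup>2 + \<epsilon>\<^sup>2" for t :: real using \<epsilon> by (simp add: add_nonneg_pos)
    have wpos: "0 < w x" for x using pos by (simp add: w_def)
    have g: "((\<lambda>t. sqrt (t\<^sup>2 + \<epsilon>\<^sup>2)) has_real_derivative t / sqrt (t\<^sup>2 + \<epsilon>\<^sup>2)) (at t)" for t
      using pos[of t] by (auto intro!: derivative_eq_intros simp: divide_simps)
    have gc: "continuous_on UNIV (\<lambda>t::real. t / sqrt (t\<^sup>2 + \<epsilon>\<^sup>2))"
      using pos by (intro continuous_intros) (metis less_irrefl real_sqrt_gt_0_iff)
    have w1: "Ck_on 1 \<Omega> w" "\<And>x. x \<in> \<Omega> \<Longrightarrow> grad w x = q x *\<^sub>R grad v x"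
      using Ck_on_1_compose[OF open_dom v1 UNIV_I g gc] unfolding w_def[abs_def] q_def by simp_all
    have wc: "continuous_on (closure \<Omega>) w" unfolding w_def[abs_def] by (intro continuous_intros vc)
    have qc: "continuous_on (closure \<Omega>) q"
      unfolding q_def[abs_def] using wpos by (intro continuous_intros vc wc) (metis less_irrefl)
    have wv: "\<bar>w x - \<bar>v x\<bar>\<bar> \<le> \<epsilon>" for x
    proof -
      have "\<bar>v x\<bar> \<le> w x" unfolding w_def by (rule real_le_rsqrt) simp
      moreover have "w x \<le> \<bar>v x\<bar> + \<epsilon>"
        unfolding w_def using \<epsilon> by (intro real_le_lsqrt) (auto simp: power2_sum)
      ultimately show ?thesis by simp
    qed
    have q1: "\<bar>q x\<bar> \<le> 1" for x
    proof -
      have "\<bar>v x\<bar> \<le> w x" unfolding w_def by (rule real_le_rsqrt) simp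
      then show ?thesis using wpos[of x] by (simp add: q_def)
    qed
    define X where "X x = w x *\<^sub>R Y x" for x
    have X1: "C1_field \<Omega> X" unfolding X_def[abs_def] by (rule C1_field_scale[OF open_dom w1(1) Y\<Omega>])
    have Xc: "continuous_on (closure \<Omega>) X" unfolding X_def[abs_def] by (intro continuous_intros wc Yc')
    have dX: "divergence X x = w x * divergence Y x + q x * (grad v x \<bullet> Y x)" if "x \<in> \<Omega>" for x
      unfolding X_def[abs_def] divergence_scale[OF w1(1) Y\<Omega> that] w1(2)[OF that] by simp
    have c2': "continuous_on (closure \<Omega>) (\<lambda>x. q x * (G x \<bullet> Y x))" by (intro continuous_intros qc G(1) Yc')
    have c1': "continuous_on (closure \<Omega>) (\<lambda>x. w x * divergence Y x)" by (intro continuous_intros wc dYc)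
    have "continuous_on (closure \<Omega>) (\<lambda>x. w x * divergence Y x + q x * (G x \<bullet> Y x))"
      by (intro continuous_intros c1' c2')
    from bounded_on_closure[OF this]
    obtain M where M: "\<forall>x\<in>closure \<Omega>. norm (w x * divergence Y x + q x * (G x \<bullet> Y x)) \<le> M" by blast
    have dM: "\<bar>divergence X x\<bar> \<le> M" if "x \<in> \<Omega>" for x
    proof -
      have "x \<in> closure \<Omega>" using that closure_subset by blast
      with M have "norm (w x * divergence Y x + q x * (G x \<bullet> Y x)) \<le> M" by (rule bspec)
      then show ?thesis using dX[OF that] G(2)[OF that] by simp
    qed
    have i1: "integrable lborel (\<lambda>x. indicator \<Omega> x * (w x * divergence Y x))"
      by (rule integrable_closure[OF c1' refl])
    have i2: "integrable lborel (\<lambda>x. indicator \<Omega> x * (q x * (grad v x \<bullet> Y x)))"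
      by (rule integrable_closure[OF c2']) (simp add: G(2))
    have i3: "integrable lborel (\<lambda>x. indicator \<Omega> x * (\<bar>v x\<bar> * divergence Y x))"
      by (rule integrable_closure[OF _ refl]) (intro continuous_intros vc dYc)
    have i4: "integrable lborel (\<lambda>x. indicator \<Omega> x * norm (grad v x))"
      by (rule integrable_closure[of "\<lambda>x. norm (G x)"]) (auto intro!: continuous_intros G(1) simp: G(2))
    have i5: "integrable lborel (\<lambda>x. indicator \<Omega> x * \<bar>divergence Y x\<bar>)"
      by (rule integrable_closure[OF _ refl]) (intro continuous_intros dYc)
    have "dom_int (divergence X) = dom_int (\<lambda>x. w x * divergence Y x + q x * (grad v x \<bullet> Y x))"
      unfolding dom_int_def using dX by (intro Bochner_Integration.integral_cong) (auto simp: indicator_def)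
    also have "\<dots> = dom_int (\<lambda>x. w x * divergence Y x) + dom_int (\<lambda>x. q x * (grad v x \<bullet> Y x))"
      by (rule dom_int_add[OF i1 i2])
    finally have DT: "(LINT x|\<sigma>. w x * (Y x \<bullet> outward_normal \<Omega> x)) =
        dom_int (\<lambda>x. w x * divergence Y x) + dom_int (\<lambda>x. q x * (grad v x \<bullet> Y x))"
      using divergence_theorem[OF Xc X1 dM] by (simp add: dom_int_def X_def)
    have "\<bar>dom_int (\<lambda>x. q x * (grad v x \<bullet> Y x))\<bar> \<le> dom_int (\<lambda>x. B * norm (grad v x))"
    proof (rule abs_dom_int_le[OF i2])
      show "integrable lborel (\<lambda>x. indicator \<Omega> x * (B * norm (grad v x)))"
        using i4 integrable_mult_right[OF i4, of B] by (simp add: mult.left_commute)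
      fix x assume "x \<in> \<Omega>"
      then have "norm (Y x) \<le> B" using Y(2) closure_subset by blast
      then have "\<bar>grad v x \<bullet> Y x\<bar> \<le> norm (grad v x) * B"
        using Cauchy_Schwarz_ineq2[of "grad v x" "Y x"] by (meson mult_left_mono norm_ge_zero order_trans)
      then have "\<bar>q x\<bar> * \<bar>grad v x \<bullet> Y x\<bar> \<le> 1 * (norm (grad v x) * B)"
        using q1[of x] by (intro mult_mono) auto
      then show "\<bar>q x * (grad v x \<bullet> Y x)\<bar> \<le> B * norm (grad v x)" by (simp add: abs_mult mult.commute)
    qed
    then have e1: "\<bar>dom_int (\<lambda>x. q x * (grad v x \<bullet> Y x))\<bar> \<le> ?E" by (simp add: dom_int_cmult)
    have "\<bar>dom_int (\<lambda>x. w x * divergence Y x + - 1 * (\<bar>v x\<bar> * divergence Y x))\<bar> \<le> dom_int (\<lambda>x. \<epsilon> * \<bar>divergence Y x\<bar>)"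
    proof (rule abs_dom_int_le)
      show "integrable lborel (\<lambda>x. indicator \<Omega> x * (w x * divergence Y x + - 1 * (\<bar>v x\<bar> * divergence Y x)))"
        by (rule integrable_closure[OF _ refl]) (intro continuous_intros wc vc dYc)
      show "integrable lborel (\<lambda>x. indicator \<Omega> x * (\<epsilon> * \<bar>divergence Y x\<bar>))"
        by (rule integrable_closure[OF _ refl]) (intro continuous_intros dYc)
      show "\<bar>w x * divergence Y x + - 1 * (\<bar>v x\<bar> * divergence Y x)\<bar> \<le> \<epsilon> * \<bar>divergence Y x\<bar>" for x
        using mult_right_mono[OF wv[of x], of "\<bar>divergence Y x\<bar>"]
        by (simp add: abs_mult[symmetric] left_diff_distrib)
    qed
    moreover have "dom_int (\<lambda>x. w x * divergence Y x + - 1 * (\<bar>v x\<bar> * divergence Y x)) =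
        dom_int (\<lambda>x. w x * divergence Y x) + dom_int (\<lambda>x. - 1 * (\<bar>v x\<bar> * divergence Y x))"
      by (rule dom_int_add[OF i1]) (rule integrable_closure[OF _ refl], intro continuous_intros vc dYc)
    ultimately have e2: "\<bar>dom_int (\<lambda>x. w x * divergence Y x) - ?D\<bar> \<le> \<epsilon> * c2"
      unfolding dom_int_cmult by (simp add: c2_def)
    have j1: "integrable \<sigma> (\<lambda>x. w x * (Y x \<bullet> outward_normal \<Omega> x))"
      by (intro integrable_surface_continuous continuous_on_mult nu continuous_on_subset[OF wc frontier_subset_closure])
    have j2: "integrable \<sigma> (\<lambda>x. \<bar>v x\<bar> * (Y x \<bullet> outward_normal \<Omega> x))"
      by (intro integrable_surface_continuous continuous_on_mult nu continuous_on_rabs vf)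
    have j3: "integrable \<sigma> (\<lambda>x. \<bar>Y x \<bullet> outward_normal \<Omega> x\<bar>)"
      by (intro integrable_surface_continuous continuous_on_rabs nu)
    have "\<bar>LINT x|\<sigma>. w x * (Y x \<bullet> outward_normal \<Omega> x) - \<bar>v x\<bar> * (Y x \<bullet> outward_normal \<Omega> x)\<bar>
        \<le> (LINT x|\<sigma>. \<epsilon> * \<bar>Y x \<bullet> outward_normal \<Omega> x\<bar>)"
    proof (rule integral_abs_bound_integral)
      show "integrable \<sigma> (\<lambda>x. w x * (Y x \<bullet> outward_normal \<Omega> x) - \<bar>v x\<bar> * (Y x \<bullet> outward_normal \<Omega> x))"
        using j1 j2 by (rule Bochner_Integration.integrable_diff)
      show "integrable \<sigma> (\<lambda>x. \<epsilon> * \<bar>Y x \<bullet> outward_normal \<Omega> x\<bar>)" using j3 by simp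
      show "\<bar>w x * (Y x \<bullet> outward_normal \<Omega> x) - \<bar>v x\<bar> * (Y x \<bullet> outward_normal \<Omega> x)\<bar>
          \<le> \<epsilon> * \<bar>Y x \<bullet> outward_normal \<Omega> x\<bar>" for x
        using mult_right_mono[OF wv[of x], of "\<bar>Y x \<bullet> outward_normal \<Omega> x\<bar>"]
        by (simp add: abs_mult[symmetric] left_diff_distrib)
    qed
    then have "\<bar>(LINT x|\<sigma>. w x * (Y x \<bullet> outward_normal \<Omega> x)) - ?L\<bar> \<le> \<epsilon> * c1"
      using Bochner_Integration.integral_diff[OF j1 j2] by (simp add: c1_def)
    with DT e1 e2 have "\<bar>?L - ?D\<bar> \<le> \<epsilon> * c1 + \<epsilon> * c2 + ?E" by linarith
    then show ?thesis by (simp add: distrib_left)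
  qed
  have cn: "0 \<le> c1 + c2" unfolding c1_def c2_def by (intro add_nonneg_nonneg dom_int_nonneg Bochner_Integration.integral_nonneg) auto
  show ?thesis
  proof (rule field_le_epsilon)
    fix d :: real assume d: "0 < d"
    \<comment> \<open>The summand 1 keeps the denominator positive when \<open>c1 + c2\<close> is
      zero.\<close>
    define \<epsilon> where "\<epsilon> = d / (c1 + c2 + 1)"
    have "\<epsilon> > 0" using d cn by (simp add: \<epsilon>_def)
    moreover have "\<epsilon> * (c1 + c2) \<le> \<epsilon> * (c1 + c2 + 1)" using \<open>\<epsilon> > 0\<close> by simp
    moreover have "\<epsilon> * (c1 + c2 + 1) = d" using cn by (simp add: \<epsilon>_def)
    ultimately show "\<bar>?L - ?D\<bar> \<le> ?E + d" using key[of \<epsilon>] by linarith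
  qed
qed

text \<open>The identity field has constant divergence, the dimension, which is at least 1, and is
  bounded by \<open>B\<close> on the bounded domain. So \<open>abs_flux\<close> controls the L1 norm
  by boundary and gradient terms with the constant \<open>B\<close>.\<close>

lemma L1_le_boundary:
  "\<exists>K\<ge>0. \<forall>v. C1_closure \<Omega> v \<longrightarrow>
     dom_int (\<lambda>x. \<bar>v x\<bar>) \<le> K * ((LINT x|\<sigma>. \<bar>v x\<bar>) + dom_int (\<lambda>x. norm (grad v x)))"
proof -
  obtain B where B: "B > 0" "\<And>x. x \<in> closure \<Omega> \<Longrightarrow> norm x \<le> B"
    using bounded_on_closure[OF continuous_on_id] by auto
  have Y: "C1_field UNIV (\<lambda>x::'a. x)"
    unfolding C1_field_def by (intro ballI Ck_on_inner_const)
  have g: "grad (\<lambda>y::'a. y \<bullet> b) x = b" for b x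
    by (rule has_derivative_imp_grad) (auto intro!: derivative_eq_intros simp: inner_commute)
  have dv: "divergence (\<lambda>x::'a. x) = (\<lambda>x. real DIM('a))"
    by (rule ext) (simp add: divergence_def g)
  have "dom_int (\<lambda>x. \<bar>v x\<bar>) \<le> B * ((LINT x|\<sigma>. \<bar>v x\<bar>) + dom_int (\<lambda>x. norm (grad v x)))"
    if v: "C1_closure \<Omega> v" for v
  proof -
    have vc: "continuous_on (closure \<Omega>) v" using C1_closureE[OF v] by metis
    have vf: "continuous_on (frontier \<Omega>) v" by (rule continuous_on_subset[OF vc frontier_subset_closure])
    have "dom_int (\<lambda>x. \<bar>v x\<bar> * real DIM('a)) \<le> (LINT x|\<sigma>. \<bar>v x\<bar> * (x \<bullet> outward_normal \<Omega> x)) + B * dom_int (\<lambda>x. norm (grad v x))"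
      using abs_flux[OF v Y B(2) continuous_on_id] unfolding dv by linarith
    moreover have "(LINT x|\<sigma>. \<bar>v x\<bar> * (x \<bullet> outward_normal \<Omega> x)) \<le> (LINT x|\<sigma>. B * \<bar>v x\<bar>)"
    proof (rule integral_mono)
      show "integrable \<sigma> (\<lambda>x. \<bar>v x\<bar> * (x \<bullet> outward_normal \<Omega> x))"
        by (intro integrable_surface_continuous continuous_on_mult continuous_on_rabs vf continuous_surface_flux continuous_on_id)
      show "integrable \<sigma> (\<lambda>x. B * \<bar>v x\<bar>)"
        by (intro integrable_surface_continuous continuous_intros vf)
      fix x assume "x \<in> space \<sigma>"
      then have x: "x \<in> frontier \<Omega>" by (simp add: space_surface_measure)
      then obtain r e \<gamma> where bg: "boundary_graph \<Omega> x r e \<gamma>" using dom unfolding smooth_bounded_domain_def by meson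
      interpret chart \<Omega> x r e \<gamma> by (rule chartI[OF bg])
      have "norm (outward_normal \<Omega> x) = 1"
        using outward_normal_eq[of x] frontier_ball[of x] x r_pos norm_normal by simp
      then have "x \<bullet> outward_normal \<Omega> x \<le> norm x" using norm_cauchy_schwarz[of x "outward_normal \<Omega> x"] by simp
      also have "\<dots> \<le> B" using B(2) x frontier_subset_closure by blast
      finally have "(x \<bullet> outward_normal \<Omega> x) * \<bar>v x\<bar> \<le> B * \<bar>v x\<bar>" by (rule mult_right_mono) simp
      then show "\<bar>v x\<bar> * (x \<bullet> outward_normal \<Omega> x) \<le> B * \<bar>v x\<bar>" by (simp only: mult.commute)
    qed
    moreover have "dom_int (\<lambda>x. \<bar>v x\<bar>) \<le> dom_int (\<lambda>x. \<bar>v x\<bar> * real DIM('a))"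
    proof (rule dom_int_mono)
      show "\<bar>v x\<bar> \<le> \<bar>v x\<bar> * real DIM('a)" for x
        using mult_left_mono[of 1 "real DIM('a)" "\<bar>v x\<bar>"] DIM_positive[where 'a='a] by simp
    qed (rule integrable_closure[OF _ refl], intro continuous_intros vc)+
    ultimately show ?thesis by (simp add: distrib_left)
  qed
  then show ?thesis using B(1) by (intro exI[of _ B]) auto
qed

text \<open>The vector field \<open>- \<Sum> \<beta>\<^sub>i e\<^sub>i\<close> is uniformly transversal to the boundary.\<close>

lemma L1_trace:
  "\<exists>K\<ge>0. \<forall>v. C1_closure \<Omega> v \<longrightarrow>
     (LINT x|\<sigma>. \<bar>v x\<bar>) \<le> K * (dom_int (\<lambda>x. \<bar>v x\<bar>) + dom_int (\<lambda>x. norm (grad v x)))"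
\<comment> \<open>The constant below is a minimum over the boundary, which exists only on a nonempty
  set.\<close>
proof (cases "frontier \<Omega> = {}")
  case True
  then have "(LINT x|\<sigma>. \<bar>v x\<bar>) = (LINT x|\<sigma>. 0)" for v
    by (intro Bochner_Integration.integral_cong) (auto simp: space_surface_measure)
  then have "(LINT x|\<sigma>. \<bar>v x\<bar>) = 0" for v by (metis Bochner_Integration.integral_zero)
  then show ?thesis by (metis mult_zero_left order_refl)
next
  case False
  obtain n :: nat and P R E G where bg: "\<And>i. i < n \<Longrightarrow> boundary_graph \<Omega> (P i) (R i) (E i) (G i)"
    and cov: "frontier \<Omega> \<subseteq> (\<Union>i<n. ball (P i) (R i / 2))"
    using finite_chart_cover by blast
  \<comment> \<open>Each chart direction \<open>E i\<close> points into \<Omega> at the boundary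
    points of its ball, so \<open>- E i\<close> has positive inner product with the outward normal
    there; elsewhere its bump vanishes. At every boundary point at least one summand is
    active.\<close>
  define Y where "Y x = (\<Sum>i<n. ball_bump (P i) (R i) x *\<^sub>R (- E i))" for x
  have bC: "Ck_on 1 UNIV (ball_bump p r)" for p r by (rule smooth_onD[OF smooth_on_ball_bump])
  have Y: "C1_field UNIV Y"
    unfolding C1_field_def Y_def inner_sum_left inner_scaleR_left
    by (intro ballI Ck_on_sum Ck_on_mult bC Ck_on_const) auto
  have Yc: "continuous_on S Y" for S
    unfolding Y_def using Ck_on_imp_continuous_on[OF Ck_on_UNIV_subset[OF bC]] by (intro continuous_intros)
  obtain B where B: "B > 0" "\<And>x. x \<in> closure \<Omega> \<Longrightarrow> norm (Y x) \<le> B" using bounded_on_closure[OF Yc] by auto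
  have dYc: "continuous_on S (divergence Y)" for S
    using continuous_on_divergence[OF Y] by (rule continuous_on_subset) simp
  obtain D where D: "D > 0" "\<And>x. x \<in> closure \<Omega> \<Longrightarrow> \<bar>divergence Y x\<bar> \<le> D" using bounded_on_closure[OF dYc] by auto
  have nu: "continuous_on (frontier \<Omega>) (\<lambda>x. Y x \<bullet> outward_normal \<Omega> x)"
    by (rule continuous_surface_flux[OF Yc])
  have pos: "0 < Y x \<bullet> outward_normal \<Omega> x" if x: "x \<in> frontier \<Omega>" for x
  proof -
    have t: "0 \<le> ball_bump (P i) (R i) x * (- E i \<bullet> outward_normal \<Omega> x)"
      "x \<in> ball (P i) (R i) \<Longrightarrow> 0 < ball_bump (P i) (R i) x * (- E i \<bullet> outward_normal \<Omega> x)" if i: "i < n" for i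
    proof -
      interpret chart \<Omega> "P i" "R i" "E i" "G i" by (rule chartI[OF bg[OF i]])
      show pp: "0 < ball_bump (P i) (R i) x * (- E i \<bullet> outward_normal \<Omega> x)" if b: "x \<in> ball (P i) (R i)"
      proof (rule mult_pos_pos)
        show "0 < ball_bump (P i) (R i) x" using ball_bump_pos_iff[OF r_pos] b by blast
        have "outward_normal \<Omega> x = normal x" using outward_normal_eq[OF b] frontier_ball[OF b] x by blast
        then show "0 < - E i \<bullet> outward_normal \<Omega> x"
          using normal_inner_e[of x] sqrt_pos[of x] by (simp add: inner_commute)
      qed
      show "0 \<le> ball_bump (P i) (R i) x * (- E i \<bullet> outward_normal \<Omega> x)"
      proof (cases "x \<in> ball (P i) (R i)")
        case True then show ?thesis using pp by (simp add: less_imp_le)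
      next
        case False then show ?thesis using ball_bump_eq_0[OF r_pos False] by simp
      qed
    qed
    obtain i where i: "i < n" "x \<in> ball (P i) (R i / 2)" using cov x by blast
    then have "x \<in> ball (P i) (R i)" using bg[OF i(1)] by (simp add: boundary_graph_def)
    then have "0 < (\<Sum>i<n. ball_bump (P i) (R i) x * (- E i \<bullet> outward_normal \<Omega> x))"
      using i(1) t by (intro sum_pos2[of _ i]) auto
    then show ?thesis by (simp add: Y_def inner_sum_left)
  qed
  obtain x0 where x0: "x0 \<in> frontier \<Omega>" "\<And>x. x \<in> frontier \<Omega> \<Longrightarrow> Y x0 \<bullet> outward_normal \<Omega> x0 \<le> Y x \<bullet> outward_normal \<Omega> x"
    using continuous_attains_inf[OF compact_frontier_dom False nu] by blast
  define c where "c = Y x0 \<bullet> outward_normal \<Omega> x0"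
  have c: "c > 0" "\<And>x. x \<in> frontier \<Omega> \<Longrightarrow> c \<le> Y x \<bullet> outward_normal \<Omega> x"
    using pos[OF x0(1)] x0(2) by (auto simp: c_def)
  \<comment> \<open>\<open>D\<close> bounds the divergence term, \<open>B\<close> the gradient term,
    and \<open>c\<close> is the least transversality of \<open>Y\<close> on the boundary.\<close>
  define K where "K = (B + D) / c"
  have "(LINT x|\<sigma>. \<bar>v x\<bar>) \<le> K * (dom_int (\<lambda>x. \<bar>v x\<bar>) + dom_int (\<lambda>x. norm (grad v x)))"
    if v: "C1_closure \<Omega> v" for v
  proof -
    have vc: "continuous_on (closure \<Omega>) v" using C1_closureE[OF v] by metis
    have vf: "continuous_on (frontier \<Omega>) v" by (rule continuous_on_subset[OF vc frontier_subset_closure])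
    have "(LINT x|\<sigma>. c * \<bar>v x\<bar>) \<le> (LINT x|\<sigma>. \<bar>v x\<bar> * (Y x \<bullet> outward_normal \<Omega> x))"
    proof (rule integral_mono)
      show "integrable \<sigma> (\<lambda>x. \<bar>v x\<bar> * (Y x \<bullet> outward_normal \<Omega> x))"
        by (intro integrable_surface_continuous continuous_on_mult continuous_on_rabs vf nu)
      show "integrable \<sigma> (\<lambda>x. c * \<bar>v x\<bar>)"
        by (intro integrable_surface_continuous continuous_intros vf)
      fix x assume "x \<in> space \<sigma>"
      then show "c * \<bar>v x\<bar> \<le> \<bar>v x\<bar> * (Y x \<bullet> outward_normal \<Omega> x)"
        using mult_left_mono[OF c(2)[of x], of "\<bar>v x\<bar>"] by (simp add: space_surface_measure mult.commute)
    qed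
    also have "\<dots> \<le> dom_int (\<lambda>x. \<bar>v x\<bar> * divergence Y x) + B * dom_int (\<lambda>x. norm (grad v x))"
      using abs_flux[OF v Y B(2) Yc] by linarith
    also have "dom_int (\<lambda>x. \<bar>v x\<bar> * divergence Y x) \<le> dom_int (\<lambda>x. D * \<bar>v x\<bar>)"
    proof (rule dom_int_mono)
      show "\<bar>v x\<bar> * divergence Y x \<le> D * \<bar>v x\<bar>" if "x \<in> \<Omega>" for x
        using D(2)[of x] closure_subset that mult_left_mono[of "divergence Y x" D "\<bar>v x\<bar>"]
        by (auto simp: mult.commute abs_le_iff)
    qed (rule integrable_closure[OF _ refl], intro continuous_intros vc dYc)+
    finally have "c * (LINT x|\<sigma>. \<bar>v x\<bar>) \<le> D * dom_int (\<lambda>x. \<bar>v x\<bar>) + B * dom_int (\<lambda>x. norm (grad v x))"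
      by (simp add: dom_int_cmult)
    also have "\<dots> \<le> (B + D) * (dom_int (\<lambda>x. \<bar>v x\<bar>) + dom_int (\<lambda>x. norm (grad v x)))"
      using B(1) D(1) dom_int_nonneg[of "\<lambda>x. \<bar>v x\<bar>"] dom_int_nonneg[of "\<lambda>x. norm (grad v x)"]
      by (simp add: algebra_simps)
    finally show ?thesis using c(1) by (simp add: K_def field_simps)
  qed
  moreover have "0 \<le> K" using B(1) D(1) c(1) by (simp add: K_def)
  ultimately show ?thesis by blast
qed

end

section \<open>A Poincare inequality with boundary term\<close>

lemma nn_integral_lborel_shift:
  fixes f :: "'a::euclidean_space \<Rightarrow> ennreal"
  assumes [measurable]: "f \<in> borel_measurable borel"
  shows "(\<integral>\<^sup>+x. f (x + a) \<partial>lborel) = (\<integral>\<^sup>+x. f x \<partial>lborel)"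
proof -
  have "(\<integral>\<^sup>+x. f x \<partial>lborel) = (\<integral>\<^sup>+x. f x \<partial>distr lborel borel ((+) a))"
    by (simp add: lborel_distr_plus)
  also have "\<dots> = (\<integral>\<^sup>+x. f (a + x) \<partial>lborel)"
    by (subst nn_integral_distr) auto
  finally show ?thesis by (simp add: add.commute)
qed

text \<open>The increment is the integral of \<open>\<psi>\<close> over an interval of length 1;
  Cauchy-Schwarz against the constant 1 gives the bound.\<close>

lemma square_increment_le:
  fixes \<phi> \<psi> :: "real \<Rightarrow> real"
  assumes D: "\<And>s. 0 \<le> s \<Longrightarrow> s \<le> 1 \<Longrightarrow> (\<phi> has_real_derivative \<psi> s) (at s)"
    and c: "\<And>s. 0 \<le> s \<Longrightarrow> s \<le> 1 \<Longrightarrow> isCont \<psi> s"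
  shows "(\<phi> 1 - \<phi> 0)\<^sup>2 \<le> (LBINT s. indicator {0..1} s * (\<psi> s)\<^sup>2)"
proof -
  have F: "(LBINT s. \<psi> s * indicator {0..1} s) = \<phi> 1 - \<phi> 0"
    by (rule integral_FTC_Icc_real) (use D c in auto)
  have cont: "continuous_on {0..1} \<psi>" using c by (auto intro: continuous_at_imp_continuous_on)
  have i1: "integrable lborel (\<lambda>s. indicator {0..1} s * \<psi> s)"
    and i2: "integrable lborel (\<lambda>s. indicator {0..1} s * (\<psi> s)\<^sup>2)"
    using borel_integrable_atLeastAtMost'[OF cont] borel_integrable_atLeastAtMost'[OF continuous_on_power[OF cont]]
    by (simp_all add: set_integrable_def)
  let ?I = "indicator {0..1} :: real \<Rightarrow> real"
  have sq: "(?I s * \<psi> s)\<^sup>2 = ?I s * (\<psi> s)\<^sup>2" "(?I s)\<^sup>2 = ?I s" "(?I s * \<psi> s) * ?I s = \<psi> s * ?I s" for s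
    by (auto simp: indicator_def)
  have "(LBINT s. (?I s * \<psi> s) * ?I s)\<^sup>2 \<le> (LBINT s. (?I s * \<psi> s)\<^sup>2) * (LBINT s. (?I s)\<^sup>2)"
    by (rule integral_Cauchy_Schwarz) (use i1 i2 in \<open>simp_all add: sq mult.commute[of "\<psi> _"]\<close>)
  then show ?thesis by (simp add: sq F)
qed

section \<open>Interior cones and the interior estimate\<close>

context smooth_domain
begin

text \<open>Uses a^2 \<le> 2 |a| |b| + (b - a)^2 with a and b the values of \<open>v\<close> at the
  two ends of the segment. The first term is kept as a product, because integrating it over both end
  points yields the square of the L1 norm and no further L2 norm. The increment is estimated along
  the segment.\<close>

lemma cone_pointwise:
  assumes v: "Ck_on 1 \<Omega> v" and seg: "\<And>s. 0 \<le> s \<Longrightarrow> s \<le> 1 \<Longrightarrow> x + s *\<^sub>R h \<in> \<Omega>" and M: "norm h \<le> M"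
  shows "ennreal ((v x)\<^sup>2) \<le> 2 * ennreal \<bar>v x\<bar> * ennreal \<bar>v (x + h)\<bar> +
    ennreal (M\<^sup>2) * (\<integral>\<^sup>+s. indicator {0..1} s * ennreal ((norm (grad v (x + s *\<^sub>R h)))\<^sup>2) \<partial>lborel)"
proof -
  define g where "g s = norm (grad v (x + s *\<^sub>R h))" for s
  have gc: "isCont (grad v) (x + s *\<^sub>R h)" if "0 \<le> s" "s \<le> 1" for s
    using v seg[OF that] open_dom unfolding Ck_on_1_iff by (simp add: continuous_on_eq_continuous_at)
  have gc': "isCont (\<lambda>s. grad v (x + s *\<^sub>R h)) s" if "0 \<le> s" "s \<le> 1" for s
    using isCont_o2[where f="\<lambda>s. x + s *\<^sub>R h" and g="grad v", OF _ gc[OF that]]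
    by (simp add: continuous_intros)
  have "(v (x + 1 *\<^sub>R h) - v (x + 0 *\<^sub>R h))\<^sup>2 \<le> (LBINT s. indicator {0..1} s * (grad v (x + s *\<^sub>R h) \<bullet> h)\<^sup>2)"
  proof (rule square_increment_le[of "\<lambda>s. v (x + s *\<^sub>R h)" "\<lambda>s. grad v (x + s *\<^sub>R h) \<bullet> h"])
    fix s :: real assume s: "0 \<le> s" "s \<le> 1"
    show "((\<lambda>s. v (x + s *\<^sub>R h)) has_real_derivative grad v (x + s *\<^sub>R h) \<bullet> h) (at s)"
      by (rule has_real_derivative_along_line[OF Ck_on_1_differentiable[OF v seg[OF s]]])
    show "isCont (\<lambda>s. grad v (x + s *\<^sub>R h) \<bullet> h) s"
      using gc'[OF s] by (intro continuous_intros)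
  qed
  also have "\<dots> \<le> (LBINT s. M\<^sup>2 * (indicator {0..1} s * (g s)\<^sup>2))"
  proof (rule integral_mono)
    have c: "continuous_on {0..1} (\<lambda>s. grad v (x + s *\<^sub>R h))"
      using gc' by (auto intro: continuous_at_imp_continuous_on)
    show "integrable lborel (\<lambda>s. indicator {0..1} s * (grad v (x + s *\<^sub>R h) \<bullet> h)\<^sup>2)"
      using borel_integrable_atLeastAtMost'[of 0 1 "\<lambda>s. (grad v (x + s *\<^sub>R h) \<bullet> h)\<^sup>2"] c
      by (simp add: set_integrable_def continuous_intros)
    have "integrable lborel (\<lambda>s. indicator {0..1} s * (g s)\<^sup>2)"
      using borel_integrable_atLeastAtMost'[of 0 1 "\<lambda>s. (g s)\<^sup>2"] c
      by (simp add: set_integrable_def continuous_intros g_def)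
    then show gi: "integrable lborel (\<lambda>s. M\<^sup>2 * (indicator {0..1} s * (g s)\<^sup>2))" by simp
    fix s :: real
    have "\<bar>grad v (x + s *\<^sub>R h) \<bullet> h\<bar> \<le> g s * norm h" unfolding g_def by (rule Cauchy_Schwarz_ineq2)
    also have "\<dots> \<le> g s * M" using M by (intro mult_left_mono) (simp_all add: g_def)
    finally have "(grad v (x + s *\<^sub>R h) \<bullet> h)\<^sup>2 \<le> (g s * M)\<^sup>2"
      by (metis abs_ge_zero power2_abs power_mono)
    then show "indicator {0..1} s * (grad v (x + s *\<^sub>R h) \<bullet> h)\<^sup>2 \<le> M\<^sup>2 * (indicator {0..1} s * (g s)\<^sup>2)"
      by (simp add: indicator_def power_mult_distrib mult.commute)
  qed
  also have "\<dots> = M\<^sup>2 * (LBINT s. indicator {0..1} s * (g s)\<^sup>2)" by simp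
  finally have d: "(v (x + h) - v x)\<^sup>2 \<le> M\<^sup>2 * (LBINT s. indicator {0..1} s * (g s)\<^sup>2)" by simp
  have c: "continuous_on {0..1} (\<lambda>s. grad v (x + s *\<^sub>R h))"
    using gc' by (auto intro: continuous_at_imp_continuous_on)
  have gi: "integrable lborel (\<lambda>s. indicator {0..1} s * (g s)\<^sup>2)"
    using borel_integrable_atLeastAtMost'[of 0 1 "\<lambda>s. (g s)\<^sup>2"] c
    by (simp add: set_integrable_def continuous_intros g_def)
  have "0 \<le> (v (x + h))\<^sup>2 + 2 * (\<bar>v x\<bar> * \<bar>v (x + h)\<bar> - v x * v (x + h))"
    using abs_ge_self[of "v x * v (x + h)"] by (simp add: abs_mult)
  then have "(v x)\<^sup>2 \<le> 2 * \<bar>v x\<bar> * \<bar>v (x + h)\<bar> + (v (x + h) - v x)\<^sup>2"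
    by (simp add: power2_eq_square algebra_simps)
  with d have "(v x)\<^sup>2 \<le> 2 * \<bar>v x\<bar> * \<bar>v (x + h)\<bar> + M\<^sup>2 * (LBINT s. indicator {0..1} s * (g s)\<^sup>2)"
    by linarith
  then have "ennreal ((v x)\<^sup>2) \<le> ennreal (2 * \<bar>v x\<bar> * \<bar>v (x + h)\<bar> + M\<^sup>2 * (LBINT s. indicator {0..1} s * (g s)\<^sup>2))"
    by (rule ennreal_leI)
  also have "\<dots> = 2 * ennreal \<bar>v x\<bar> * ennreal \<bar>v (x + h)\<bar> + ennreal (M\<^sup>2) * ennreal (LBINT s. indicator {0..1} s * (g s)\<^sup>2)"
  proof -
    have "0 \<le> (LBINT s. indicator {0..1} s * (g s)\<^sup>2)"
      by (intro Bochner_Integration.integral_nonneg) simp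
    then show ?thesis by (simp add: ennreal_mult)
  qed
  also have "ennreal (LBINT s. indicator {0..1} s * (g s)\<^sup>2) = (\<integral>\<^sup>+s. ennreal (indicator {0..1} s * (g s)\<^sup>2) \<partial>lborel)"
    by (rule nn_integral_eq_integral[symmetric, OF gi]) simp
  also have "\<dots> = (\<integral>\<^sup>+s. indicator {0..1} s * ennreal ((norm (grad v (x + s *\<^sub>R h)))\<^sup>2) \<partial>lborel)"
    by (intro nn_integral_cong) (auto simp: g_def indicator_def)
  finally show ?thesis .
qed

text \<open>Integrates \<open>cone_pointwise\<close> over \<open>x\<close> in \<open>P\<close> and
  \<open>h\<close> in \<open>H\<close>; averaging over a set of directions of positive measure is
  what turns the end point value into an L1 norm. Working with nonnegative integrals makes Tonelli
  available throughout.\<close>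

lemma cone_estimate:
  assumes v: "C1_closure \<Omega> v" and P: "P \<in> sets borel" "P \<subseteq> \<Omega>" and H: "H \<in> sets borel" "emeasure lborel H < \<infinity>"
    and M: "\<And>h. h \<in> H \<Longrightarrow> norm h \<le> M"
    and cone: "\<And>x h s. x \<in> P \<Longrightarrow> h \<in> H \<Longrightarrow> 0 \<le> s \<Longrightarrow> s \<le> 1 \<Longrightarrow> x + s *\<^sub>R h \<in> \<Omega>"
  shows "measure lborel H * (LINT x|lborel. indicator P x * (v x)\<^sup>2) \<le>
    2 * (dom_int (\<lambda>x. \<bar>v x\<bar>))\<^sup>2 + M\<^sup>2 * (measure lborel H * dom_int (\<lambda>x. (norm (grad v x))\<^sup>2))"
proof -
  note [measurable] = P(1) H(1)
  obtain G where G: "continuous_on (closure \<Omega>) G" "\<And>x. x \<in> \<Omega> \<Longrightarrow> G x = grad v x"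
    and v1: "Ck_on 1 \<Omega> v" and vc: "continuous_on (closure \<Omega>) v" using C1_closureE[OF v] by metis
  define V where "V x = ennreal (indicator \<Omega> x * \<bar>v x\<bar>)" for x
  define Q where "Q x = ennreal (indicator \<Omega> x * (norm (grad v x))\<^sup>2)" for x
  define W where "W x = ennreal (indicator P x * (v x)\<^sup>2)" for x
  have iV: "integrable lborel (\<lambda>x. indicator \<Omega> x * \<bar>v x\<bar>)"
    by (rule integrable_closure[OF _ refl]) (intro continuous_intros vc)
  have iQ: "integrable lborel (\<lambda>x. indicator \<Omega> x * (norm (grad v x))\<^sup>2)"
    by (rule integrable_closure[of "\<lambda>x. (norm (G x))\<^sup>2"]) (auto intro!: continuous_intros G(1) simp: G(2))
  have i2: "integrable lborel (\<lambda>x. indicator \<Omega> x * (v x)\<^sup>2)"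
    by (rule integrable_closure[OF _ refl]) (intro continuous_intros vc)
  have "integrable lborel (\<lambda>x. indicator P x *\<^sub>R (indicator \<Omega> x * (v x)\<^sup>2))"
    by (rule integrable_mult_indicator[OF _ i2]) simp
  moreover have "indicator P x *\<^sub>R (indicator \<Omega> x * (v x)\<^sup>2) = indicator P x * (v x)\<^sup>2" for x
    using P(2) by (auto simp: indicator_def)
  ultimately have iW: "integrable lborel (\<lambda>x. indicator P x * (v x)\<^sup>2)" by (simp only:)
  have [measurable]: "V \<in> borel_measurable borel" "Q \<in> borel_measurable borel" "W \<in> borel_measurable borel"
    unfolding V_def Q_def W_def using iV iQ iW by (auto dest!: borel_measurable_integrable)
  define J where "J x h = (\<integral>\<^sup>+s. indicator {0..1::real} s * Q (x + s *\<^sub>R h) \<partial>lborel)" for x h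
  have Jm: "(\<lambda>(x, h). J x h) \<in> borel_measurable (lborel \<Otimes>\<^sub>M lborel)" unfolding J_def by measurable
  \<comment> \<open>\<open>V\<close> and \<open>Q\<close> vanish outside \<Omega>, so the later
    integrals run over the whole space and translations by \<open>h\<close> and
    \<open>s *\<^sub>R h\<close> can be undone. The indicator of \<open>H\<close> is dropped in the
    first term, where the integral over all \<open>h\<close> is finite, and kept in the second,
    where it produces the measure of \<open>H\<close>.\<close>
  have pt: "indicator H h * W x \<le> 2 * V x * V (x + h) + ennreal (M\<^sup>2) * (indicator H h * J x h)" for x h
  proof (cases "x \<in> P \<and> h \<in> H")
    case True
    then have xh: "x \<in> P" "h \<in> H" by auto
    have \<Omega>: "x \<in> \<Omega>" "x + h \<in> \<Omega>" using P(2) xh cone[OF xh, of 1] by auto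
    have "(\<integral>\<^sup>+s. indicator {0..1} s * ennreal ((norm (grad v (x + s *\<^sub>R h)))\<^sup>2) \<partial>lborel) = J x h"
      unfolding J_def Q_def using cone[OF xh] by (intro nn_integral_cong) (auto simp: indicator_def)
    then show ?thesis
      using cone_pointwise[OF v1 cone[OF xh] M[OF xh(2)]] xh \<Omega> by (simp add: W_def V_def)
  qed (auto simp: W_def)
  have "emeasure lborel H * (\<integral>\<^sup>+x. W x \<partial>lborel) = (\<integral>\<^sup>+x. \<integral>\<^sup>+h. indicator H h * W x \<partial>lborel \<partial>lborel)"
    by (simp add: nn_integral_cmult nn_integral_multc)
  also have "\<dots> \<le> (\<integral>\<^sup>+x. \<integral>\<^sup>+h. 2 * V x * V (x + h) + ennreal (M\<^sup>2) * (indicator H h * J x h) \<partial>lborel \<partial>lborel)"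
    by (intro nn_integral_mono pt)
  also have "\<dots> = (\<integral>\<^sup>+x. 2 * V x * (\<integral>\<^sup>+h. V (x + h) \<partial>lborel) + ennreal (M\<^sup>2) * (\<integral>\<^sup>+h. indicator H h * J x h \<partial>lborel) \<partial>lborel)"
    using Jm by (intro nn_integral_cong) (simp add: nn_integral_add nn_integral_cmult)
  also have "\<dots> = (\<integral>\<^sup>+x. 2 * V x * (\<integral>\<^sup>+h. V h \<partial>lborel) \<partial>lborel) +
      ennreal (M\<^sup>2) * (\<integral>\<^sup>+x. \<integral>\<^sup>+h. indicator H h * J x h \<partial>lborel \<partial>lborel)"
  proof -
    have "(\<integral>\<^sup>+h. V (x + h) \<partial>lborel) = (\<integral>\<^sup>+h. V h \<partial>lborel)" for x
      using nn_integral_lborel_shift[of V x] by (simp add: add.commute)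
    then show ?thesis using Jm by (simp add: nn_integral_add nn_integral_cmult)
  qed
  also have "(\<integral>\<^sup>+x. 2 * V x * (\<integral>\<^sup>+h. V h \<partial>lborel) \<partial>lborel) = 2 * (\<integral>\<^sup>+x. V x \<partial>lborel) * (\<integral>\<^sup>+h. V h \<partial>lborel)"
    by (simp add: nn_integral_multc nn_integral_cmult)
  also have "(\<integral>\<^sup>+x. \<integral>\<^sup>+h. indicator H h * J x h \<partial>lborel \<partial>lborel) = (\<integral>\<^sup>+h. indicator H h * (\<integral>\<^sup>+x. J x h \<partial>lborel) \<partial>lborel)"
  proof -
    have "(\<integral>\<^sup>+x. \<integral>\<^sup>+h. indicator H h * J x h \<partial>lborel \<partial>lborel) = (\<integral>\<^sup>+h. \<integral>\<^sup>+x. indicator H h * J x h \<partial>lborel \<partial>lborel)"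
      by (intro lborel_pair.Fubini'[symmetric]) (unfold J_def, measurable)
    also have "\<dots> = (\<integral>\<^sup>+h. indicator H h * (\<integral>\<^sup>+x. J x h \<partial>lborel) \<partial>lborel)"
      by (intro nn_integral_cong nn_integral_cmult) (unfold J_def, measurable)
    finally show ?thesis .
  qed
  also have "\<dots> = (\<integral>\<^sup>+h. indicator H h * (\<integral>\<^sup>+x. Q x \<partial>lborel) \<partial>lborel)"
  proof -
    have "(\<integral>\<^sup>+x. J x h \<partial>lborel) = (\<integral>\<^sup>+x. Q x \<partial>lborel)" for h
    proof -
      have "(\<integral>\<^sup>+x. J x h \<partial>lborel) = (\<integral>\<^sup>+s. \<integral>\<^sup>+x. indicator {0..1::real} s * Q (x + s *\<^sub>R h) \<partial>lborel \<partial>lborel)"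
        unfolding J_def by (intro lborel_pair.Fubini'[symmetric]) measurable
      also have "\<dots> = (\<integral>\<^sup>+s. indicator {0..1::real} s * (\<integral>\<^sup>+x. Q x \<partial>lborel) \<partial>lborel)"
        by (simp add: nn_integral_cmult nn_integral_lborel_shift)
      also have "\<dots> = (\<integral>\<^sup>+x. Q x \<partial>lborel)" by (simp add: nn_integral_multc)
      finally show ?thesis .
    qed
    then show ?thesis by simp
  qed
  also have "\<dots> = emeasure lborel H * (\<integral>\<^sup>+x. Q x \<partial>lborel)" by (simp add: nn_integral_multc)
  finally have fin: "emeasure lborel H * (\<integral>\<^sup>+x. W x \<partial>lborel) \<le>
      2 * (\<integral>\<^sup>+x. V x \<partial>lborel) * (\<integral>\<^sup>+x. V x \<partial>lborel) + ennreal (M\<^sup>2) * (emeasure lborel H * (\<integral>\<^sup>+x. Q x \<partial>lborel))" .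
  have eV: "(\<integral>\<^sup>+x. V x \<partial>lborel) = ennreal (dom_int (\<lambda>x. \<bar>v x\<bar>))"
    unfolding V_def dom_int_def by (rule nn_integral_eq_integral[OF iV]) simp
  have eQ: "(\<integral>\<^sup>+x. Q x \<partial>lborel) = ennreal (dom_int (\<lambda>x. (norm (grad v x))\<^sup>2))"
    unfolding Q_def dom_int_def by (rule nn_integral_eq_integral[OF iQ]) simp
  have eW: "(\<integral>\<^sup>+x. W x \<partial>lborel) = ennreal (LINT x|lborel. indicator P x * (v x)\<^sup>2)"
    unfolding W_def by (rule nn_integral_eq_integral[OF iW]) simp
  have eH: "emeasure lborel H = ennreal (measure lborel H)"
    using H(2) by (simp add: emeasure_eq_ennreal_measure less_top)
  have n: "0 \<le> dom_int (\<lambda>x. \<bar>v x\<bar>)" "0 \<le> dom_int (\<lambda>x. (norm (grad v x))\<^sup>2)"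
    by (intro dom_int_nonneg; simp)+
  have "ennreal (measure lborel H * (LINT x|lborel. indicator P x * (v x)\<^sup>2)) \<le>
      ennreal (2 * (dom_int (\<lambda>x. \<bar>v x\<bar>))\<^sup>2 + M\<^sup>2 * (measure lborel H * dom_int (\<lambda>x. (norm (grad v x))\<^sup>2)))"
  proof -
    have R: "ennreal (2 * a\<^sup>2 + b * (c * d)) = 2 * ennreal a * ennreal a + ennreal b * (ennreal c * ennreal d)"
      if "0 \<le> a" "0 \<le> b" "0 \<le> c" "0 \<le> d" for a b c d :: real
      using that by (simp add: ennreal_mult power2_eq_square mult.assoc)
    have "ennreal (measure lborel H * (LINT x|lborel. indicator P x * (v x)\<^sup>2)) =
        ennreal (measure lborel H) * ennreal (LINT x|lborel. indicator P x * (v x)\<^sup>2)"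
      by (rule ennreal_mult') simp
    also have "\<dots> \<le> 2 * ennreal (dom_int (\<lambda>x. \<bar>v x\<bar>)) * ennreal (dom_int (\<lambda>x. \<bar>v x\<bar>)) +
        ennreal (M\<^sup>2) * (ennreal (measure lborel H) * ennreal (dom_int (\<lambda>x. (norm (grad v x))\<^sup>2)))"
      using fin unfolding eV eQ eW eH .
    also have "\<dots> = ennreal (2 * (dom_int (\<lambda>x. \<bar>v x\<bar>))\<^sup>2 +
        M\<^sup>2 * (measure lborel H * dom_int (\<lambda>x. (norm (grad v x))\<^sup>2)))"
      by (rule R[symmetric]) (use n in simp_all)
    finally show ?thesis .
  qed
  then show ?thesis by (subst (asm) ennreal_le_iff) (use n in auto)
qed

text \<open>At an interior point a small ball of directions around 0 works. At a boundary point the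
  directions lie near a multiple of \<open>e\<close> and climb faster than the graph, whose slope is
  bounded by a Lipschitz constant.\<close>

lemma local_cone:
  assumes p: "p \<in> closure \<Omega>"
  shows "\<exists>\<rho> c \<delta>. 0 < \<rho> \<and> 0 < \<delta> \<and>
    (\<forall>x\<in>\<Omega> \<inter> ball p \<rho>. \<forall>h\<in>ball c \<delta>. \<forall>s. 0 \<le> s \<longrightarrow> s \<le> 1 \<longrightarrow> x + s *\<^sub>R h \<in> \<Omega>)"
proof (cases "p \<in> \<Omega>")
  case True
  then obtain r where r: "r > 0" "ball p r \<subseteq> \<Omega>" using open_dom open_contains_ball by blast
  have "x + s *\<^sub>R h \<in> \<Omega>" if "x \<in> ball p (r / 2)" "h \<in> ball 0 (r / 2)" "0 \<le> s" "s \<le> 1" for x h and s :: real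
  proof -
    have "norm (s *\<^sub>R h) \<le> norm h" using that by (simp add: mult_left_le_one_le)
    moreover have "dist p (x + s *\<^sub>R h) \<le> dist p x + norm (s *\<^sub>R h)"
      using dist_triangle[of p "x + s *\<^sub>R h" x] by (simp add: dist_norm)
    ultimately have "x + s *\<^sub>R h \<in> ball p r" using that by simp
    then show ?thesis using r(2) by blast
  qed
  then show ?thesis using r(1) by (intro exI[of _ "r / 2"] exI[of _ 0]) auto
next
  case False
  then have "p \<in> frontier \<Omega>" using p open_dom by (simp add: frontier_def interior_open)
  then obtain r e \<gamma> where bg: "boundary_graph \<Omega> p r e \<gamma>" using dom unfolding smooth_bounded_domain_def by meson
  interpret chart \<Omega> p r e \<gamma> by (rule chartI[OF bg])
  have "bounded (grad \<gamma> ` cball p r)" by (intro compact_imp_bounded compact_continuous_image cont_grad_\<gamma>) auto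
  then obtain L where L: "L > 0" "\<forall>x\<in>cball p r. norm (grad \<gamma> x) \<le> L" unfolding bounded_pos by auto
  have lip: "\<bar>\<gamma> y - \<gamma> x\<bar> \<le> L * norm (y - x)" if "x \<in> ball p r" "y \<in> ball p r" for x y
  proof -
    have "norm (\<gamma> y - \<gamma> x) \<le> L * norm (y - x)"
    proof (rule differentiable_bound[OF convex_ball])
      fix z assume z: "z \<in> ball p r"
      show "(\<gamma> has_derivative (\<lambda>h. grad \<gamma> z \<bullet> h)) (at z within ball p r)"
        using has_derivative_grad[OF diff_\<gamma>] by (rule has_derivative_at_withinI)
      show "onorm (\<lambda>h. grad \<gamma> z \<bullet> h) \<le> L"
      proof (rule onorm_le)
        fix h
        have "norm (grad \<gamma> z \<bullet> h) \<le> norm (grad \<gamma> z) * norm h" using Cauchy_Schwarz_ineq2 by simp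
        also have "\<dots> \<le> L * norm h" using L(2) z by (intro mult_right_mono) auto
        finally show "norm (grad \<gamma> z \<bullet> h) \<le> L * norm h" .
      qed
    qed (use that in auto)
    then show ?thesis by simp
  qed
  \<comment> \<open>With \<open>(L + 1) * \<delta> = t\<close>, the vertical gain s t covers both
    the rise of the graph, at most L s \<delta>, and the vertical loss s \<delta> due to the
    deviation \<open>k\<close>. A quarter of the radius keeps \<open>x\<close> and the two
    displacements, each of size at most \<open>t\<close>, inside the chart ball.\<close>
  define t where "t = r / 4"
  define \<delta> where "\<delta> = t / (L + 1)"
  have t: "t > 0" using r_pos by (simp add: t_def)
  have \<delta>: "\<delta> > 0" "\<delta> \<le> t" "(L + 1) * \<delta> = t" using t L(1) by (auto simp: \<delta>_def field_simps)
  have "x + s *\<^sub>R h \<in> \<Omega>" if x: "x \<in> \<Omega> \<inter> ball p t" and h: "h \<in> ball (t *\<^sub>R e) \<delta>" and s: "0 \<le> s" "s \<le> 1"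
    for x h and s :: real
  proof -
    define k where "k = h - t *\<^sub>R e"
    have k: "norm k < \<delta>" using h by (simp add: k_def dist_norm norm_minus_commute)
    have sk: "norm (s *\<^sub>R k) \<le> s * \<delta>" using k s by (simp add: mult_left_mono)
    have "s * \<delta> \<le> 1 * \<delta>" using s \<delta> by (intro mult_right_mono) auto
    with sk \<delta>(2) have skt: "norm (s *\<^sub>R k) \<le> t" by simp
    have hs: "x + s *\<^sub>R h = (x + s *\<^sub>R k) + (s * t) *\<^sub>R e" by (simp add: k_def algebra_simps)
    have "norm ((s * t) *\<^sub>R e) \<le> t" using s t by (simp add: norm_e mult_left_le_one_le)
    moreover have "dist p (x + s *\<^sub>R k) \<le> dist p x + norm (s *\<^sub>R k)"
      using dist_triangle[of p "x + s *\<^sub>R k" x] by (simp add: dist_norm)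
    moreover have "dist p (x + s *\<^sub>R h) \<le> dist p (x + s *\<^sub>R k) + norm ((s * t) *\<^sub>R e)"
      using dist_triangle[of p "x + s *\<^sub>R h" "x + s *\<^sub>R k"] unfolding hs by (simp add: dist_norm)
    ultimately have b: "x + s *\<^sub>R k \<in> ball p r" "x + s *\<^sub>R h \<in> ball p r" "x \<in> ball p r"
      using x skt t by (auto simp: t_def)
    have "\<gamma> (x + s *\<^sub>R h) = \<gamma> (x + s *\<^sub>R k)" unfolding hs by (rule inv)
    also have "\<dots> \<le> \<gamma> x + L * norm (s *\<^sub>R k)" using lip[OF b(3,1)] by simp
    also have "\<dots> \<le> \<gamma> x + L * (s * \<delta>)" using sk L(1) by simp
    also have "\<dots> < x \<bullet> e + L * (s * \<delta>)" using x \<Omega>_ball[OF b(3)] by (simp add: U_def)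
    also have "L * (s * \<delta>) = s * t - s * \<delta>" using arg_cong[OF \<delta>(3), of "\<lambda>x. s * x"] by (simp add: algebra_simps)
    also have "x \<bullet> e + (s * t - s * \<delta>) \<le> (x + s *\<^sub>R h) \<bullet> e"
    proof -
      have "\<bar>(s *\<^sub>R k) \<bullet> e\<bar> \<le> norm (s *\<^sub>R k)"
        using Cauchy_Schwarz_ineq2[of "s *\<^sub>R k" e] by (simp add: norm_e)
      then show ?thesis using sk unfolding hs by (simp add: inner_add_left)
    qed
    finally show ?thesis using \<Omega>_ball[OF b(2)] by (simp add: U_def)
  qed
  then show ?thesis using t \<delta>(1) by blast
qed

text \<open>Sums the cone estimates over a finite cover by balls with a common set of directions;
  overlaps only enlarge the right-hand side.\<close>

lemma L2_le_L1_grad: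
  "\<exists>K\<ge>0. \<forall>v. C1_closure \<Omega> v \<longrightarrow>
     dom_int (\<lambda>x. (v x)\<^sup>2) \<le> K * (dom_int (\<lambda>x. (norm (grad v x))\<^sup>2) + (dom_int (\<lambda>x. \<bar>v x\<bar>))\<^sup>2)"
proof -
  obtain \<rho> c \<delta> where pos: "\<And>p. p \<in> closure \<Omega> \<Longrightarrow> 0 < \<rho> p \<and> 0 < \<delta> p"
    and cone: "\<And>p x h s. p \<in> closure \<Omega> \<Longrightarrow> x \<in> \<Omega> \<inter> ball p (\<rho> p) \<Longrightarrow> h \<in> ball (c p) (\<delta> p) \<Longrightarrow> 0 \<le> s \<Longrightarrow> s \<le> 1 \<Longrightarrow> x + s *\<^sub>R h \<in> \<Omega>"
    using local_cone by metis
  have "closure \<Omega> \<subseteq> (\<Union>p\<in>closure \<Omega>. ball p (\<rho> p))" using pos by (auto intro!: bexI)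
  then obtain C where C: "C \<subseteq> closure \<Omega>" "finite C" "closure \<Omega> \<subseteq> (\<Union>p\<in>C. ball p (\<rho> p))"
    using compactE_image[OF compact_closure_dom, of "closure \<Omega>" "\<lambda>p. ball p (\<rho> p)"] by auto
  define H where "H p = ball (c p) (\<delta> p)" for p
  define M where "M p = norm (c p) + \<delta> p" for p
  \<comment> \<open>Division of the cone estimate by the measure of \<open>H p\<close> leaves this
    factor of the squared L1 norm in the first term; \<open>M p\<close> bounds the length of the
    directions.\<close>
  define k where "k p = 2 / measure lborel (H p) + (M p)\<^sup>2" for p
  have Hpos: "0 < measure lborel (H p)" if "p \<in> C" for p
    using pos[of p] C(1) that by (auto simp: H_def intro!: content_ball_pos)
  have "dom_int (\<lambda>x. (v x)\<^sup>2) \<le> (\<Sum>p\<in>C. k p) * (dom_int (\<lambda>x. (norm (grad v x))\<^sup>2) + (dom_int (\<lambda>x. \<bar>v x\<bar>))\<^sup>2)"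
    if v: "C1_closure \<Omega> v" for v
  proof -
    define S where "S = dom_int (\<lambda>x. (norm (grad v x))\<^sup>2) + (dom_int (\<lambda>x. \<bar>v x\<bar>))\<^sup>2"
    have g0: "0 \<le> dom_int (\<lambda>x. (norm (grad v x))\<^sup>2)" by (rule dom_int_nonneg) simp
    have vc: "continuous_on (closure \<Omega>) v" using C1_closureE[OF v] by metis
    have i2: "integrable lborel (\<lambda>x. indicator \<Omega> x * (v x)\<^sup>2)"
      by (rule integrable_closure[OF _ refl]) (intro continuous_intros vc)
    define I where "I p = (LINT x|lborel. indicator (\<Omega> \<inter> ball p (\<rho> p)) x * (v x)\<^sup>2)" for p
    have ii: "integrable lborel (\<lambda>x. indicator (\<Omega> \<inter> ball p (\<rho> p)) x * (v x)\<^sup>2)" for p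
      using integrable_mult_indicator[of "ball p (\<rho> p)" lborel, OF _ i2]
      by (simp add: indicator_inter_arith ac_simps)
    have "I p \<le> k p * S" if p: "p \<in> C" for p
    proof -
      have "measure lborel (H p) * I p \<le> 2 * (dom_int (\<lambda>x. \<bar>v x\<bar>))\<^sup>2 + (M p)\<^sup>2 * (measure lborel (H p) * dom_int (\<lambda>x. (norm (grad v x))\<^sup>2))"
        unfolding I_def
      proof (rule cone_estimate[OF v])
        show "emeasure lborel (H p) < \<infinity>" unfolding H_def by (rule emeasure_lborel_ball_finite)
        show "norm h \<le> M p" if "h \<in> H p" for h
          using that norm_triangle_sub[of h "c p"] by (simp add: H_def M_def dist_norm norm_minus_commute)
        show "x + s *\<^sub>R h \<in> \<Omega>" if "x \<in> \<Omega> \<inter> ball p (\<rho> p)" "h \<in> H p" "0 \<le> s" "s \<le> 1" for x h s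
          using cone[of p x h s] C(1) p that unfolding H_def by blast
      qed (auto simp: H_def)
      also have "\<dots> \<le> 2 * S + (M p)\<^sup>2 * (measure lborel (H p) * S)"
        using Hpos[OF p] g0 by (intro add_mono mult_left_mono) (auto simp: S_def)
      finally show ?thesis using Hpos[OF p] by (simp add: k_def field_simps)
    qed
    then have "(\<Sum>p\<in>C. I p) \<le> (\<Sum>p\<in>C. k p) * S" unfolding sum_distrib_right by (rule sum_mono)
    moreover have "dom_int (\<lambda>x. (v x)\<^sup>2) \<le> (\<Sum>p\<in>C. I p)"
      unfolding I_def dom_int_def Bochner_Integration.integral_sum[OF ii, symmetric]
    proof (rule integral_mono[OF i2])
      show "integrable lborel (\<lambda>x. \<Sum>p\<in>C. indicator (\<Omega> \<inter> ball p (\<rho> p)) x * (v x)\<^sup>2)"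
        by (intro Bochner_Integration.integrable_sum ii)
      fix x
      show "indicator \<Omega> x * (v x)\<^sup>2 \<le> (\<Sum>p\<in>C. indicator (\<Omega> \<inter> ball p (\<rho> p)) x * (v x)\<^sup>2)"
      proof (cases "x \<in> \<Omega>")
        case True
        then obtain p where p: "p \<in> C" "x \<in> ball p (\<rho> p)" using C(3) closure_subset by blast
        have "indicator (\<Omega> \<inter> ball p (\<rho> p)) x * (v x)\<^sup>2 \<le> (\<Sum>p\<in>C. indicator (\<Omega> \<inter> ball p (\<rho> p)) x * (v x)\<^sup>2)"
          using p(1) C(2) by (intro member_le_sum) auto
        then show ?thesis using True p(2) by simp
      qed (auto intro: sum_nonneg)
    qed
    ultimately show ?thesis by (simp add: S_def)
  qed
  moreover have "0 \<le> (\<Sum>p\<in>C. k p)" by (intro sum_nonneg) (simp add: k_def)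
  ultimately show ?thesis by blast
qed

theorem poincare_boundary:
  "\<exists>K\<ge>0. \<forall>v. C1_closure \<Omega> v \<longrightarrow>
     dom_int (\<lambda>x. (v x)\<^sup>2) \<le> K * (dom_int (\<lambda>x. (norm (grad v x))\<^sup>2) + (LINT x|\<sigma>. \<bar>v x\<bar>)\<^sup>2)"
proof -
  obtain K0 where K0: "K0 \<ge> 0" "\<And>v. C1_closure \<Omega> v \<Longrightarrow>
     dom_int (\<lambda>x. (v x)\<^sup>2) \<le> K0 * (dom_int (\<lambda>x. (norm (grad v x))\<^sup>2) + (dom_int (\<lambda>x. \<bar>v x\<bar>))\<^sup>2)"
    using L2_le_L1_grad by auto
  obtain K1 where K1: "K1 \<ge> 0" "\<And>v. C1_closure \<Omega> v \<Longrightarrow>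
     dom_int (\<lambda>x. \<bar>v x\<bar>) \<le> K1 * ((LINT x|\<sigma>. \<bar>v x\<bar>) + dom_int (\<lambda>x. norm (grad v x)))"
    using L1_le_boundary by auto
  \<comment> \<open>With a, b, g, g2 as named below: a^2 \<le> K1^2 (b + g)^2 \<le> 2 K1^2 (b^2 +
    g^2), and g^2 \<le> vol g2 by Cauchy-Schwarz.\<close>
  define K where "K = K0 * (1 + 2 * K1\<^sup>2 + 2 * K1\<^sup>2 * vol)"
  have "dom_int (\<lambda>x. (v x)\<^sup>2) \<le> K * (dom_int (\<lambda>x. (norm (grad v x))\<^sup>2) + (LINT x|\<sigma>. \<bar>v x\<bar>)\<^sup>2)"
    if v: "C1_closure \<Omega> v" for v
  proof -
    obtain G where G: "continuous_on (closure \<Omega>) G" "\<And>x. x \<in> \<Omega> \<Longrightarrow> G x = grad v x"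
      using C1_closureE[OF v] by metis
    define a b g g2 where "a = dom_int (\<lambda>x. \<bar>v x\<bar>)" and "b = (LINT x|\<sigma>. \<bar>v x\<bar>)"
      and "g = dom_int (\<lambda>x. norm (grad v x))" and "g2 = dom_int (\<lambda>x. (norm (grad v x))\<^sup>2)"
    have nn: "0 \<le> a" "0 \<le> b" "0 \<le> g" "0 \<le> g2"
      unfolding a_def b_def g_def g2_def by (auto intro!: dom_int_nonneg)
    have gg: "g\<^sup>2 \<le> vol * g2"
      using dom_int_abs_le[of "\<lambda>x. norm (G x)" "\<lambda>x. norm (grad v x)"] G
      by (simp add: g_def g2_def continuous_on_norm)
    have "a\<^sup>2 \<le> (K1 * (b + g))\<^sup>2" using K1(2)[OF v] nn(1) unfolding a_def b_def g_def by (intro power_mono)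
    also have "\<dots> \<le> K1\<^sup>2 * (2 * (b\<^sup>2 + g\<^sup>2))"
    proof -
      have "(b + g)\<^sup>2 \<le> 2 * (b\<^sup>2 + g\<^sup>2)" using sum_squares_bound[of b g] by (simp add: power2_sum)
      then show ?thesis unfolding power_mult_distrib by (rule mult_left_mono) simp
    qed
    also have "\<dots> \<le> K1\<^sup>2 * (2 * (b\<^sup>2 + vol * g2))" using gg by (intro mult_left_mono) auto
    finally have "g2 + a\<^sup>2 \<le> g2 + K1\<^sup>2 * (2 * (b\<^sup>2 + vol * g2))" by simp
    also have "\<dots> \<le> (1 + 2 * K1\<^sup>2 + 2 * K1\<^sup>2 * vol) * (g2 + b\<^sup>2)"
      using nn vol_nonneg by (simp add: algebra_simps)
    finally have "K0 * (g2 + a\<^sup>2) \<le> K0 * ((1 + 2 * K1\<^sup>2 + 2 * K1\<^sup>2 * vol) * (g2 + b\<^sup>2))"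
      using K0(1) by (rule mult_left_mono)
    then show ?thesis using K0(2)[OF v] unfolding a_def[symmetric] b_def[symmetric] g2_def[symmetric] K_def
      by (simp add: mult.assoc)
  qed
  moreover have "0 \<le> K" using K0(1) vol_nonneg by (simp add: K_def)
  ultimately show ?thesis by blast
qed

end

section \<open>Traces and the energy estimate\<close>

context smooth_domain
begin

text \<open>Continuity of the restriction to the boundary from the H1 norm to the L1 norm, which is
  what links an arbitrary approximating sequence in \<open>is_trace\<close> to the boundary values
  of its limit.\<close>

lemma L1_trace_H1:
  "\<exists>K\<ge>0. \<forall>v. C1_closure \<Omega> v \<longrightarrow> (LINT x|\<sigma>. \<bar>v x\<bar>) \<le> K * H1_norm \<Omega> v"
proof -
  obtain K where K: "K \<ge> 0" "\<And>v. C1_closure \<Omega> v \<Longrightarrow>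
     (LINT x|\<sigma>. \<bar>v x\<bar>) \<le> K * (dom_int (\<lambda>x. \<bar>v x\<bar>) + dom_int (\<lambda>x. norm (grad v x)))"
    using L1_trace by auto
  have "(LINT x|\<sigma>. \<bar>v x\<bar>) \<le> (K * (2 * sqrt vol)) * H1_norm \<Omega> v" if v: "C1_closure \<Omega> v" for v
  proof -
    obtain G where G: "continuous_on (closure \<Omega>) G" "\<And>x. x \<in> \<Omega> \<Longrightarrow> G x = grad v x"
      and vc: "continuous_on (closure \<Omega>) v" using C1_closureE[OF v] by metis
    let ?a = "dom_int (\<lambda>x. (v x)\<^sup>2)" and ?g = "dom_int (\<lambda>x. (norm (grad v x))\<^sup>2)"
    have nn: "0 \<le> ?a" "0 \<le> ?g" by (intro dom_int_nonneg; simp)+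
    have H: "H1_norm \<Omega> v = sqrt (?a + ?g)" by (rule H1_norm_C1_closure[OF v])
    have "dom_int (\<lambda>x. \<bar>v x\<bar>) \<le> sqrt (vol * ?a)"
      using dom_int_abs_le[OF vc refl] by (rule real_le_rsqrt)
    also have "\<dots> \<le> sqrt vol * H1_norm \<Omega> v"
      unfolding real_sqrt_mult H using nn vol_nonneg by (intro mult_left_mono real_sqrt_le_mono) auto
    finally have 1: "dom_int (\<lambda>x. \<bar>v x\<bar>) \<le> sqrt vol * H1_norm \<Omega> v" .
    have "(dom_int (\<lambda>x. norm (grad v x)))\<^sup>2 \<le> vol * ?g"
      using dom_int_abs_le[of "\<lambda>x. norm (G x)" "\<lambda>x. norm (grad v x)"] G by (simp add: continuous_on_norm)
    then have "dom_int (\<lambda>x. norm (grad v x)) \<le> sqrt (vol * ?g)" by (rule real_le_rsqrt)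
    also have "\<dots> \<le> sqrt vol * H1_norm \<Omega> v"
      unfolding real_sqrt_mult H using nn vol_nonneg by (intro mult_left_mono real_sqrt_le_mono) auto
    finally have "dom_int (\<lambda>x. \<bar>v x\<bar>) + dom_int (\<lambda>x. norm (grad v x)) \<le> 2 * sqrt vol * H1_norm \<Omega> v"
      using 1 by simp
    then have "K * (dom_int (\<lambda>x. \<bar>v x\<bar>) + dom_int (\<lambda>x. norm (grad v x))) \<le> K * (2 * sqrt vol * H1_norm \<Omega> v)"
      using K(1) by (rule mult_left_mono)
    then show ?thesis using K(2)[OF v] by (simp add: mult.assoc)
  qed
  moreover have "0 \<le> K * (2 * sqrt vol)" using K(1) vol_nonneg by simp
  ultimately show ?thesis by blast
qed

lemma H1_norm_0: "H1_norm \<Omega> (\<lambda>x. 0) = 0"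
proof -
  have g: "grad (\<lambda>x::'a. 0) = (\<lambda>x. 0)" by (rule ext) (simp add: grad_def)
  then have "C1_closure \<Omega> (\<lambda>x. 0)"
    unfolding C1_closure_def by (auto intro!: exI[of _ "\<lambda>x. 0"])
  then show ?thesis using H1_norm_C1_closure[of "\<lambda>x. 0"] by (simp add: g dom_int_def)
qed

text \<open>Triangle inequality through an approximating function: its distance to \<open>g\<close>
  tends to 0 in L2, hence in L1 since the surface measure is finite, and its distance to
  \<open>w\<close> is controlled by \<open>L1_trace_H1\<close>.\<close>

lemma is_trace_L1_le:
  assumes w: "C1_closure \<Omega> w" and g: "is_trace \<Omega> w g"
  shows "(LINT x|\<sigma>. \<bar>g x\<bar>) \<le> (LINT x|\<sigma>. \<bar>w x\<bar>)"
proof -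
  interpret finite_measure \<sigma> by (rule finite_surface_measure)
  obtain \<phi> where \<phi>: "\<And>j. C1_closure \<Omega> (\<phi> j)" "(\<lambda>j. H1_norm \<Omega> (\<lambda>x. \<phi> j x - w x)) \<longlonglongrightarrow> 0"
    "(\<lambda>j. LINT x|\<sigma>. (\<phi> j x - g x)\<^sup>2) \<longlonglongrightarrow> 0"
    and gm[measurable]: "g \<in> borel_measurable \<sigma>" and g2: "integrable \<sigma> (\<lambda>x. (g x)\<^sup>2)"
    using g unfolding is_trace_def by blast
  obtain K where K: "K \<ge> 0" "\<And>v. C1_closure \<Omega> v \<Longrightarrow> (LINT x|\<sigma>. \<bar>v x\<bar>) \<le> K * H1_norm \<Omega> v"
    using L1_trace_H1 by auto
  define s where "s = measure \<sigma> (frontier \<Omega>)"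
  have cl: "continuous_on (frontier \<Omega>) v" if "C1_closure \<Omega> v" for v
    using that continuous_on_subset[OF _ frontier_subset_closure] unfolding C1_closure_def by blast
  have gi: "integrable \<sigma> g"
  proof (rule Bochner_Integration.integrable_bound)
    show "integrable \<sigma> (\<lambda>x. 1 + (g x)\<^sup>2)" using g2 by simp
    have "\<bar>t\<bar> \<le> 1 + t\<^sup>2" for t :: real
    proof -
      have "2 * \<bar>t\<bar> \<le> t\<^sup>2 + 1" using sum_squares_bound[of "\<bar>t\<bar>" 1] by simp
      then show ?thesis using abs_ge_zero[of t] by linarith
    qed
    then show "AE x in \<sigma>. norm (g x) \<le> norm (1 + (g x)\<^sup>2)" by (intro AE_I2) simp
  qed simp
  have le: "(LINT x|\<sigma>. \<bar>g x\<bar>) \<le> sqrt (s * (LINT x|\<sigma>. (\<phi> j x - g x)\<^sup>2)) + K * H1_norm \<Omega> (\<lambda>x. \<phi> j x - w x) + (LINT x|\<sigma>. \<bar>w x\<bar>)" for j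
  proof -
    have d: "C1_closure \<Omega> (\<lambda>x. \<phi> j x - w x)" by (rule C1_closure_diff[OF open_dom \<phi>(1) w])
    have ij: "integrable \<sigma> (\<phi> j)" "integrable \<sigma> (\<lambda>x. (\<phi> j x)\<^sup>2)" "integrable \<sigma> w"
      by (intro integrable_surface_continuous continuous_intros cl \<phi>(1) w)+
    have \<phi>m[measurable]: "\<phi> j \<in> borel_measurable \<sigma>" using ij(1) by simp
    have "(LINT x|\<sigma>. \<bar>g x\<bar>) \<le> (LINT x|\<sigma>. \<bar>\<phi> j x - g x\<bar> + \<bar>\<phi> j x - w x\<bar> + \<bar>w x\<bar>)"
      using gi ij by (intro integral_mono) auto
    also have "\<dots> = (LINT x|\<sigma>. \<bar>\<phi> j x - g x\<bar>) + (LINT x|\<sigma>. \<bar>\<phi> j x - w x\<bar>) + (LINT x|\<sigma>. \<bar>w x\<bar>)"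
      using gi ij by simp
    also have "(LINT x|\<sigma>. \<bar>\<phi> j x - w x\<bar>) \<le> K * H1_norm \<Omega> (\<lambda>x. \<phi> j x - w x)" by (rule K(2)[OF d])
    also have "(LINT x|\<sigma>. \<bar>\<phi> j x - g x\<bar>) \<le> sqrt (s * (LINT x|\<sigma>. (\<phi> j x - g x)\<^sup>2))"
    proof (rule real_le_rsqrt)
      have i2: "integrable \<sigma> (\<lambda>x. (\<phi> j x - g x)\<^sup>2)"
      proof (rule Bochner_Integration.integrable_bound)
        show "integrable \<sigma> (\<lambda>x. 2 * (\<phi> j x)\<^sup>2 + 2 * (g x)\<^sup>2)" using ij g2 by simp
        have "(a - b)\<^sup>2 \<le> 2 * a\<^sup>2 + 2 * b\<^sup>2" for a b :: real
          using zero_le_power2[of "a + b"] by (simp add: power2_sum power2_diff)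
        then show "AE x in \<sigma>. norm ((\<phi> j x - g x)\<^sup>2) \<le> norm (2 * (\<phi> j x)\<^sup>2 + 2 * (g x)\<^sup>2)"
          by (intro AE_I2) simp
      qed measurable
      have "(LINT x|\<sigma>. 1 * \<bar>\<phi> j x - g x\<bar>)\<^sup>2 \<le> (LINT x|\<sigma>. 1\<^sup>2) * (LINT x|\<sigma>. (\<bar>\<phi> j x - g x\<bar>)\<^sup>2)"
        using gi ij i2 by (intro integral_Cauchy_Schwarz) auto
      then show "(LINT x|\<sigma>. \<bar>\<phi> j x - g x\<bar>)\<^sup>2 \<le> s * (LINT x|\<sigma>. (\<phi> j x - g x)\<^sup>2)"
        by (simp add: s_def space_surface_measure)
    qed
    finally show ?thesis by simp
  qed
  have "(\<lambda>j. sqrt (s * (LINT x|\<sigma>. (\<phi> j x - g x)\<^sup>2)) + K * H1_norm \<Omega> (\<lambda>x. \<phi> j x - w x) + (LINT x|\<sigma>. \<bar>w x\<bar>))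
      \<longlonglongrightarrow> sqrt (s * 0) + K * 0 + (LINT x|\<sigma>. \<bar>w x\<bar>)"
    by (intro tendsto_intros \<phi>(2,3))
  then have "(\<lambda>j. sqrt (s * (LINT x|\<sigma>. (\<phi> j x - g x)\<^sup>2)) + K * H1_norm \<Omega> (\<lambda>x. \<phi> j x - w x) + (LINT x|\<sigma>. \<bar>w x\<bar>))
      \<longlonglongrightarrow> (LINT x|\<sigma>. \<bar>w x\<bar>)" by simp
  then show ?thesis by (rule LIMSEQ_le_const) (use le in blast)
qed

text \<open>The constant sequence shows that \<open>w\<close> is a trace of itself, so the choice in
  \<open>trace_on\<close> does return a trace.\<close>

lemma trace_on_L1_le:
  assumes w: "C1_closure \<Omega> w"
  shows "(LINT x|\<sigma>. \<bar>trace_on \<Omega> w x\<bar>) \<le> (LINT x|\<sigma>. \<bar>w x\<bar>)"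
proof -
  have wc: "continuous_on (frontier \<Omega>) w"
    using w continuous_on_subset[OF _ frontier_subset_closure] unfolding C1_closure_def by blast
  have "is_trace \<Omega> w w"
    unfolding is_trace_def
    by (intro conjI exI[of _ "\<lambda>_. w"] borel_measurable_surface wc integrable_surface_continuous continuous_intros)
      (simp_all add: w H1_norm_0)
  then have "is_trace \<Omega> w (trace_on \<Omega> w)" unfolding trace_on_def by (rule someI[of "is_trace \<Omega> w"])
  then show ?thesis by (rule is_trace_L1_le[OF w])
qed

lemma normal_derivative_eq:
  assumes G: "continuous_on (closure \<Omega>) G" "\<And>x. x \<in> \<Omega> \<Longrightarrow> G x = grad w x" and x: "x \<in> frontier \<Omega>"
  shows "normal_derivative \<Omega> w x = G x \<bullet> outward_normal \<Omega> x"
proof -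
  have xc: "x \<in> closure \<Omega>" using x frontier_subset_closure by blast
  \<comment> \<open>A boundary point does not belong to the open set \<Omega>, so it is a limit
    point; the limit in \<open>normal_derivative\<close> is then unique and equals the extended
    gradient.\<close>
  then have "x islimpt \<Omega>" using frontier_disjoint[OF x] by (simp add: closure_def)
  then have nt: "\<not> trivial_limit (at x within \<Omega>)" by (simp add: trivial_limit_within)
  have "(G \<longlongrightarrow> G x) (at x within closure \<Omega>)" using G(1) xc by (simp add: continuous_on_def)
  then have "(G \<longlongrightarrow> G x) (at x within \<Omega>)" using closure_subset by (rule tendsto_within_subset)
  moreover have "\<forall>\<^sub>F y in at x within \<Omega>. G y = grad w y"
    using G(2) by (auto simp: eventually_at_filter)
  ultimately have "(grad w \<longlongrightarrow> G x) (at x within \<Omega>)" by (rule Lim_transform_eventually)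
  then show ?thesis by (simp add: normal_derivative_def tendsto_Lim[OF nt])
qed

section \<open>The Robin problem tested with its own solution\<close>

lemma energy_step:
  assumes m: "m > 0" and u: "continuous_on (closure \<Omega>) u"
    and h: "\<And>x. x \<in> frontier \<Omega> \<Longrightarrow> h x = m * \<bar>u x\<bar> / (LINT y|\<sigma>. \<bar>u y\<bar>)"
    and w: "robin_solution \<Omega> h (\<lambda>x. l * u x) w"
  shows "dom_int (\<lambda>x. (norm (grad w x))\<^sup>2) + 1 / m * (LINT x|\<sigma>. \<bar>w x\<bar>)\<^sup>2 \<le> l * dom_int (\<lambda>x. u x * w x)"
proof -
  have w2: "Ck_on (Suc 1) \<Omega> w" and wC: "C1_closure \<Omega> w"
    and lap: "\<And>x. x \<in> \<Omega> \<Longrightarrow> - laplacian w x = l * u x"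
    and rob: "\<And>x. x \<in> frontier \<Omega> \<Longrightarrow> w x + h x * normal_derivative \<Omega> w x = 0"
    using w unfolding robin_solution_def by (auto simp: numeral_2_eq_2 simp del: Ck_on.simps)
  obtain G where G: "continuous_on (closure \<Omega>) G" "\<And>x. x \<in> \<Omega> \<Longrightarrow> G x = grad w x"
    and w1: "Ck_on 1 \<Omega> w" and wc: "continuous_on (closure \<Omega>) w" using C1_closureE[OF wC] by metis
  have pb: "(\<lambda>y. grad w y \<bullet> b) = partial_deriv b w" if "b \<in> Basis" for b
    by (rule ext) (rule grad_inner[OF that])
  have gC: "C1_field \<Omega> (grad w)"
    unfolding C1_field_def using w2 pb by (simp only: Ck_on.simps(2)) auto
  have dg: "divergence (grad w) x = laplacian w x" for x
    unfolding divergence_def laplacian_def by (rule sum.cong) (simp_all add: pb grad_inner)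
  \<comment> \<open>The extension \<open>G\<close> replaces \<open>grad w\<close>, so that the field
    is continuous up to the boundary.\<close>
  define X where "X x = w x *\<^sub>R G x" for x
  have Xc: "continuous_on (closure \<Omega>) X" unfolding X_def by (intro continuous_intros wc G(1))
  have XG: "X x = w x *\<^sub>R grad w x" if "x \<in> \<Omega>" for x using G(2)[OF that] by (simp add: X_def)
  have X1: "C1_field \<Omega> X"
    using C1_field_cong[OF open_dom XG] C1_field_scale[OF open_dom w1 gC] by simp
  \<comment> \<open>The second derivatives of \<open>w\<close> enter only through the Laplacian. By
    the equation the divergence is an expression with a continuous extension to the closure, hence
    bounded.\<close>
  have dX: "divergence X x = (norm (grad w x))\<^sup>2 + (- l) * (u x * w x)" if x: "x \<in> \<Omega>" for x
  proof -
    have "divergence X x = divergence (\<lambda>x. w x *\<^sub>R grad w x) x" by (rule divergence_cong[OF open_dom XG x])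
    also have "\<dots> = w x * laplacian w x + grad w x \<bullet> grad w x"
      unfolding divergence_scale[OF w1 gC x] dg ..
    also have "laplacian w x = - (l * u x)" using lap[OF x] by simp
    finally show ?thesis by (simp add: power2_norm_eq_inner)
  qed
  have "continuous_on (closure \<Omega>) (\<lambda>x. (norm (G x))\<^sup>2 + (- l) * (u x * w x))"
    by (intro continuous_intros G(1) u wc)
  from bounded_on_closure[OF this]
  obtain M where M: "\<forall>x\<in>closure \<Omega>. norm ((norm (G x))\<^sup>2 + (- l) * (u x * w x)) \<le> M" by blast
  have dM: "\<bar>divergence X x\<bar> \<le> M" if "x \<in> \<Omega>" for x
  proof -
    have "x \<in> closure \<Omega>" using that closure_subset by blast
    with M have "norm ((norm (G x))\<^sup>2 + (- l) * (u x * w x)) \<le> M" by (rule bspec)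
    then show ?thesis using dX[OF that] G(2)[OF that] by simp
  qed
  define N where "N x = G x \<bullet> outward_normal \<Omega> x" for x
  have Nc: "continuous_on (frontier \<Omega>) N" unfolding N_def by (rule continuous_surface_flux[OF G(1)])
  have uf: "continuous_on (frontier \<Omega>) u" by (rule continuous_on_subset[OF u frontier_subset_closure])
  define I where "I = (LINT y|\<sigma>. \<bar>u y\<bar>)"
  have I: "0 \<le> I" by (simp add: I_def)
  \<comment> \<open>The values of \<open>h\<close> are prescribed on the boundary only;
    \<open>k\<close> is the same formula on the whole space.\<close>
  define k where "k x = m * \<bar>u x\<bar> / I" for x
  have k0: "0 \<le> k x" for x using I m by (simp add: k_def)
  have kc: "continuous_on (frontier \<Omega>) k"
    unfolding k_def divide_inverse by (intro continuous_intros uf)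
  have wN: "w x = - (k x * N x)" if x: "x \<in> frontier \<Omega>" for x
    using rob[OF x] h[OF x] normal_derivative_eq[OF G x] by (simp add: k_def I_def N_def)
  define J where "J = (LINT x|\<sigma>. k x * (N x)\<^sup>2)"
  have "(LINT x|\<sigma>. X x \<bullet> outward_normal \<Omega> x) = (LINT x|\<sigma>. - (k x * (N x)\<^sup>2))"
    using wN by (intro Bochner_Integration.integral_cong)
      (auto simp: space_surface_measure X_def N_def[symmetric] power2_eq_square)
  also have "\<dots> = - J" by (simp add: J_def)
  finally have flux: "dom_int (divergence X) = - J"
    using divergence_theorem[OF Xc X1 dM] by (simp add: dom_int_def)
  have "dom_int (divergence X) = dom_int (\<lambda>x. (norm (grad w x))\<^sup>2 + (- l) * (u x * w x))"
    unfolding dom_int_def using dX by (intro Bochner_Integration.integral_cong) (auto simp: indicator_def)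
  also have "\<dots> = dom_int (\<lambda>x. (norm (grad w x))\<^sup>2) + dom_int (\<lambda>x. (- l) * (u x * w x))"
  proof (rule dom_int_add)
    show "integrable lborel (\<lambda>x. indicator \<Omega> x * (norm (grad w x))\<^sup>2)"
      by (rule integrable_closure[of "\<lambda>x. (norm (G x))\<^sup>2"]) (auto intro!: continuous_intros G(1) simp: G(2))
    show "integrable lborel (\<lambda>x. indicator \<Omega> x * ((- l) * (u x * w x)))"
      by (rule integrable_closure[OF _ refl]) (intro continuous_intros u wc)
  qed
  finally have id: "dom_int (\<lambda>x. (norm (grad w x))\<^sup>2) + J = l * dom_int (\<lambda>x. u x * w x)"
    unfolding dom_int_cmult flux by simp
  have "(LINT x|\<sigma>. \<bar>w x\<bar>)\<^sup>2 \<le> m * J"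
  proof -
    \<comment> \<open>The integrand \<open>k x * \<bar>N x\<bar>\<close>, which equals
      \<open>\<bar>w x\<bar>\<close> on the boundary, is split into \<open>sqrt (k x)\<close> and
      \<open>sqrt (k x) * \<bar>N x\<bar>\<close>; the squares integrate to the total of
      \<open>k\<close> and to \<open>J\<close>.\<close>
    have sq: "(sqrt (k x))\<^sup>2 = k x" "(sqrt (k x) * \<bar>N x\<bar>)\<^sup>2 = k x * (N x)\<^sup>2"
      "sqrt (k x) * (sqrt (k x) * \<bar>N x\<bar>) = k x * \<bar>N x\<bar>" for x
      using k0[of x] by (simp_all add: power_mult_distrib mult.assoc[symmetric])
    have "(LINT x|\<sigma>. sqrt (k x) * (sqrt (k x) * \<bar>N x\<bar>))\<^sup>2
        \<le> (LINT x|\<sigma>. (sqrt (k x))\<^sup>2) * (LINT x|\<sigma>. (sqrt (k x) * \<bar>N x\<bar>)\<^sup>2)"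
      by (intro integral_Cauchy_Schwarz integrable_surface_continuous continuous_intros kc Nc)
    then have "(LINT x|\<sigma>. k x * \<bar>N x\<bar>)\<^sup>2 \<le> (LINT x|\<sigma>. k x) * J" unfolding sq J_def .
    moreover have "(LINT x|\<sigma>. \<bar>w x\<bar>) = (LINT x|\<sigma>. k x * \<bar>N x\<bar>)"
      using wN k0 by (intro Bochner_Integration.integral_cong) (auto simp: space_surface_measure abs_mult)
    moreover have "(LINT x|\<sigma>. k x) \<le> m"
    proof -
      \<comment> \<open>If \<open>I\<close> is zero, division by it gives 0 and so does the product;
        otherwise the product is \<open>m\<close>. This is why the next line is an
        inequality.\<close>
      have "(LINT x|\<sigma>. k x) = m / I * I" unfolding k_def by (simp add: I_def)
      also have "\<dots> \<le> m" using m by simp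
      finally show ?thesis .
    qed
    moreover have "0 \<le> J" unfolding J_def using k0 by (intro Bochner_Integration.integral_nonneg) simp
    ultimately show ?thesis by (metis mult_right_mono order_trans)
  qed
  then have "1 / m * (LINT x|\<sigma>. \<bar>w x\<bar>)\<^sup>2 \<le> J" using m by (simp add: field_simps)
  with id show ?thesis by simp
qed

end

section \<open>Boundedness of the iterates\<close>

theorem proposition4p2:
  fixes \<Omega> :: "(real ^ 'n::finite) set"
    and m :: real
    and u h :: "nat \<Rightarrow> real ^ 'n \<Rightarrow> real"
  assumes "CARD('n) \<ge> 2"
    and "smooth_bounded_domain \<Omega>"
    and "m > 0"
    and "Ck_on 1 \<Omega> (u 0)" and "Linf_on \<Omega> (u 0)" and "u 0 \<in> H1 \<Omega>"
    and "continuous_on (closure \<Omega>) (u 0)" and "\<forall>x\<in>closure \<Omega>. u 0 x > 0"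
    and "C1_hypersurface (frontier \<Omega>) (u 0)"
    and "\<forall>k. \<forall>x\<in>frontier \<Omega>. h k x = m * \<bar>u k x\<bar> / (LINT y|surface_measure \<Omega>. \<bar>u k y\<bar>)"
    and "\<forall>k. robin_solution \<Omega> (h k) (\<lambda>x. rayleigh \<Omega> m (u k) * u k x) (u (Suc k))"
  shows "\<exists>C. \<forall>k\<ge>1. u k \<in> H1 \<Omega> \<and> H1_norm \<Omega> (u k) \<le> C"
proof -
  interpret smooth_domain \<Omega> by standard (rule assms(2))
  have m: "m > 0" by (rule assms(3))
  have uC: "C1_closure \<Omega> (u (Suc k))" for k
    using assms(11) by (simp add: robin_solution_def)
  have uc: "continuous_on (closure \<Omega>) (u k)" for k
    using assms(7) uC by (cases k) (auto simp: C1_closure_def)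
  define a where "a k = sqrt (dom_int (\<lambda>x. (u k x)\<^sup>2))" for k
  define g where "g k = dom_int (\<lambda>x. (norm (grad (u k) x))\<^sup>2)" for k
  define E where "E k = g k + 1 / m * (LINT x|\<sigma>. \<bar>u k x\<bar>)\<^sup>2" for k
  \<comment> \<open>At index 0 only \<open>l 0 * a 0\<close> enters the bounds; the trace and
    Poincare estimates are applied from \<open>Suc k\<close> on, where \<open>C1_closure\<close> is
    available.\<close>
  define l where "l k = rayleigh \<Omega> m (u k)" for k
  have g0: "0 \<le> g k" for k unfolding g_def by (rule dom_int_nonneg) simp
  have d0: "0 \<le> dom_int (\<lambda>x. (u k x)\<^sup>2)" for k by (rule dom_int_nonneg) simp
  have a0: "0 \<le> a k" "(a k)\<^sup>2 = dom_int (\<lambda>x. (u k x)\<^sup>2)" for k using d0 by (auto simp: a_def)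
  have l0: "0 \<le> l k" for k
    unfolding l_def rayleigh_def using m
    by (intro divide_nonneg_nonneg add_nonneg_nonneg mult_nonneg_nonneg Bochner_Integration.integral_nonneg) auto
  have step: "E (Suc k) \<le> l k * a k * a (Suc k)" for k
  proof -
    have "E (Suc k) \<le> l k * dom_int (\<lambda>x. u k x * u (Suc k) x)"
      unfolding E_def g_def l_def
    proof (rule energy_step[where h="h k", OF m uc])
      show "h k x = m * \<bar>u k x\<bar> / (LINT y|\<sigma>. \<bar>u k y\<bar>)" if "x \<in> frontier \<Omega>" for x
        using assms(10) that by simp
      show "robin_solution \<Omega> (h k) (\<lambda>x. rayleigh \<Omega> m (u k) * u k x) (u (Suc k))" using assms(11) ..
    qed
    moreover have "dom_int (\<lambda>x. u k x * u (Suc k) x) \<le> a k * a (Suc k)"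
    proof (rule power2_le_imp_le)
      show "(dom_int (\<lambda>x. u k x * u (Suc k) x))\<^sup>2 \<le> (a k * a (Suc k))\<^sup>2"
        using dom_int_Cauchy_Schwarz[OF uc refl uc refl] by (simp add: power_mult_distrib a0(2))
      show "0 \<le> a k * a (Suc k)" using a0(1) by simp
    qed
    then have "l k * dom_int (\<lambda>x. u k x * u (Suc k) x) \<le> l k * (a k * a (Suc k))"
      using l0 by (rule mult_left_mono)
    ultimately show ?thesis by (simp add: mult.assoc)
  qed
  have ray: "l (Suc k) * (a (Suc k))\<^sup>2 \<le> E (Suc k)" for k
  proof -
    let ?n = "g (Suc k) + 1 / m * (LINT x|\<sigma>. \<bar>trace_on \<Omega> (u (Suc k)) x\<bar>)\<^sup>2"
    have "l (Suc k) = ?n / (a (Suc k))\<^sup>2"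
      unfolding l_def rayleigh_def g_def a0(2) C1_closure_in_H1(2,3)[OF uC] ..
    moreover have "0 \<le> ?n" using g0 m by simp
    \<comment> \<open>If the norm is zero the left side is 0; otherwise the division
      cancels.\<close>
    ultimately have "l (Suc k) * (a (Suc k))\<^sup>2 \<le> ?n" by (cases "a (Suc k) = 0") auto
    also have "\<dots> \<le> E (Suc k)"
      unfolding E_def using m trace_on_L1_le[OF uC]
      by (intro add_left_mono mult_left_mono power_mono Bochner_Integration.integral_nonneg) auto
    finally show ?thesis .
  qed
  \<comment> \<open>Combining \<open>ray\<close> and \<open>step\<close> bounds
    \<open>l (Suc k) * (a (Suc k))\<^sup>2\<close> by \<open>l k * a k * a (Suc k)\<close>; one
    factor \<open>a (Suc k)\<close> is cancelled.\<close>
  have mono: "l (Suc k) * a (Suc k) \<le> l k * a k" for k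
  proof (cases "a (Suc k) = 0")
    case True
    then show ?thesis using l0 a0(1) by simp
  next
    case False
    then have "0 < a (Suc k)" using a0(1)[of "Suc k"] by simp
    moreover have "(l (Suc k) * a (Suc k)) * a (Suc k) \<le> (l k * a k) * a (Suc k)"
      using order_trans[OF ray step] by (simp add: power2_eq_square mult.assoc)
    ultimately show ?thesis by (rule mult_right_le_imp_le[rotated])
  qed
  define c where "c = l 0 * a 0"
  have lc: "l k * a k \<le> c" for k
    by (induction k) (auto simp: c_def intro: order_trans[OF mono])
  have c0: "0 \<le> c" using l0 a0(1) by (simp add: c_def)
  obtain K0 where K0: "K0 \<ge> 0" "\<And>v. C1_closure \<Omega> v \<Longrightarrow>
     dom_int (\<lambda>x. (v x)\<^sup>2) \<le> K0 * (dom_int (\<lambda>x. (norm (grad v x))\<^sup>2) + (LINT x|\<sigma>. \<bar>v x\<bar>)\<^sup>2)"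
    using poincare_boundary by auto
  \<comment> \<open>The factor \<open>1 + m\<close> compensates the weight 1/m of the boundary term
    in \<open>E\<close>.\<close>
  define K where "K = K0 * (1 + m)"
  have K: "K \<ge> 0" using K0(1) m by (simp add: K_def)
  have Ec: "E (Suc k) \<le> c * a (Suc k)" for k
    using step[of k] mult_right_mono[OF lc[of k] a0(1)[of "Suc k"]] by linarith
  have poinc: "(a (Suc k))\<^sup>2 \<le> K * E (Suc k)" for k
  proof -
    let ?b = "(LINT x|\<sigma>. \<bar>u (Suc k) x\<bar>)\<^sup>2"
    have "g (Suc k) + ?b \<le> (1 + m) * E (Suc k)"
      unfolding E_def using g0[of "Suc k"] m by (simp add: field_simps)
    then have "K0 * (g (Suc k) + ?b) \<le> K0 * ((1 + m) * E (Suc k))" using K0(1) by (rule mult_left_mono)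
    then show ?thesis using K0(2)[OF uC[of k]] unfolding a0(2) K_def g_def by (simp add: mult.assoc)
  qed
  \<comment> \<open>From a^2 \<le> K E \<le> K c a, with one factor a cancelled: the energy bound is
    linear in the norm, while the Poincare inequality is quadratic.\<close>
  have abound: "a (Suc k) \<le> K * c" for k
  proof (cases "a (Suc k) = 0")
    case True
    then show ?thesis using K c0 by simp
  next
    case False
    then have "0 < a (Suc k)" using a0(1)[of "Suc k"] by simp
    moreover have "a (Suc k) * a (Suc k) \<le> (K * c) * a (Suc k)"
      using order_trans[OF poinc mult_left_mono[OF Ec K]] by (simp add: power2_eq_square mult.assoc)
    ultimately show ?thesis by (rule mult_right_le_imp_le[rotated])
  qed
  \<comment> \<open>The first summand bounds the squared L2 norm through \<open>abound\<close>, the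
    second bounds the gradient part through \<open>Ec\<close> and \<open>abound\<close>.\<close>
  have "H1_norm \<Omega> (u (Suc k)) \<le> sqrt ((K * c)\<^sup>2 + c * (K * c))" for k
  proof -
    have "g (Suc k) \<le> E (Suc k)" unfolding E_def using m by simp
    also have "\<dots> \<le> c * (K * c)" using Ec[of k] mult_left_mono[OF abound[of k] c0] by linarith
    finally have "g (Suc k) \<le> c * (K * c)" .
    moreover have "(a (Suc k))\<^sup>2 \<le> (K * c)\<^sup>2" using abound a0(1) by (rule power_mono)
    ultimately show ?thesis
      unfolding H1_norm_C1_closure[OF uC] a0(2)[symmetric] g_def[symmetric] by (intro real_sqrt_le_mono) linarith
  qed
  then have "\<forall>k\<ge>1. u k \<in> H1 \<Omega> \<and> H1_norm \<Omega> (u k) \<le> sqrt ((K * c)\<^sup>2 + c * (K * c))"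
    using C1_closure_in_H1(1)[OF uC] by (metis One_nat_def Suc_le_D)
  then show ?thesis by blast
qed

end
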